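(* The sure reachability problem and the sure repeated reachability problem are decidable for 1-VASS-MDPs.
   Context: A VASS-MDP of dimension $d\ge 0$ is a tuple $S=\langle Q,Q_1,Q_P,T,\tau\rangle$ where $Q$ is a finite set of control states partitioned into $Q_1$ (Player 1) and $Q_P$ (probabilistic), $T\subseteq Q\times\mathbb{Z}^d\times Q$ is finite, and $\tau:T\to\mathbb{N}_{>0}$. Configurations are $\langle q,\mathbf{v}\rangle\in Q\times\mathbb{N}^d$; $t=\langle q,\mathbf{z},q'\rangle$ is enabled in $\langle q,\mathbf{v}\rangle$ if $\mathbf{v}+\mathbf{z}\in\mathbb{N}^d$ and leads to $\langle q',\mathbf{v}+\mathbf{z}\rangle$. The induced MDP $M_S=\langle C,C_1,C_P,\rightarrow,p\rangle$ has $C=Q\times\mathbb{N}^d$, $C_1=Q_1\times\mathbb{N}^d$, $C_P=Q_P\times\mathbb{N}^d$, $c\rightarrow c'$ iff $c'$ is obtained from $c$ by an enabled transition, and for $c\in C_P$, $p(c)(c')$ is the total weight of enabled transitions from $c$ leading to $c'$ divided by the total weight of transitions enabled in $c$. A configuration without successor is a deadlock. A 1-VASS-MDP is a VASS-MDP in which every transition $\langle q,\mathbf{z},q'\rangle$ with $q\in Q_P$ has $\mathbf{z}=\mathbf{0}$ (only Player 1 changes counters). A strategy $\sigma$ of Player 1 maps each finite play ending in a non-deadlock $c\in C_1$ to a successor of $c$; $\mathrm{Outcome}(M_S,c,\sigma)$ is the set of maximal plays (infinite or ending in a deadlock) from $c$ consistent with $\sigma$. For $q_F\in Q$, $[\![\Diamond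 q_F]\!]$ is the set of plays visiting control state $q_F$, and $[\![\Box\Diamond q_F]\!]$ the set of infinite plays visiting it infinitely often. The sure (resp. sure repeated) reachability problem asks, given $S$, an initial configuration $c_0$ and $q_F$, whether some $\sigma$ satisfies $\mathrm{Outcome}(M_S,c_0,\sigma)\subseteq[\![\Diamond q_F]\!]$ (resp. $\subseteq[\![\Box\Diamond q_F]\!]$). *)

theory Defs
  imports Complex_Main "HOL-Library.Nat_Bijection"
begin

section \<open>Recursive functions and decidable sets of numbers\<close>

datatype recf = Zero | Succ | Proj nat | Comp recf "recf list" | Prec recf recf | Mu recf

text \<open>\<open>computes f xs y\<close> means that the partial recursive function denoted by \<open>f\<close> is defined on the
  arguments \<open>xs\<close> and has the value \<open>y\<close> there. In primitive recursion and minimisation the recursion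
  variable is the first argument; minimisation requires all smaller values to be defined.\<close>

inductive computes :: "recf \<Rightarrow> nat list \<Rightarrow> nat \<Rightarrow> bool" where
  zero: "computes Zero xs 0"
| succ: "computes Succ [x] (Suc x)"
| proj: "i < length xs \<Longrightarrow> computes (Proj i) xs (xs ! i)"
| comp: "list_all2 (\<lambda>g y. computes g xs y) gs ys \<Longrightarrow> computes f ys z
    \<Longrightarrow> computes (Comp f gs) xs z"
| prec_0: "computes f xs y \<Longrightarrow> computes (Prec f g) (0 # xs) y"
| prec_Suc: "computes (Prec f g) (n # xs) r \<Longrightarrow> computes g (n # r # xs) y
    \<Longrightarrow> computes (Prec f g) (Suc n # xs) y"
| mu: "computes f (n # xs) 0 \<Longrightarrow> (\<forall>m<n. \<exists>k. computes f (m # xs) (Suc k))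
    \<Longrightarrow> computes (Mu f) xs n"

inductive_cases computes_ZeroE: "computes Zero xs y"
inductive_cases computes_SuccE: "computes Succ xs y"
inductive_cases computes_ProjE: "computes (Proj i) xs y"
inductive_cases computes_CompE: "computes (Comp f gs) xs y"
inductive_cases computes_Prec_0E: "computes (Prec f g) (0 # xs) y"
inductive_cases computes_Prec_SucE: "computes (Prec f g) (Suc n # xs) y"
inductive_cases computes_MuE: "computes (Mu f) xs y"

lemma computes_deterministic:
  "computes f xs y \<Longrightarrow> computes f xs z \<Longrightarrow> y = z"
proof (induction arbitrary: z rule: computes.induct)
  case (zero xs)
  then show ?case by (rule computes_ZeroE) simp
next
  case (succ x)
  then show ?case by (rule computes_SuccE) simp
next
  case (proj i xs)
  from proj.prems show ?case by (rule computes_ProjE) simp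
next
  case (comp xs gs ys f z z')
  from comp.prems obtain ys' where 1: "list_all2 (\<lambda>g y. computes g xs y) gs ys'"
    and 2: "computes f ys' z'" by (rule computes_CompE)
  have "ys = ys'"
  proof (rule nth_equalityI)
    show "length ys = length ys'"
      using comp.IH(1)[THEN list_all2_lengthD] 1[THEN list_all2_lengthD] by simp
  next
    fix i assume "i < length ys"
    then show "ys ! i = ys' ! i" using comp.IH(1) 1 by (simp add: list_all2_conv_all_nth)
  qed
  then show ?case using comp.IH(2) 2 by simp
next
  case (prec_0 f xs y g)
  from prec_0.prems have "computes f xs z" by (rule computes_Prec_0E)
  then show ?case by (rule prec_0.IH)
next
  case (prec_Suc f g n xs r y)
  from prec_Suc.prems obtain r' where "computes (Prec f g) (n # xs) r'" "computes g (n # r' # xs) z"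
    by (rule computes_Prec_SucE)
  then show ?case using prec_Suc.IH by simp
next
  case (mu f n xs)
  from mu.prems have 1: "computes f (z # xs) 0" and 2: "\<forall>m<z. \<exists>k. computes f (m # xs) (Suc k)"
    by (rule computes_MuE, simp)+
  show ?case
  proof (rule linorder_cases[of n z])
    assume "n < z"
    with 2 obtain k where "computes f (n # xs) (Suc k)" by blast
    then have "0 = Suc k" by (rule mu.IH(1))
    then show ?thesis by simp
  next
    assume "z < n"
    with mu.IH(2) obtain k where "\<forall>x. computes f (z # xs) x \<longrightarrow> Suc k = x" by blast
    with 1 show ?thesis by blast
  qed simp
qed

definition decidable :: "nat set \<Rightarrow> bool" where
  "decidable A \<longleftrightarrow> (\<exists>f. \<forall>n. computes f [n] (if n \<in> A then 1 else 0))"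

section \<open>Markov decision processes\<close>

text \<open>The value \<open>prob M c c'\<close> is meaningful only for \<open>c \<in> confsP M\<close> that is not a deadlock.\<close>

record 'c mdp =
  confs :: "'c set"
  confs1 :: "'c set"
  confsP :: "'c set"
  edges :: "('c \<times> 'c) set"
  prob :: "'c \<Rightarrow> 'c \<Rightarrow> real"

definition deadlock :: "'c mdp \<Rightarrow> 'c \<Rightarrow> bool" where
  "deadlock M c \<longleftrightarrow> (\<nexists>c'. (c, c') \<in> edges M)"

datatype 'c play = Fin "'c list" | Inf "nat \<Rightarrow> 'c"

definition finite_play :: "'c mdp \<Rightarrow> 'c list \<Rightarrow> bool" where
  "finite_play M \<rho> \<longleftrightarrow> \<rho> \<noteq> [] \<and> set \<rho> \<subseteq> confs M \<and>
     (\<forall>i. Suc i < length \<rho> \<longrightarrow> (\<rho> ! i, \<rho> ! Suc i) \<in> edges M)"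

definition infinite_play :: "'c mdp \<Rightarrow> (nat \<Rightarrow> 'c) \<Rightarrow> bool" where
  "infinite_play M r \<longleftrightarrow> range r \<subseteq> confs M \<and> (\<forall>i. (r i, r (Suc i)) \<in> edges M)"

definition plays :: "'c mdp \<Rightarrow> 'c play set" where
  "plays M = Fin ` {\<rho>. finite_play M \<rho>} \<union> Inf ` {r. infinite_play M r}"

definition maximal_plays_from :: "'c mdp \<Rightarrow> 'c \<Rightarrow> 'c play set" where
  "maximal_plays_from M c =
     Fin ` {\<rho>. finite_play M \<rho> \<and> hd \<rho> = c \<and> deadlock M (last \<rho>)} \<union>
     Inf ` {r. infinite_play M r \<and> r 0 = c}"

text \<open>Strategies are total functions, constrained only on finite plays ending in a Player 1
  configuration that is not a deadlock; their other values are never consulted.\<close>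

definition strategy :: "'c mdp \<Rightarrow> ('c list \<Rightarrow> 'c) \<Rightarrow> bool" where
  "strategy M \<sigma> \<longleftrightarrow>
     (\<forall>\<rho>. finite_play M \<rho> \<and> last \<rho> \<in> confs1 M \<and> \<not> deadlock M (last \<rho>) \<longrightarrow>
        (last \<rho>, \<sigma> \<rho>) \<in> edges M)"

fun consistent :: "'c mdp \<Rightarrow> ('c list \<Rightarrow> 'c) \<Rightarrow> 'c play \<Rightarrow> bool" where
  "consistent M \<sigma> (Fin \<rho>) \<longleftrightarrow>
     (\<forall>i. Suc i < length \<rho> \<and> \<rho> ! i \<in> confs1 M \<longrightarrow> \<rho> ! Suc i = \<sigma> (take (Suc i) \<rho>))"
| "consistent M \<sigma> (Inf r) \<longleftrightarrow>
     (\<forall>i. r i \<in> confs1 M \<longrightarrow> r (Suc i) = \<sigma> (map r [0..<Suc i]))"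

definition Outcome :: "'c mdp \<Rightarrow> 'c \<Rightarrow> ('c list \<Rightarrow> 'c) \<Rightarrow> 'c play set" where
  "Outcome M c \<sigma> = {\<pi> \<in> maximal_plays_from M c. consistent M \<sigma> \<pi>}"

section \<open>VASS-MDPs\<close>

text \<open>Vectors of dimension \<open>d\<close> are lists of length \<open>d\<close>.\<close>

type_synonym 'q transition = "'q \<times> int list \<times> 'q"
type_synonym 'q conf = "'q \<times> nat list"

record 'q vass =
  dim :: nat
  states1 :: "'q set"
  statesP :: "'q set"
  transitions :: "'q transition set"
  weight :: "'q transition \<Rightarrow> nat"

definition states :: "'q vass \<Rightarrow> 'q set" where
  "states S = states1 S \<union> statesP S"

definition vass_mdp :: "'q vass \<Rightarrow> bool" where
  "vass_mdp S \<longleftrightarrow>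
     finite (states S) \<and> states1 S \<inter> statesP S = {} \<and>
     finite (transitions S) \<and>
     transitions S \<subseteq> states S \<times> {z. length z = dim S} \<times> states S \<and>
     (\<forall>t \<in> transitions S. weight S t > 0)"

definition one_vass_mdp :: "'q vass \<Rightarrow> bool" where
  "one_vass_mdp S \<longleftrightarrow> vass_mdp S \<and>
     (\<forall>(q, z, q') \<in> transitions S. q \<in> statesP S \<longrightarrow> z = replicate (dim S) 0)"

definition add_vec :: "nat list \<Rightarrow> int list \<Rightarrow> int list" where
  "add_vec v z = map2 (\<lambda>a b. int a + b) v z"

definition enabled :: "'q vass \<Rightarrow> 'q conf \<Rightarrow> 'q transition set" where
  "enabled S = (\<lambda>(q, v). {(p, z, q'). (p, z, q') \<in> transitions S \<and> p = q \<and> (\<forall>x \<in> set (add_vec v z). 0 \<le> x)})"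

definition leads_to :: "'q conf \<Rightarrow> 'q transition \<Rightarrow> 'q conf \<Rightarrow> bool" where
  "leads_to = (\<lambda>(q, v) (p, z, q') (r, w). r = q' \<and> map int w = add_vec v z)"

definition induced_mdp :: "'q vass \<Rightarrow> 'q conf mdp" where
  "induced_mdp S = \<lparr>
     confs = states S \<times> {v. length v = dim S},
     confs1 = states1 S \<times> {v. length v = dim S},
     confsP = statesP S \<times> {v. length v = dim S},
     edges = {(c, c'). c \<in> states S \<times> {v. length v = dim S} \<and>
                       (\<exists>t \<in> enabled S c. leads_to c t c')},
     prob = (\<lambda>c c'. real (\<Sum>t | t \<in> enabled S c \<and> leads_to c t c'. weight S t) /
                    real (\<Sum>t \<in> enabled S c. weight S t))\<rparr>"

definition reach :: "'q vass \<Rightarrow> 'q \<Rightarrow> 'q conf play set" where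
  "reach S qF =
     Fin ` {\<rho>. \<exists>c \<in> set \<rho>. fst c = qF} \<inter> plays (induced_mdp S) \<union>
     Inf ` {r. \<exists>i. fst (r i) = qF} \<inter> plays (induced_mdp S)"

definition repeated_reach :: "'q vass \<Rightarrow> 'q \<Rightarrow> 'q conf play set" where
  "repeated_reach S qF =
     Inf ` {r. \<exists>\<^sub>\<infinity>i. fst (r i) = qF} \<inter> plays (induced_mdp S)"

definition sure_reachable :: "'q vass \<Rightarrow> 'q conf \<Rightarrow> 'q \<Rightarrow> bool" where
  "sure_reachable S c0 qF \<longleftrightarrow>
     (\<exists>\<sigma>. strategy (induced_mdp S) \<sigma> \<and> Outcome (induced_mdp S) c0 \<sigma> \<subseteq> reach S qF)"

definition sure_repeatedly_reachable :: "'q vass \<Rightarrow> 'q conf \<Rightarrow> 'q \<Rightarrow> bool" where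
  "sure_repeatedly_reachable S c0 qF \<longleftrightarrow>
     (\<exists>\<sigma>. strategy (induced_mdp S) \<sigma> \<and> Outcome (induced_mdp S) c0 \<sigma> \<subseteq> repeated_reach S qF)"

section \<open>The decision problems\<close>

text \<open>As input to an algorithm, a VASS-MDP is given by its dimension, the lists of its Player 1 states,
  of its probabilistic states, and of its transitions paired with their weights. Control states are
  named by natural numbers.\<close>

type_synonym vass_desc = "nat \<times> nat list \<times> nat list \<times> (nat transition \<times> nat) list"

definition vass_of :: "vass_desc \<Rightarrow> nat vass" where
  "vass_of = (\<lambda>(d, q1s, qPs, tws). \<lparr>
     dim = d, states1 = set q1s, statesP = set qPs, transitions = fst ` set tws,
     weight = (\<lambda>t. case map_of tws t of Some w \<Rightarrow> w | None \<Rightarrow> 0)\<rparr>)"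

text \<open>Each transition may be listed only once, so that its weight is unambiguous.\<close>

definition proper_desc :: "vass_desc \<Rightarrow> bool" where
  "proper_desc = (\<lambda>(d, q1s, qPs, tws). distinct (map fst tws))"

lemma vass_desc_exists:
  assumes "vass_mdp S"
  shows "\<exists>D. proper_desc D \<and> dim (vass_of D) = dim S \<and> states1 (vass_of D) = states1 S \<and>
    statesP (vass_of D) = statesP S \<and> transitions (vass_of D) = transitions S \<and>
    (\<forall>t \<in> transitions S. weight (vass_of D) t = weight S t)"
proof -
  have "finite (states1 S)" "finite (statesP S)" "finite (transitions S)"
    using assms by (auto simp: vass_mdp_def states_def)
  then obtain q1s qPs ts where L: "set q1s = states1 S" "set qPs = statesP S"
    "set ts = transitions S" "distinct ts"
    by (metis finite_list finite_distinct_list)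
  define tws where "tws = map (\<lambda>t. (t, weight S t)) ts"
  have "map fst tws = ts" by (simp add: tws_def comp_def)
  moreover have weight: "map_of tws t = Some (weight S t)" if "t \<in> transitions S" for t
    using that L(3) \<open>map fst tws = ts\<close> L(4) by (intro map_of_is_SomeI) (auto simp: tws_def)
  moreover have "fst ` set tws = transitions S" using L by (simp add: tws_def image_image)
  ultimately show ?thesis using L
    by (intro exI[of _ "(dim S, q1s, qPs, tws)"]) (simp add: proper_desc_def vass_of_def weight)
qed

type_synonym problem_instance = "vass_desc \<times> nat conf \<times> nat"

definition one_vass_mdp_instances :: "problem_instance set" where
  "one_vass_mdp_instances = {(D, c0, qF). proper_desc D \<and> one_vass_mdp (vass_of D) \<and>
     c0 \<in> confs (induced_mdp (vass_of D)) \<and> qF \<in> states (vass_of D)}"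

definition encode_transition :: "nat transition \<times> nat \<Rightarrow> nat" where
  "encode_transition =
     (\<lambda>((q, z, q'), w). list_encode [q, list_encode (map int_encode z), q', w])"

definition encode_vass :: "vass_desc \<Rightarrow> nat" where
  "encode_vass = (\<lambda>(d, q1s, qPs, tws).
     list_encode [d, list_encode q1s, list_encode qPs, list_encode (map encode_transition tws)])"

definition encode_instance :: "problem_instance \<Rightarrow> nat" where
  "encode_instance = (\<lambda>(D, (q0, v0), qF). list_encode [encode_vass D, q0, list_encode v0, qF])"

lemma inj_encode_transition: "inj encode_transition"
  by (auto simp: inj_def encode_transition_def inj_map_eq_map[OF inj_int_encode[of UNIV]] list_encode_eq)

lemma inj_encode_vass: "inj encode_vass"
  by (auto simp: inj_def encode_vass_def inj_map_eq_map[OF inj_encode_transition] list_encode_eq)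

lemma inj_encode_instance: "inj encode_instance"
  by (auto simp: inj_def encode_instance_def inj_eq[OF inj_encode_vass] list_encode_eq)

definition sure_reachability_problem :: "nat set" where
  "sure_reachability_problem = encode_instance `
     {(D, c0, qF) \<in> one_vass_mdp_instances. sure_reachable (vass_of D) c0 qF}"

definition sure_repeated_reachability_problem :: "nat set" where
  "sure_repeated_reachability_problem = encode_instance `
     {(D, c0, qF) \<in> one_vass_mdp_instances. sure_repeatedly_reachable (vass_of D) c0 qF}"

end

theory Submission
  imports Defs "HOL-Library.More_List" "HOL-Library.Multiset" "HOL-Library.Infinite_Set"
begin

text \<open>Both problems reduce to one question: does Player 1 win a Buechi game on a finite graph in which only
  she changes the counters? (For reachability, make the target absorbing.) Winning and losing are both
  semi-decidable, so Post's theorem applies.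

  Winning sets are upward closed. By Dickson's lemma the winning set has a finite basis, and since the
  game is finitely branching each basis element has a finite derivation that it reaches the target once
  more and then re-enters the winning set. Basis and derivations certify winning.

  For losing, Dickson's lemma gives a bound \<open>B\<close> such that a counter of value at least \<open>B\<close> may as well be
  arbitrarily large. Tracking the counters up to \<open>B\<close> in the control state turns the game into one with
  unknown initial credit on a finite graph, and there the opponent needs no memory: against two
  alternatives at a state, Player 1 would interleave two winning plays, each with its own credit. Once a
  memoryless strategy of the opponent is fixed, Player 1 wins iff she can reach a closed walk through
  the target with non-negative effect. By Farkas' lemma and Euler's theorem on circuits, such a walk does
  not exist iff a finite sequence of linear ranking functions rules it out. The bound, the memoryless
  strategy and the ranking functions certify losing.\<close>

text \<open>Sureness quantifies over all outcomes, so probabilities vanish and the probabilistic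
  states become an opponent. Larger counters help Player 1 only because the opponent's moves do not
  touch them: an opponent move that became enabled by a larger counter could harm her, and
  saturation could take choices away from the opponent.

  Dickson's lemma is not effective: basis and bound merely exist. Hence winning and losing are
  certified by guessed data, and no check may presuppose that the guess is the right one. A set
  contained in its own attractor is winning whatever its origin, and a refutation in the saturated
  game is sound for every \<open>B\<close> above the initial vector.

  A single ranking function is not enough to refute closed walks, since a linear system sees only
  circulations, that is, possibly disconnected unions of cycles. Each step removes edges that no
  closed walk with non-negative effect can use; this may disconnect the graph, and the component
  that remains may admit new ranking functions.\<close>

section \<open>Computable functions on encoded data\<close>

text \<open>Codes are bijective, so \<open>dec\<close> is total and a search through all numbers is
  a search through all values of the type, certificates included.\<close>

class encodable =
  fixes enc :: "'a \<Rightarrow> nat"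
  assumes bij_enc: "bij enc"
begin

definition dec :: "nat \<Rightarrow> 'a" where "dec = inv enc"

lemma dec_enc [simp]: "dec (enc x) = x"
  using bij_enc by (simp add: dec_def bij_is_inj)

lemma enc_dec [simp]: "enc (dec n) = n"
  using bij_enc by (simp add: dec_def bij_is_surj surj_f_inv_f)

lemma enc_eq_iff [simp]: "enc x = enc y \<longleftrightarrow> x = y"
  by (metis dec_enc)

end

instantiation nat :: encodable
begin
definition enc_nat :: "nat \<Rightarrow> nat" where [simp]: "enc_nat n = n"
instance by standard (simp add: enc_nat_def[abs_def] bij_def inj_def surj_def)
end

instantiation int :: encodable
begin
definition enc_int :: "int \<Rightarrow> nat" where "enc_int = int_encode"
instance by standard (simp add: enc_int_def bij_int_encode)
end

instantiation prod :: (encodable, encodable) encodable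
begin
definition enc_prod :: "'a \<times> 'b \<Rightarrow> nat" where "enc_prod p = prod_encode (enc (fst p), enc (snd p))"
instance
proof
  show "bij (enc :: 'a \<times> 'b \<Rightarrow> nat)"
    by (rule o_bij[of "\<lambda>n. (dec (fst (prod_decode n)), dec (snd (prod_decode n)))"])
      (auto simp: fun_eq_iff enc_prod_def)
qed
end

instantiation list :: (encodable) encodable
begin
definition enc_list :: "'a list \<Rightarrow> nat" where "enc_list xs = list_encode (map enc xs)"
instance
proof
  show "bij (enc :: 'a list \<Rightarrow> nat)"
    by (rule o_bij[of "\<lambda>n. map dec (list_decode n)"]) (auto simp: fun_eq_iff enc_list_def o_def)
qed
end

lemma enc_Pair: "enc (x, y) = prod_encode (enc x, enc y)"
  by (simp add: enc_prod_def)

lemma enc_Nil: "enc [] = 0"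
  by (simp add: enc_list_def)

lemma enc_Cons: "enc (x # xs) = Suc (prod_encode (enc x, enc xs))"
  by (simp add: enc_list_def)

text \<open>Only unary functions are considered: several arguments travel as one pair. This is why
  the rules below ask that a parameter function such as \<open>g\<close> be computable on pairs of
  the ambient input and its own argument.\<close>

definition computable :: "('a::encodable \<Rightarrow> 'b::encodable) \<Rightarrow> bool" where
  "computable f \<longleftrightarrow> (\<exists>r. \<forall>x. computes r [enc x] (enc (f x)))"

definition decidable_pred :: "('a::encodable \<Rightarrow> bool) \<Rightarrow> bool" where
  "decidable_pred P \<longleftrightarrow> computable (\<lambda>x. if P x then 1 else 0 :: nat)"

named_theorems comp_intros

subsection \<open>Arithmetic and pairing\<close>

lemma computes_Comp1:
  "computes g xs y \<Longrightarrow> computes f [y] z \<Longrightarrow> computes (Comp f [g]) xs z"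
  by (rule computes.comp[where ys = "[y]"]) simp_all

lemma computes_Comp2:
  "computes g xs y \<Longrightarrow> computes g' xs y' \<Longrightarrow> computes f [y, y'] z \<Longrightarrow> computes (Comp f [g, g']) xs z"
  by (rule computes.comp[where ys = "[y, y']"]) simp_all

lemma computes_Proj: "i < length xs \<Longrightarrow> y = xs ! i \<Longrightarrow> computes (Proj i) xs y"
  by (simp add: computes.proj)

definition r_add :: recf where "r_add = Prec (Proj 0) (Comp Succ [Proj 1])"
definition r_pred :: recf where "r_pred = Prec Zero (Proj 0)"
definition r_minus :: recf where
  "r_minus = Comp (Prec (Proj 0) (Comp r_pred [Proj 1])) [Proj 1, Proj 0]"
definition r_triangle :: recf where
  "r_triangle = Prec Zero (Comp r_add [Comp Succ [Proj 0], Proj 1])"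
definition r_pair :: recf where
  "r_pair = Comp r_add [Comp r_triangle [r_add], Proj 0]"
text \<open>Inverts Cantor pairing: \<open>prod_encode (m, n) = triangle (m + n) + m\<close>, and
  the diagonal \<open>m + n\<close> is the least \<open>k\<close> for which the code is below
  \<open>triangle (Suc k)\<close>. With truncated subtraction this is a minimisation for the value
  0.\<close>

definition r_diag :: recf where
  "r_diag = Mu (Comp r_minus [Comp Succ [Proj 1], Comp r_triangle [Comp Succ [Proj 0]]])"
definition r_fst :: recf where
  "r_fst = Comp r_minus [Proj 0, Comp r_triangle [r_diag]]"
definition r_snd :: recf where
  "r_snd = Comp r_minus [r_diag, r_fst]"

lemma computes_add: "computes r_add [m, n] (m + n)"
proof (induction m)
  case 0
  show ?case unfolding r_add_def by (rule computes.prec_0) (simp add: computes_Proj)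
next
  case (Suc m)
  show ?case unfolding r_add_def
    by (rule computes.prec_Suc[OF Suc[unfolded r_add_def]], rule computes_Comp1[where y = "m + n"])
      (simp_all add: computes_Proj computes.succ)
qed

lemma computes_pred: "computes r_pred [m] (m - 1)"
proof (induction m)
  case 0
  show ?case unfolding r_pred_def by (simp add: computes.prec_0 computes.zero)
next
  case (Suc m)
  show ?case unfolding r_pred_def
    by (rule computes.prec_Suc[OF Suc[unfolded r_pred_def]]) (simp add: computes_Proj)
qed

lemma computes_minus: "computes r_minus [m, n] (m - n)"
proof -
  have "computes (Prec (Proj 0) (Comp r_pred [Proj 1])) [n, m] (m - n)"
  proof (induction n)
    case 0
    show ?case by (rule computes.prec_0) (simp add: computes_Proj)
  next
    case (Suc n)
    show ?case
      by (rule computes.prec_Suc[OF Suc], rule computes_Comp1[where y = "m - n"])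
        (use computes_pred[of "m - n"] in \<open>simp_all add: computes_Proj\<close>)
  qed
  then show ?thesis unfolding r_minus_def
    by (intro computes_Comp2[where y = n and y' = m]) (simp_all add: computes_Proj)
qed

lemma computes_triangle: "computes r_triangle [n] (triangle n)"
proof (induction n)
  case 0
  show ?case unfolding r_triangle_def by (simp add: computes.prec_0 computes.zero)
next
  case (Suc n)
  show ?case unfolding r_triangle_def
    by (rule computes.prec_Suc[OF Suc[unfolded r_triangle_def]],
        rule computes_Comp2[where y = "Suc n" and y' = "triangle n"])
      (use computes_add[of "Suc n" "triangle n"] in
        \<open>auto simp: computes_Proj computes.succ ac_simps intro!: computes_Comp1[where y = n]\<close>)
qed

lemma computes_pair: "computes r_pair [m, n] (prod_encode (m, n))"
  unfolding r_pair_def prod_encode_def split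
  by (rule computes_Comp2[OF computes_Comp1[OF computes_add computes_triangle] _ computes_add])
    (simp add: computes_Proj)

lemma computes_diag: "computes r_diag [triangle k + m] k" if "m \<le> k"
proof -
  let ?f = "Comp r_minus [Comp Succ [Proj 1], Comp r_triangle [Comp Succ [Proj 0]]]"
  have step: "computes ?f [i, n] (Suc n - triangle (Suc i))" for i n
    by (intro computes_Comp2[OF _ _ computes_minus] computes_Comp1[OF _ computes.succ]
        computes_Comp1[OF _ computes_triangle]) (simp_all add: computes_Proj)
  have mono: "triangle i \<le> triangle j" if "i \<le> j" for i j
    using that by (induction rule: dec_induct) auto
  show ?thesis unfolding r_diag_def
  proof (rule computes.mu)
    show "computes ?f (k # [triangle k + m]) 0"
      using step[of k "triangle k + m"] that by simp
    show "\<forall>i<k. \<exists>l. computes ?f (i # [triangle k + m]) (Suc l)"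
    proof (intro allI impI)
      fix i assume "i < k"
      then have "triangle (Suc i) \<le> triangle k" by (intro mono) simp
      then have "Suc (triangle k + m) - triangle (Suc i) = Suc (triangle k + m - triangle (Suc i))"
        by simp
      then show "\<exists>l. computes ?f (i # [triangle k + m]) (Suc l)"
        using step[of i "triangle k + m"] by metis
    qed
  qed
qed

lemma computes_fst: "computes r_fst [prod_encode (m, n)] m"
proof -
  have "computes r_minus [prod_encode (m, n), triangle (m + n)] m"
    using computes_minus[of "prod_encode (m, n)" "triangle (m + n)"] by (simp add: prod_encode_def)
  moreover have "computes r_diag [prod_encode (m, n)] (m + n)"
    using computes_diag[of m "m + n"] by (simp add: prod_encode_def)
  ultimately show ?thesis unfolding r_fst_def
    by (intro computes_Comp2[OF _ computes_Comp1[OF _ computes_triangle]]) (simp_all add: computes_Proj)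
qed

lemma computes_snd: "computes r_snd [prod_encode (m, n)] n"
proof -
  have "computes r_minus [m + n, m] n"
    using computes_minus[of "m + n" m] by simp
  moreover have "computes r_diag [prod_encode (m, n)] (m + n)"
    using computes_diag[of m "m + n"] by (simp add: prod_encode_def)
  ultimately show ?thesis unfolding r_snd_def
    by (intro computes_Comp2[OF _ computes_fst])
qed

lemma computable_comp: "computable g \<Longrightarrow> computable f \<Longrightarrow> computable (\<lambda>x. g (f x))"
  unfolding computable_def by (meson computes_Comp1)

lemma computable_id [comp_intros]: "computable (\<lambda>x. x)"
  unfolding computable_def by (intro exI[of _ "Proj 0"]) (simp add: computes_Proj)

lemma computable_const [comp_intros]: "computable (\<lambda>x. c)"
proof -
  have "\<exists>r. \<forall>xs. computes r xs n" for n
    by (induction n) (blast intro: computes.zero, meson computes_Comp1 computes.succ)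
  then show ?thesis unfolding computable_def by blast
qed

lemma computable_Pair [comp_intros]:
  "computable f \<Longrightarrow> computable g \<Longrightarrow> computable (\<lambda>x. (f x, g x))"
  unfolding computable_def enc_Pair by (meson computes_Comp2 computes_pair)

lemma computable_fst [comp_intros]:
  fixes f :: "'a::encodable \<Rightarrow> 'b::encodable \<times> 'c::encodable"
  shows "computable f \<Longrightarrow> computable (\<lambda>x. fst (f x))"
proof (rule computable_comp[of fst])
  show "computable (fst :: 'b \<times> 'c \<Rightarrow> 'b)"
    unfolding computable_def enc_prod_def using computes_fst by blast
qed

lemma computable_snd [comp_intros]:
  fixes f :: "'a::encodable \<Rightarrow> 'b::encodable \<times> 'c::encodable"
  shows "computable f \<Longrightarrow> computable (\<lambda>x. snd (f x))"
proof (rule computable_comp[of snd])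
  show "computable (snd :: 'b \<times> 'c \<Rightarrow> 'c)"
    unfolding computable_def enc_prod_def using computes_snd by blast
qed

lemma computable_enc [comp_intros]: "computable f \<Longrightarrow> computable (\<lambda>x. enc (f x))"
  by (simp add: computable_def)

lemma computable_dec [comp_intros]: "computable f \<Longrightarrow> computable (\<lambda>x. dec (f x))"
  by (simp add: computable_def)

lemma computable_code:
  fixes f :: "'a::encodable \<Rightarrow> 'b::encodable"
  shows "computable (\<lambda>x. enc (f x)) \<Longrightarrow> computable f"
  by (simp add: computable_def)

lemma computable2:
  assumes "computable (\<lambda>p. h (fst p) (snd p))" "computable f" "computable g"
  shows "computable (\<lambda>x. h (f x) (g x))"
  using computable_comp[OF assms(1) computable_Pair[OF assms(2,3)]] by simp

lemma computable_Suc [comp_intros]: "computable f \<Longrightarrow> computable (\<lambda>x. Suc (f x))"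
  by (rule computable_comp[of Suc]) (auto simp: computable_def intro: computes.succ)

lemma computable_Cons [comp_intros]:
  "computable f \<Longrightarrow> computable g \<Longrightarrow> computable (\<lambda>x. f x # g x)"
proof (rule computable2[where h = "(#)"])
  show "computable (\<lambda>p::'b \<times> 'b list. fst p # snd p)"
    by (rule computable_code, unfold enc_Cons enc_prod_def[symmetric])
      (intro computable_Suc computable_enc computable_id)
qed

lemma computable_rec_nat:
  assumes f: "computable f" and g: "computable (\<lambda>p. g (fst p) (fst (snd p)) (snd (snd p)))"
    and n: "computable n"
  shows "computable (\<lambda>x. rec_nat (f x) (g x) (n x))"
proof (rule computable2[where h = "\<lambda>n x. rec_nat (f x) (g x) n", OF _ n computable_id])
  obtain rf where rf: "computes rf [enc x] (enc (f x))" for x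
    using f unfolding computable_def by blast
  obtain rg where "\<forall>p. computes rg [enc p] (enc (g (fst p) (fst (snd p)) (snd (snd p))))"
    using g unfolding computable_def by blast
  from spec[OF this] have rg: "computes rg [enc (x, i, y)] (enc (g x i y))" for x i y
    by fastforce
  \<comment> \<open>\<open>Prec\<close> supplies the counter, the previous value and the parameter
    in this order, whereas \<open>rg\<close> expects one code with the parameter in front.\<close>
  let ?g = "Comp rg [Comp r_pair [Proj 2, Comp r_pair [Proj 0, Proj 1]]]"
  have *: "computes (Prec rf ?g) [n, enc x] (enc (rec_nat (f x) (g x) n))" for n x
  proof (induction n)
    case 0
    then show ?case by (simp add: computes.prec_0 rf)
  next
    case (Suc n)
    show ?case
      by (rule computes.prec_Suc[OF Suc], simp, rule computes_Comp1[OF _ rg],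
          unfold enc_Pair, intro computes_Comp2[OF _ _ computes_pair] computes_Proj) simp_all
  qed
  show "computable (\<lambda>p. rec_nat (f (snd p)) (g (snd p)) (fst p))"
    unfolding computable_def
    by (intro exI[of _ "Comp (Prec rf ?g) [r_fst, r_snd]"] allI, rule computes_Comp2[OF _ _ *])
      (auto simp: enc_prod_def computes_fst computes_snd)
qed

lemma decidable_pred_comp: "decidable_pred P \<Longrightarrow> computable f \<Longrightarrow> decidable_pred (\<lambda>x. P (f x))"
  unfolding decidable_pred_def by (rule computable_comp)

lemma computable_If [comp_intros]:
  assumes "decidable_pred P" "computable f" "computable g"
  shows "computable (\<lambda>x. if P x then f x else g x)"
proof -
  \<comment> \<open>The 0/1 value of the condition serves as the number of rounds: one round
    replaces \<open>g x\<close> by \<open>f x\<close>.\<close>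
  have "computable (\<lambda>x. rec_nat (g x) (\<lambda>_ _. f x) (if P x then 1 else 0 :: nat))"
    using assms unfolding decidable_pred_def
    by (intro computable_rec_nat computable_comp[OF assms(2) computable_fst[OF computable_id]])
  then show ?thesis by (rule back_subst[where P = computable]) auto
qed

lemma computable_funpow [comp_intros]:
  fixes g :: "'a::encodable \<Rightarrow> 'b::encodable \<Rightarrow> 'b"
  assumes "computable (\<lambda>p. g (fst p) (snd p))" "computable n" "computable f"
  shows "computable (\<lambda>x. (g x ^^ n x) (f x))"
proof -
  have "(g x ^^ n) y = rec_nat y (\<lambda>_. g x) n" for x n y by (induction n) auto
  moreover have "computable (\<lambda>p. g (fst p) (snd (snd p :: nat \<times> 'b)))"
    using computable_comp[OF assms(1), of "\<lambda>p. (fst p, snd (snd p :: nat \<times> 'b))"] by (simp add: comp_intros)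
  ultimately show ?thesis
    using computable_rec_nat[of f "\<lambda>x _. g x" n] assms(2,3) by simp
qed

lemma computable_plus_nat [comp_intros]:
  fixes f g :: "'a::encodable \<Rightarrow> nat"
  shows "computable f \<Longrightarrow> computable g \<Longrightarrow> computable (\<lambda>x. f x + g x)"
  unfolding computable_def enc_nat_def by (meson computes_Comp2 computes_add)

lemma computable_minus_nat [comp_intros]:
  fixes f g :: "'a::encodable \<Rightarrow> nat"
  shows "computable f \<Longrightarrow> computable g \<Longrightarrow> computable (\<lambda>x. f x - g x)"
  unfolding computable_def enc_nat_def by (meson computes_Comp2 computes_minus)

lemma computable_times_nat [comp_intros]:
  fixes f g :: "'a::encodable \<Rightarrow> nat"
  assumes f: "computable f" and g: "computable g"
  shows "computable (\<lambda>x. f x * g x)"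
proof -
  have *: "((+) m ^^ n) 0 = n * m" for m n :: nat by (induction n) auto
  have "computable (\<lambda>x. ((+) (g x) ^^ f x) 0)"
    by (intro comp_intros computable_comp[OF g computable_fst[OF computable_id]] f g)
  then show ?thesis unfolding * .
qed

subsection \<open>Decidable predicates\<close>

lemma decidable_pred_nat_pos: "computable f \<Longrightarrow> decidable_pred (\<lambda>x. f x > (0::nat))"
  unfolding decidable_pred_def
proof -
  assume "computable f"
  then have "computable (\<lambda>x. 1 - (1 - f x))" by (intro comp_intros)
  moreover have "(\<lambda>x. 1 - (1 - f x)) = (\<lambda>x. if f x > 0 then 1 else 0)" by auto
  ultimately show "computable (\<lambda>x. if f x > 0 then 1 else (0::nat))" by simp
qed

lemma if_distrib_not: "(if \<not> b then x else y) = (if b then y else x)"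
  by simp

lemma decidable_pred_not [comp_intros]: "decidable_pred P \<Longrightarrow> decidable_pred (\<lambda>x. \<not> P x)"
  unfolding decidable_pred_def[of "\<lambda>x. \<not> P x"] if_distrib_not by (intro comp_intros)

lemma decidable_pred_conj [comp_intros]:
  "decidable_pred P \<Longrightarrow> decidable_pred Q \<Longrightarrow> decidable_pred (\<lambda>x. P x \<and> Q x)"
proof -
  assume P: "decidable_pred P" and Q: "decidable_pred Q"
  have "(\<lambda>x. if P x \<and> Q x then 1 else 0 :: nat) = (\<lambda>x. if P x then if Q x then 1 else 0 else 0)"
    by auto
  then show ?thesis unfolding decidable_pred_def[of "\<lambda>x. P x \<and> Q x"]
    using P Q by (simp add: comp_intros)
qed

lemma decidable_pred_disj [comp_intros]:
  "decidable_pred P \<Longrightarrow> decidable_pred Q \<Longrightarrow> decidable_pred (\<lambda>x. P x \<or> Q x)"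
  using decidable_pred_not[OF decidable_pred_conj[OF decidable_pred_not decidable_pred_not], of P Q]
  by simp

lemma decidable_pred_imp [comp_intros]:
  "decidable_pred P \<Longrightarrow> decidable_pred Q \<Longrightarrow> decidable_pred (\<lambda>x. P x \<longrightarrow> Q x)"
  using decidable_pred_disj[OF decidable_pred_not, of P Q] by simp

lemma decidable_pred_iff [comp_intros]:
  assumes "decidable_pred P" "decidable_pred Q"
  shows "decidable_pred (\<lambda>x. P x \<longleftrightarrow> Q x)"
  unfolding iff_conv_conj_imp by (intro comp_intros assms)

lemma decidable_pred_if [comp_intros]:
  assumes "decidable_pred P" "decidable_pred Q" "decidable_pred R"
  shows "decidable_pred (\<lambda>x. if P x then Q x else R x)"
  unfolding if_bool_eq_conj by (intro comp_intros assms)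

lemma decidable_pred_less_nat [comp_intros]:
  fixes f g :: "'a::encodable \<Rightarrow> nat"
  assumes "computable f" "computable g"
  shows "decidable_pred (\<lambda>x. f x < g x)"
  using decidable_pred_nat_pos[OF computable_minus_nat[OF assms(2,1)]] by simp

lemma decidable_pred_le_nat [comp_intros]:
  fixes f g :: "'a::encodable \<Rightarrow> nat"
  assumes "computable f" "computable g"
  shows "decidable_pred (\<lambda>x. f x \<le> g x)"
  unfolding linorder_not_less[symmetric] by (intro comp_intros assms)

lemma decidable_pred_eq [comp_intros]:
  fixes f g :: "'a::encodable \<Rightarrow> 'b::encodable"
  assumes "computable f" "computable g"
  shows "decidable_pred (\<lambda>x. f x = g x)"
proof -
  have "decidable_pred (\<lambda>x. enc (f x) \<le> enc (g x) \<and> enc (g x) \<le> enc (f x))"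
    by (intro comp_intros assms)
  then show ?thesis unfolding order_eq_iff[symmetric] enc_eq_iff .
qed

subsection \<open>Lists\<close>

text \<open>Since \<open>prod_encode (0, 0) = 0\<close>, the predecessor of the code of the empty list
  is a pair whose second component is again the code of the empty list.\<close>

lemma computable_tl [comp_intros]:
  fixes f :: "'a::encodable \<Rightarrow> 'b::encodable list"
  shows "computable f \<Longrightarrow> computable (\<lambda>x. tl (f x))"
proof (rule computable_comp[of tl])
  have "prod_encode (0, 0) = 0" by (simp add: prod_encode_def)
  then have "prod_decode 0 = (0, 0)" by (metis prod_encode_inverse)
  then have "enc (tl xs) = enc (snd (dec (enc xs - 1) :: 'b \<times> 'b list))" for xs :: "'b list"
  proof (cases xs)
    case Nil
    have "prod_encode (enc (fst p), enc (snd p)) = 0 \<Longrightarrow> enc (snd p) = 0" for p :: "'b \<times> 'b list"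
      using \<open>prod_encode (0, 0) = 0\<close> by (metis Pair_inject prod_encode_eq)
    then have "enc p = 0 \<Longrightarrow> enc (snd p) = 0" for p :: "'b \<times> 'b list" by (simp add: enc_prod_def)
    then show ?thesis using Nil by (simp add: enc_Nil)
  next
    case (Cons y ys)
    then show ?thesis by (simp add: enc_Cons enc_Pair[symmetric])
  qed
  moreover have "computable (\<lambda>xs :: 'b list. enc (snd (dec (enc xs - 1) :: 'b \<times> 'b list)))"
    by (intro comp_intros)
  ultimately show "computable (tl :: 'b list \<Rightarrow> 'b list)" by (auto intro: computable_code)
qed

text \<open>A head whose value on the empty list is whatever its code happens to decode to, so that
  it is a composition of functions already known to be computable.\<close>

definition hd0 :: "'a::encodable list \<Rightarrow> 'a" where
  "hd0 xs = fst (dec (enc xs - 1) :: 'a \<times> 'a list)"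

lemma hd0_Cons [simp]: "hd0 (x # xs) = x"
  by (simp add: hd0_def enc_Cons enc_Pair[symmetric])

lemma computable_hd0 [comp_intros]: "computable f \<Longrightarrow> computable (\<lambda>x. hd0 (f x))"
  unfolding hd0_def by (intro comp_intros)

lemma length_le_enc: "length xs \<le> enc xs"
proof (induction xs)
  case (Cons x xs)
  then show ?case using le_prod_encode_2[of "enc xs" "enc x"] by (simp add: enc_Cons)
qed simp

lemma computable_foldl [comp_intros]:
  fixes g :: "'a::encodable \<Rightarrow> 'b::encodable \<Rightarrow> 'c::encodable \<Rightarrow> 'b"
  assumes g: "computable (\<lambda>p. g (fst p) (fst (snd p)) (snd (snd p)))"
    and f: "computable f" and l: "computable l"
  shows "computable (\<lambda>x. foldl (g x) (f x) (l x))"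
proof -
  define step where "step x p = (if snd p = [] then p else (g x (fst p) (hd0 (snd p)), tl (snd p)))"
    for x and p :: "'b \<times> 'c list"
  have *: "(step x ^^ n) (a, xs) = (foldl (g x) a (take n xs), drop n xs)" for x n a xs
  proof (induction n arbitrary: a xs)
    case (Suc n)
    then show ?case by (cases xs) (simp_all add: funpow_Suc_right step_def del: funpow.simps(2))
  qed simp
  have g': "computable (\<lambda>q. g (fst q) (fst (snd q)) (hd0 (snd (snd q))))"
    using computable_comp[OF g, of "\<lambda>q. (fst q, fst (snd q), hd0 (snd (snd q)))"]
    by (simp add: comp_intros)
  \<comment> \<open>The code of the list bounds its length and so serves as the number of
    iterations; rounds after the list is exhausted change nothing.\<close>
  have "computable (\<lambda>x. fst ((step x ^^ enc (l x)) (f x, l x)))"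
    unfolding step_def by (intro comp_intros f l g')
  then show ?thesis unfolding * by (simp add: length_le_enc)
qed

lemma computable_rev [comp_intros]:
  fixes l :: "'a::encodable \<Rightarrow> 'b::encodable list"
  assumes "computable l"
  shows "computable (\<lambda>x. rev (l x))"
proof -
  have *: "foldl (\<lambda>a b. b # a) ys xs = rev xs @ ys" for xs ys :: "'b list"
    by (induction xs arbitrary: ys) auto
  have "computable (\<lambda>x. foldl (\<lambda>a b. b # a) [] (l x))"
    by (intro comp_intros assms)
  then show ?thesis unfolding * by simp
qed

lemma computable_map [comp_intros]:
  fixes g :: "'a::encodable \<Rightarrow> 'b::encodable \<Rightarrow> 'c::encodable"
  assumes g: "computable (\<lambda>p. g (fst p) (snd p))" and l: "computable l"
  shows "computable (\<lambda>x. map (g x) (l x))"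
proof -
  have *: "foldl (\<lambda>a b. f b # a) ys xs = rev (map f xs) @ ys" for f :: "'b \<Rightarrow> 'c" and xs ys
    by (induction xs arbitrary: ys) auto
  have "computable (\<lambda>x. rev (foldl (\<lambda>a b. g x b # a) [] (l x)))"
    by (intro comp_intros l computable2[OF g])
  then show ?thesis unfolding * by simp
qed

lemma computable_append [comp_intros]:
  fixes f g :: "'a::encodable \<Rightarrow> 'b::encodable list"
  assumes "computable f" "computable g"
  shows "computable (\<lambda>x. f x @ g x)"
proof -
  have *: "foldl (\<lambda>a b. b # a) ys (rev xs) = xs @ ys" for xs ys :: "'b list"
    by (induction xs arbitrary: ys rule: rev_induct) auto
  have "computable (\<lambda>x. foldl (\<lambda>a b. b # a) (g x) (rev (f x)))"
    by (intro comp_intros assms)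
  then show ?thesis unfolding * .
qed

lemma computable_filter [comp_intros]:
  fixes P :: "'a::encodable \<Rightarrow> 'b::encodable \<Rightarrow> bool"
  assumes P: "decidable_pred (\<lambda>p. P (fst p) (snd p))" and l: "computable l"
  shows "computable (\<lambda>x. filter (P x) (l x))"
proof -
  have *: "foldl (\<lambda>a b. if Q b then b # a else a) ys xs = rev (filter Q xs) @ ys"
    for Q :: "'b \<Rightarrow> bool" and xs ys
    by (induction xs arbitrary: ys) auto
  have P': "decidable_pred (\<lambda>p. P (f p) (g p))" if "computable f" "computable g"
    for f g using decidable_pred_comp[OF P computable_Pair[OF that]] by simp
  have "computable (\<lambda>x. rev (foldl (\<lambda>a b. if P x b then b # a else a) [] (l x)))"
    by (intro comp_intros l P')
  then show ?thesis unfolding * by simp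
qed

lemma decidable_pred_ball [comp_intros]:
  assumes l: "computable l" and P: "decidable_pred (\<lambda>p. P (fst p) (snd p))"
  shows "decidable_pred (\<lambda>x. \<forall>y\<in>set (l x). P x y)"
proof -
  have "decidable_pred (\<lambda>x. filter (\<lambda>y. \<not> P x y) (l x) = [])"
    by (intro comp_intros l P)
  then show ?thesis by (simp add: filter_empty_conv)
qed

lemma decidable_pred_bex [comp_intros]:
  assumes l: "computable l" and P: "decidable_pred (\<lambda>p. P (fst p) (snd p))"
  shows "decidable_pred (\<lambda>x. \<exists>y\<in>set (l x). P x y)"
proof -
  have "decidable_pred (\<lambda>x. \<not> (\<forall>y\<in>set (l x). \<not> P x y))"
    by (intro comp_intros l P)
  then show ?thesis by simp
qed

lemma decidable_pred_mem [comp_intros]: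
  assumes "computable f" "computable l"
  shows "decidable_pred (\<lambda>x. f x \<in> set (l x))"
proof -
  have "decidable_pred (\<lambda>x. \<exists>y\<in>set (l x). y = f x)"
    by (intro comp_intros assms(2) computable_comp[OF assms(1) computable_fst[OF computable_id]])
  then show ?thesis by simp
qed

lemma computable_length [comp_intros]:
  fixes l :: "'a::encodable \<Rightarrow> 'b::encodable list"
  shows "computable l \<Longrightarrow> computable (\<lambda>x. length (l x))"
proof -
  have *: "foldl (\<lambda>a b. Suc a) n xs = n + length xs" for n and xs :: "'b list"
    by (induction xs arbitrary: n) auto
  assume "computable l"
  then have "computable (\<lambda>x. foldl (\<lambda>a b. Suc a) 0 (l x))" by (intro comp_intros)
  then show ?thesis unfolding * by simp
qed

lemma computable_upt [comp_intros]:
  assumes "computable f"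
  shows "computable (\<lambda>x. [0..<f x])"
proof -
  have *: "((\<lambda>p. (fst p - 1, (fst p - 1) # snd p)) ^^ k) (n, []) = (n - k, [n - k..<n])"
    if "k \<le> n" for k n
    using that
  proof (induction k)
    case (Suc k)
    then have "[n - Suc k..<n] = (n - Suc k) # [n - k..<n]"
      by (subst upt_conv_Cons) (auto simp: Suc_diff_Suc)
    with Suc show ?case by simp
  qed simp
  have "computable (\<lambda>x. snd (((\<lambda>p. (fst p - 1, (fst p - 1) # snd p)) ^^ f x) (f x, [] :: nat list)))"
    by (intro comp_intros assms)
  then show ?thesis by (simp only: *[OF order_refl] snd_conv diff_self_eq_0)
qed

lemma decidable_pred_all_less [comp_intros]:
  fixes P :: "'a::encodable \<Rightarrow> nat \<Rightarrow> bool"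
  assumes "computable f" "decidable_pred (\<lambda>p. P (fst p) (snd p))"
  shows "decidable_pred (\<lambda>x. \<forall>i<f x. P x i)"
proof -
  have "decidable_pred (\<lambda>x. \<forall>i\<in>set [0..<f x]. P x i)" by (intro comp_intros assms)
  then show ?thesis by (simp add: Ball_def)
qed

lemma computable_nth_default [comp_intros]:
  fixes l :: "'a::encodable \<Rightarrow> 'b::encodable list"
  assumes "computable l" "computable f"
  shows "computable (\<lambda>x. nth_default c (l x) (f x))"
proof -
  have *: "(tl ^^ n) xs = drop n xs" for n and xs :: "'b list"
    by (induction n arbitrary: xs) (simp_all add: funpow_Suc_right drop_Suc del: funpow.simps(2))
  have "computable (\<lambda>x. if (tl ^^ f x) (l x) = [] then c else hd0 ((tl ^^ f x) (l x)))"
    by (intro comp_intros assms)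
  moreover have "(if drop n xs = [] then c else hd0 (drop n xs)) = nth_default c xs n"
    for n and xs :: "'b list"
    by (auto simp: nth_default_def Cons_nth_drop_Suc[symmetric])
  ultimately show ?thesis unfolding * by simp
qed

subsection \<open>Integers\<close>

lemma computable_div2: "computable f \<Longrightarrow> computable (\<lambda>x. f x div (2::nat))"
  and decidable_pred_even: "computable f \<Longrightarrow> decidable_pred (\<lambda>x. even (f x :: nat))"
proof -
  assume f: "computable f"
  have *: "((\<lambda>p. (if snd p = 0 then fst p else Suc (fst p), 1 - snd p)) ^^ n) (0, 0)
      = (n div 2, n mod 2)" for n :: nat
    by (induction n) (auto simp: mod2_eq_if)
  have c: "computable (\<lambda>x. ((\<lambda>p. (if snd p = 0 then fst p else Suc (fst p), 1 - snd p)) ^^ f x) (0, 0::nat))"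
    by (intro comp_intros f)
  show "computable (\<lambda>x. f x div 2)" using computable_fst[OF c] unfolding * by simp
  show "decidable_pred (\<lambda>x. even (f x))"
    using decidable_pred_eq[OF computable_snd[OF c] computable_const[of 0]]
    unfolding * by (simp add: even_iff_mod_2_eq_zero)
qed

lemma int_encode_cases: "int_encode i = (if 0 \<le> i then 2 * nat i else Suc (2 * nat (- i - 1)))"
  by (simp add: int_encode_def sum_encode_def)

lemma computable_nat [comp_intros]: "computable f \<Longrightarrow> computable (\<lambda>x. nat (f x))"
  and computable_nat_uminus: "computable f \<Longrightarrow> computable (\<lambda>x. nat (- f x))"
proof -
  assume f: "computable f"
  have "nat i = (if even (enc i) then enc i div 2 else 0)" for i :: int
    by (simp add: enc_int_def int_encode_cases)
  moreover have "computable (\<lambda>x. if even (enc (f x)) then enc (f x) div 2 else 0)"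
    by (intro comp_intros computable_div2 decidable_pred_even f)
  ultimately show "computable (\<lambda>x. nat (f x))" by simp
  have "nat (- i) = (if even (enc i) then 0 else Suc (enc i div 2))" for i :: int
    by (auto simp: enc_int_def int_encode_cases)
  moreover have "computable (\<lambda>x. if even (enc (f x)) then 0 else Suc (enc (f x) div 2))"
    by (intro comp_intros computable_div2 decidable_pred_even f)
  ultimately show "computable (\<lambda>x. nat (- f x))" by simp
qed

lemma computable_int_diff:
  assumes f: "computable f" and g: "computable g"
  shows "computable (\<lambda>x. int (f x) - int (g x))"
proof (rule computable_code)
  have "enc (int a - int b) = (if b \<le> a then 2 * (a - b) else Suc (2 * (b - a - 1)))" for a b
    by (auto simp: enc_int_def int_encode_cases nat_diff_distrib)
  moreover have "computable (\<lambda>x. if g x \<le> f x then 2 * (f x - g x) else Suc (2 * (g x - f x - 1)))"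
    by (intro comp_intros f g)
  ultimately show "computable (\<lambda>x. enc (int (f x) - int (g x)))" by simp
qed

lemma computable_int [comp_intros]: "computable f \<Longrightarrow> computable (\<lambda>x. int (f x))"
  using computable_int_diff[of f "\<lambda>_. 0"] by (simp add: comp_intros)

lemma computable_plus_int [comp_intros]:
  fixes f g :: "'a::encodable \<Rightarrow> int"
  assumes f: "computable f" and g: "computable g"
  shows "computable (\<lambda>x. f x + g x)"
proof -
  have "computable (\<lambda>x. int (nat (f x) + nat (g x)) - int (nat (- f x) + nat (- g x)))"
    by (intro comp_intros computable_int_diff computable_nat_uminus f g)
  moreover have "int (nat a + nat b) - int (nat (- a) + nat (- b)) = a + b" for a b by simp
  ultimately show ?thesis by simp
qed

lemma computable_uminus_int [comp_intros]:
  fixes f :: "'a::encodable \<Rightarrow> int"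
  assumes f: "computable f"
  shows "computable (\<lambda>x. - f x)"
proof -
  have "computable (\<lambda>x. int (nat (- f x)) - int (nat (f x)))"
    by (intro comp_intros computable_int_diff computable_nat_uminus f)
  moreover have "int (nat (- a)) - int (nat a) = - a" for a by simp
  ultimately show ?thesis by simp
qed

lemma computable_minus_int [comp_intros]:
  fixes f g :: "'a::encodable \<Rightarrow> int"
  shows "computable f \<Longrightarrow> computable g \<Longrightarrow> computable (\<lambda>x. f x - g x)"
  using computable_plus_int[OF _ computable_uminus_int, of f g] by simp

lemma computable_times_int [comp_intros]:
  fixes f g :: "'a::encodable \<Rightarrow> int"
  assumes f: "computable f" and g: "computable g"
  shows "computable (\<lambda>x. f x * g x)"
proof -
  have "computable (\<lambda>x. int (nat (f x) * nat (g x) + nat (- f x) * nat (- g x))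
      - int (nat (f x) * nat (- g x) + nat (- f x) * nat (g x)))"
    by (intro comp_intros computable_int_diff computable_nat_uminus f g)
  moreover have "int (nat a * nat b + nat (- a) * nat (- b))
      - int (nat a * nat (- b) + nat (- a) * nat b) = a * b" for a b
    by (cases "a \<ge> 0"; cases "b \<ge> 0") simp_all
  ultimately show ?thesis by simp
qed

lemma decidable_pred_le_int [comp_intros]:
  fixes f g :: "'a::encodable \<Rightarrow> int"
  assumes f: "computable f" and g: "computable g"
  shows "decidable_pred (\<lambda>x. f x \<le> g x)"
proof -
  have "decidable_pred (\<lambda>x. nat (f x + - g x) = 0)" by (intro comp_intros f g)
  then show ?thesis by simp
qed

lemma computable_sum_list_int [comp_intros]:
  fixes l :: "'a::encodable \<Rightarrow> int list"
  assumes l: "computable l"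
  shows "computable (\<lambda>x. sum_list (l x))"
proof -
  have *: "foldl (+) a xs = a + sum_list xs" for a :: int and xs
    by (induction xs arbitrary: a) (auto simp: add.assoc)
  have "computable (\<lambda>x. foldl (+) 0 (l x))" by (intro comp_intros l)
  then show ?thesis unfolding * by simp
qed

lemma computable_sum_int [comp_intros]:
  fixes g :: "'a::encodable \<Rightarrow> nat \<Rightarrow> int"
  assumes "computable f" "computable (\<lambda>p. g (fst p) (snd p))"
  shows "computable (\<lambda>x. \<Sum>i<f x. g x i)"
proof -
  have "computable (\<lambda>x. sum_list (map (g x) [0..<f x]))" by (intro comp_intros assms)
  then show ?thesis by (simp add: interv_sum_list_conv_sum_set_nat atLeast0LessThan)
qed

subsection \<open>Unbounded search\<close>

lemma computable_Least:
  assumes P: "decidable_pred (\<lambda>p. P (fst p) (snd p))" and ex: "\<And>x. \<exists>n. P x n"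
  shows "computable (\<lambda>x. LEAST n. P x (n::nat))"
proof -
  \<comment> \<open>Minimisation searches for the value 0, so here 0 stands for truth.\<close>
  have "computable (\<lambda>p. if P (fst p) (snd p) then 0 else 1 :: nat)" by (intro comp_intros P)
  then obtain r where r: "computes r [prod_encode (enc x, n)] (if P x n then 0 else 1)" for x n
    unfolding computable_def by (auto simp: enc_prod_def split_paired_all)
  let ?r = "Comp r [Comp r_pair [Proj 1, Proj 0]]"
  have r': "computes ?r [n, enc x] (if P x n then 0 else 1)" for x n
    by (rule computes_Comp1[OF computes_Comp2[OF _ _ computes_pair] r]) (simp_all add: computes_Proj)
  have "computes (Mu ?r) [enc x] (LEAST n. P x n)" for x
  proof (rule computes.mu)
    show "computes ?r ((LEAST n. P x n) # [enc x]) 0"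
      using r'[of "LEAST n. P x n" x] LeastI_ex[OF ex[of x]] by simp
    show "\<forall>m<LEAST n. P x n. \<exists>k. computes ?r (m # [enc x]) (Suc k)"
      using r'[of _ x] not_less_Least by (metis One_nat_def)
  qed
  then show ?thesis unfolding computable_def by auto
qed

lemma Post_theorem:
  assumes R: "decidable_pred (\<lambda>p. R (fst p) (snd p :: 'b::encodable))" "\<And>x. P x \<longleftrightarrow> (\<exists>y. R x y)"
    and Q: "decidable_pred (\<lambda>p. Q (fst p) (snd p :: 'c::encodable))" "\<And>x. \<not> P x \<longleftrightarrow> (\<exists>y. Q x y)"
  shows "decidable_pred P"
proof -
  \<comment> \<open>Each number is decoded at both certificate types, so one search runs through
    both enumerations. When it stops, \<open>R\<close> holds of the number found exactly if
    \<open>P x\<close> does, because certificates of the two kinds never coexist.\<close>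
  let ?n = "\<lambda>x. LEAST n. R x (dec n) \<or> Q x (dec n)"
  have R': "decidable_pred (\<lambda>x. R (f x) (g x))" if "computable f" "computable g" for f g
    using decidable_pred_comp[OF R(1) computable_Pair[OF that]] by simp
  have Q': "decidable_pred (\<lambda>x. Q (f x) (g x))" if "computable f" "computable g" for f g
    using decidable_pred_comp[OF Q(1) computable_Pair[OF that]] by simp
  have ex: "\<exists>n. R x (dec n) \<or> Q x (dec n)" for x
    using R(2)[of x] Q(2)[of x] by (metis dec_enc)
  have "computable ?n" by (rule computable_Least) (intro comp_intros R' Q', rule ex)
  then have "decidable_pred (\<lambda>x. R x (dec (?n x)))" by (intro comp_intros R')
  moreover have "R x (dec (?n x)) \<longleftrightarrow> P x" for x
    using LeastI_ex[OF ex[of x]] R(2)[of x] Q(2)[of x] by blast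
  ultimately show ?thesis by simp
qed

lemma decidable_iff: "decidable A \<longleftrightarrow> decidable_pred (\<lambda>n. n \<in> A)"
  by (simp add: decidable_def decidable_pred_def computable_def)

section \<open>Nested fixpoints for Buechi objectives\<close>

primrec attn :: "('c set \<Rightarrow> 'c set) \<Rightarrow> 'c set \<Rightarrow> nat \<Rightarrow> 'c set \<Rightarrow> 'c set" where
  "attn pre F 0 X = {}"
| "attn pre F (Suc n) X = F \<inter> pre X \<union> pre (attn pre F n X)"

text \<open>From \<open>attn pre F n X\<close> Player 1 forces, in at most \<open>n\<close> steps, a visit to \<open>F\<close> and then a step into \<open>X\<close>.\<close>

definition att :: "('c set \<Rightarrow> 'c set) \<Rightarrow> 'c set \<Rightarrow> 'c set \<Rightarrow> 'c set" where
  "att pre F X = (\<Union>n. attn pre F n X)"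

definition buchi :: "('c set \<Rightarrow> 'c set) \<Rightarrow> 'c set \<Rightarrow> 'c set" where
  "buchi pre F = \<Union>{X. X \<subseteq> att pre F X}"

lemma attn_mono:
  assumes "mono pre" "X \<subseteq> Y"
  shows "attn pre F n X \<subseteq> attn pre F n Y"
proof (induction n)
  case (Suc n)
  then show ?case using monoD[OF assms(1) Suc] monoD[OF assms(1,2)] by auto
qed simp

lemma attn_Suc:
  assumes "mono pre"
  shows "attn pre F n X \<subseteq> attn pre F (Suc n) X"
proof (induction n)
  case (Suc n)
  then show ?case using monoD[OF assms Suc] by auto
qed simp

lemma att_mono: "mono pre \<Longrightarrow> X \<subseteq> Y \<Longrightarrow> att pre F X \<subseteq> att pre F Y"
  unfolding att_def by (intro UN_mono attn_mono) simp_all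

lemma attn_subset_att: "attn pre F n X \<subseteq> att pre F X"
  unfolding att_def by blast

lemma buchi_unfold:
  assumes "mono pre"
  shows "buchi pre F = att pre F (buchi pre F)"
proof
  show *: "buchi pre F \<subseteq> att pre F (buchi pre F)"
  proof
    fix c assume "c \<in> buchi pre F"
    then obtain X where X: "c \<in> X" "X \<subseteq> att pre F X" unfolding buchi_def by blast
    then have "X \<subseteq> buchi pre F" unfolding buchi_def by blast
    then have "att pre F X \<subseteq> att pre F (buchi pre F)" by (rule att_mono[OF assms])
    then show "c \<in> att pre F (buchi pre F)" using X by blast
  qed
  show "att pre F (buchi pre F) \<subseteq> buchi pre F"
    using att_mono[OF assms *] unfolding buchi_def by blast
qed

lemma buchi_coinduct: "X \<subseteq> att pre F X \<Longrightarrow> X \<subseteq> buchi pre F"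
  unfolding buchi_def by blast

definition omega_continuous :: "('c set \<Rightarrow> 'c set) \<Rightarrow> bool" where
  "omega_continuous pre \<longleftrightarrow> (\<forall>A. incseq A \<longrightarrow> pre (\<Union>n. A n) \<subseteq> (\<Union>n. pre (A n)))"

lemma pre_att:
  assumes "mono pre" "omega_continuous pre"
  shows "pre (att pre F X) \<subseteq> att pre F X"
proof -
  have "incseq (\<lambda>n. attn pre F n X)" by (rule incseq_SucI) (rule attn_Suc[OF assms(1)])
  then have "pre (att pre F X) \<subseteq> (\<Union>n. pre (attn pre F n X))"
    using assms(2) unfolding omega_continuous_def att_def by blast
  also have "\<dots> \<subseteq> (\<Union>n. attn pre F (Suc n) X)" by auto
  also have "\<dots> \<subseteq> att pre F X" unfolding att_def by blast
  finally show ?thesis .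
qed

lemma pre_buchi:
  assumes "mono pre" "omega_continuous pre"
  shows "pre (buchi pre F) \<subseteq> buchi pre F"
  using pre_att[OF assms] buchi_unfold[OF assms(1), of F] by metis

lemma attn_buchi_subset: "mono pre \<Longrightarrow> attn pre F n (buchi pre F) \<subseteq> buchi pre F"
  using attn_subset_att[of pre F n "buchi pre F"] by (simp add: buchi_unfold[symmetric])

lemma attn_buchi_pre:
  assumes "mono pre"
  shows "attn pre F n (buchi pre F) \<subseteq> pre (buchi pre F)"
proof (cases n)
  case (Suc m)
  then show ?thesis using monoD[OF assms attn_buchi_subset[OF assms]] by auto
qed simp

text \<open>Simulation up to winning: a successor may be related again or already lie in the winning
  set of the second game. Both kinds together form a set \<open>Z\<close> inside its own attractor,
  by induction on the rank in the first game. The simulation step may use that \<open>X\<close>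
  consists of winning configurations, since \<open>saturated_win\<close> leaves the relation by
  appealing to a win in the first game.\<close>

lemma buchi_sim_upto:
  assumes F: "\<And>c c'. R c c' \<Longrightarrow> c \<in> F \<Longrightarrow> c' \<in> F'"
    and pre: "\<And>c c' X. R c c' \<Longrightarrow> X \<subseteq> buchi pre F \<Longrightarrow> c \<in> pre X \<Longrightarrow>
      c' \<in> pre' ({b. \<exists>a\<in>X. R a b} \<union> buchi pre' F')"
    and mono: "mono pre" "mono pre'" and cont: "omega_continuous pre'"
    and c: "R c c'" "c \<in> buchi pre F"
  shows "c' \<in> buchi pre' F'"
proof -
  define Z where "Z = {b. \<exists>a\<in>buchi pre F. R a b} \<union> buchi pre' F'"
  have W: "buchi pre' F' \<subseteq> att pre' F' Z"
    using att_mono[OF mono(2), of "buchi pre' F'" Z F'] buchi_unfold[OF mono(2), of F']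
    unfolding Z_def by simp
  have *: "R a b \<Longrightarrow> a \<in> attn pre F n (buchi pre F) \<Longrightarrow> b \<in> att pre' F' Z" for n a b
  proof (induction n arbitrary: a b)
    case (Suc n)
    have "{b. \<exists>a\<in>attn pre F n (buchi pre F). R a b} \<union> buchi pre' F' \<subseteq> att pre' F' Z"
      using Suc.IH W by blast
    moreover have "a \<in> pre (attn pre F n (buchi pre F)) \<Longrightarrow>
        b \<in> pre' ({b. \<exists>a\<in>attn pre F n (buchi pre F). R a b} \<union> buchi pre' F')"
      by (rule pre[OF Suc.prems(1) attn_buchi_subset[OF mono(1)]])
    ultimately have "a \<in> pre (attn pre F n (buchi pre F)) \<Longrightarrow> b \<in> pre' (att pre' F' Z)"
      using monoD[OF mono(2)] by blast
    then have "a \<in> pre (attn pre F n (buchi pre F)) \<Longrightarrow> b \<in> att pre' F' Z"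
      using pre_att[OF mono(2) cont] by blast
    moreover have "a \<in> F \<inter> pre (buchi pre F) \<Longrightarrow> b \<in> att pre' F' Z"
    proof -
      assume "a \<in> F \<inter> pre (buchi pre F)"
      then have "b \<in> F' \<inter> pre' Z"
        unfolding Z_def using F[OF Suc.prems(1)] pre[OF Suc.prems(1) order_refl] by blast
      then show ?thesis using attn_subset_att[of pre' F' "Suc 0" Z] by auto
    qed
    ultimately show ?case using Suc.prems(2) by auto
  qed simp
  have "Z \<subseteq> att pre' F' Z"
  proof
    fix b assume b: "b \<in> Z"
    show "b \<in> att pre' F' Z"
    proof (cases "b \<in> buchi pre' F'")
      case False
      then obtain a where a: "a \<in> buchi pre F" "R a b" using b unfolding Z_def by blast
      then have "a \<in> att pre F (buchi pre F)" using buchi_unfold[OF mono(1)] by blast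
      then show ?thesis using *[OF a(2)] unfolding att_def[of pre] by blast
    qed (use W in blast)
  qed
  then show ?thesis using buchi_coinduct[of Z] c unfolding Z_def by blast
qed


lemma buchi_sim:
  assumes F: "\<And>c c'. R c c' \<Longrightarrow> c \<in> F \<Longrightarrow> c' \<in> F'"
    and pre: "\<And>c c' X. R c c' \<Longrightarrow> c \<in> pre X \<Longrightarrow> c' \<in> pre' {b. \<exists>a\<in>X. R a b}"
    and mono: "mono pre" "mono pre'" and cont: "omega_continuous pre'"
    and c: "R c c'" "c \<in> buchi pre F"
  shows "c' \<in> buchi pre' F'"
proof (rule buchi_sim_upto[where R = R, OF _ _ mono cont c])
  fix c c' X assume "R c c'" "c \<in> pre X"
  then have "c' \<in> pre' {b. \<exists>a\<in>X. R a b}" by (rule pre)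
  then show "c' \<in> pre' ({b. \<exists>a\<in>X. R a b} \<union> buchi pre' F')"
    using monoD[OF mono(2) Un_upper1] by blast
qed (rule F)

section \<open>Counter games\<close>

type_synonym 'v edge = "'v \<times> int list \<times> 'v"

abbreviation src :: "'v edge \<Rightarrow> 'v" where "src e \<equiv> fst e"
abbreviation lab :: "'v edge \<Rightarrow> int list" where "lab e \<equiv> fst (snd e)"
abbreviation tgt :: "'v edge \<Rightarrow> 'v" where "tgt e \<equiv> snd (snd e)"

abbreviation coord :: "int list \<Rightarrow> nat \<Rightarrow> int" where "coord \<equiv> nth_default 0"

text \<open>A counter may be lowered spontaneously; this only makes winning harder and makes all winning
  sets upward closed.\<close>

definition fires :: "nat \<Rightarrow> (nat \<Rightarrow> nat) \<Rightarrow> int list \<Rightarrow> (nat \<Rightarrow> nat) \<Rightarrow> bool" where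
  "fires d x z x' \<longleftrightarrow> (\<forall>i<d. int (x' i) \<le> int (x i) + coord z i)"

text \<open>Player 1 chooses how far to lower the counters even after the opponent has chosen the
  edge. Opponent vertices without outgoing edges are excluded because a Buechi objective needs an
  infinite play.\<close>

definition pre :: "nat \<Rightarrow> 'v set \<Rightarrow> 'v edge set \<Rightarrow> ('v \<times> (nat \<Rightarrow> nat)) set \<Rightarrow> ('v \<times> (nat \<Rightarrow> nat)) set" where
  "pre d P E X = {(s, x). if s \<in> P
     then (\<exists>z t. (s, z, t) \<in> E) \<and> (\<forall>z t. (s, z, t) \<in> E \<longrightarrow> (\<exists>x'. fires d x z x' \<and> (t, x') \<in> X))
     else \<exists>z t x'. (s, z, t) \<in> E \<and> fires d x z x' \<and> (t, x') \<in> X}"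

definition win :: "nat \<Rightarrow> 'v set \<Rightarrow> 'v set \<Rightarrow> 'v edge set \<Rightarrow> ('v \<times> (nat \<Rightarrow> nat)) set" where
  "win d P F E = buchi (pre d P E) (F \<times> UNIV)"

lemma pre_P: "s \<in> P \<Longrightarrow> (s, x) \<in> pre d P E X \<longleftrightarrow>
    (\<exists>z t. (s, z, t) \<in> E) \<and> (\<forall>z t. (s, z, t) \<in> E \<longrightarrow> (\<exists>x'. fires d x z x' \<and> (t, x') \<in> X))"
  by (simp add: pre_def)

lemma pre_1: "s \<notin> P \<Longrightarrow> (s, x) \<in> pre d P E X \<longleftrightarrow>
    (\<exists>z t x'. (s, z, t) \<in> E \<and> fires d x z x' \<and> (t, x') \<in> X)"
  by (simp add: pre_def)

lemma mono_pre: "mono (pre d P E)"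
proof (rule monoI, rule subsetI)
  fix X Y :: "('a \<times> (nat \<Rightarrow> nat)) set" and c
  assume "X \<subseteq> Y" "c \<in> pre d P E X"
  then show "c \<in> pre d P E Y"
    by (cases c, cases "fst c \<in> P") (simp_all add: pre_P pre_1, blast+)
qed

lemma continuous_pre:
  assumes "finite E"
  shows "omega_continuous (pre d P E)"
  unfolding omega_continuous_def
proof (intro allI impI subsetI)
  fix A :: "nat \<Rightarrow> ('a \<times> (nat \<Rightarrow> nat)) set" and c
  assume A: "incseq A" and c: "c \<in> pre d P E (\<Union>n. A n)"
  obtain s x where sx: "c = (s, x)" by fastforce
  show "c \<in> (\<Union>n. pre d P E (A n))"
  proof (cases "s \<in> P")
    case True
    note c' = c[unfolded sx pre_P[OF True]]
    then have ex: "\<exists>z t. (s, z, t) \<in> E" by blast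
    have all: "\<exists>n. \<exists>x'. fires d x z x' \<and> (t, x') \<in> A n" if "(s, z, t) \<in> E" for z t
      using c' that by blast
    define N where "N = (\<lambda>(z, t). SOME n. \<exists>x'. fires d x z x' \<and> (t, x') \<in> A n)"
    have N: "\<exists>x'. fires d x z x' \<and> (t, x') \<in> A (N (z, t))" if "(s, z, t) \<in> E" for z t
      unfolding N_def using someI_ex[OF all[OF that]] by simp
    have fin: "finite (N ` snd ` E)" using assms by simp
    define M where "M = Max (N ` snd ` E)"
    have "N (z, t) \<le> M" if "(s, z, t) \<in> E" for z t
      unfolding M_def by (rule Max_ge[OF fin]) (use that in force)
    then have "\<exists>x'. fires d x z x' \<and> (t, x') \<in> A M" if "(s, z, t) \<in> E" for z t
      using N[OF that] that incseqD[OF A] by blast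
    then have "(s, x) \<in> pre d P E (A M)"
      using True ex by (simp add: pre_P)
    then show ?thesis unfolding sx by blast
  next
    case False
    then show ?thesis using c unfolding sx by (auto simp: pre_1)
  qed
qed

lemmas win_unfold = buchi_unfold[OF mono_pre, of d P E "F \<times> UNIV" for d P E F, folded win_def]

lemma pre_win: "finite E \<Longrightarrow> pre d P E (win d P F E) \<subseteq> win d P F E"
  unfolding win_def by (rule pre_buchi[OF mono_pre continuous_pre])

lemma win_sim_upto:
  assumes "\<And>s x s' x'. R (s, x) (s', x') \<Longrightarrow> s \<in> F \<Longrightarrow> s' \<in> F'"
    and "\<And>s x s' x' X. R (s, x) (s', x') \<Longrightarrow> X \<subseteq> win d P F E \<Longrightarrow> (s, x) \<in> pre d P E X \<Longrightarrow>
      (s', x') \<in> pre d' P' E' ({b. \<exists>a\<in>X. R a b} \<union> win d' P' F' E')"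
    and "finite E'" "R c c'" "c \<in> win d P F E"
  shows "c' \<in> win d' P' F' E'"
  unfolding win_def
proof (rule buchi_sim_upto[where R = R and c = c, OF _ _ mono_pre mono_pre continuous_pre assms(4)])
  show "c \<in> buchi (pre d P E) (F \<times> UNIV)" using assms(5) by (simp add: win_def)
  show "finite E'" by fact
  show "R a b \<Longrightarrow> a \<in> F \<times> UNIV \<Longrightarrow> b \<in> F' \<times> UNIV" for a b
    using assms(1)[of "fst a" "snd a" "fst b" "snd b"] by (simp add: mem_Times_iff)
  show "R a b \<Longrightarrow> X \<subseteq> buchi (pre d P E) (F \<times> UNIV) \<Longrightarrow> a \<in> pre d P E X \<Longrightarrow>
      b \<in> pre d' P' E' ({b. \<exists>a\<in>X. R a b} \<union> buchi (pre d' P' E') (F' \<times> UNIV))" for a b X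
    using assms(2)[of "fst a" "snd a" "fst b" "snd b" X] by (simp add: win_def)
qed

lemma win_sim:
  assumes F: "\<And>s x s' x'. R (s, x) (s', x') \<Longrightarrow> s \<in> F \<Longrightarrow> s' \<in> F'"
    and pre: "\<And>s x s' x' X. R (s, x) (s', x') \<Longrightarrow> (s, x) \<in> pre d P E X \<Longrightarrow>
      (s', x') \<in> pre d' P' E' {b. \<exists>a\<in>X. R a b}"
    and "finite E'" "R c c'" "c \<in> win d P F E"
  shows "c' \<in> win d' P' F' E'"
proof (rule win_sim_upto[where R = R, OF _ _ assms(3-5)])
  fix s x s' x' X assume "R (s, x) (s', x')" "(s, x) \<in> pre d P E X"
  then have "(s', x') \<in> pre d' P' E' {b. \<exists>a\<in>X. R a b}" by (rule pre)
  then show "(s', x') \<in> pre d' P' E' ({b. \<exists>a\<in>X. R a b} \<union> win d' P' F' E')"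
    using monoD[OF mono_pre Un_upper1] by blast
qed (rule F)

lemma fires_mono: "fires d x z x' \<Longrightarrow> \<forall>i<d. x i \<le> y i \<Longrightarrow> fires d y z x'"
  unfolding fires_def by (meson add_right_mono of_nat_mono order_trans)

lemma pre_up: "(s, x) \<in> pre d P E X \<Longrightarrow> \<forall>i<d. x i \<le> y i \<Longrightarrow> (s, y) \<in> pre d P E X"
  unfolding pre_def using fires_mono by (simp split: if_splits) blast+

lemma win_up:
  "(s, x) \<in> win d P F E \<Longrightarrow> finite E \<Longrightarrow> \<forall>i<d. x i \<le> y i \<Longrightarrow> (s, y) \<in> win d P F E"
proof (rule win_sim[where R = "\<lambda>c c'. fst c = fst c' \<and> (\<forall>i<d. snd c i \<le> snd c' i)"])
  fix s x s' x' X
  assume "fst (s::'a, x) = fst (s', x') \<and> (\<forall>i<d. snd (s, x) i \<le> snd (s', x') i)"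
    and "(s, x) \<in> pre d P E X"
  then have "(s', x') \<in> pre d P E X" using pre_up by auto
  then show "(s', x') \<in> pre d P E {b. \<exists>a\<in>X. fst a = fst b \<and> (\<forall>i<d. snd a i \<le> snd b i)}"
    using monoD[OF mono_pre, of X "{b. \<exists>a\<in>X. fst a = fst b \<and> (\<forall>i<d. snd a i \<le> snd b i)}" d P E]
    by blast
qed auto

section \<open>Memoryless opponents for unknown initial credit\<close>

text \<open>If Player 1 wins from \<open>q\<close> against both halves of the opponent's choices at \<open>q\<close>, she interleaves
  the two plays, each with its own credit; the sum of the two ranks decreases.\<close>

lemma win_interleave:
  assumes fin: "finite E" and q: "q \<in> P"
    and sub: "El \<subseteq> E" "Er \<subseteq> E"
    and other: "\<And>e. e \<in> E \<Longrightarrow> src e \<noteq> q \<Longrightarrow> e \<in> El \<and> e \<in> Er"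
    and cover: "\<And>e. e \<in> E \<Longrightarrow> src e = q \<Longrightarrow> e \<in> El \<or> e \<in> Er"
    and s: "(s, x) \<in> win d P F El" and qr: "(q, y) \<in> win d P F Er"
  shows "(s, \<lambda>i. x i + y i) \<in> win d P F E"
proof -
  \<comment> \<open>The active play is at \<open>s\<close> with credit \<open>x\<close> in the game
    \<open>A\<close>; the other play, in the game \<open>B\<close>, is suspended at \<open>q\<close>
    with credit \<open>y\<close>.\<close>
  define Z1 where "Z1 A B = {(s, z). \<exists>x y. z = (\<lambda>i. x i + y i) \<and> (s, x) \<in> win d P F A \<and> (q, y) \<in> win d P F B}" for A B
  define Z where "Z = Z1 El Er \<union> Z1 Er El"
  define good where "good A B \<longleftrightarrow> (A = El \<and> B = Er) \<or> (A = Er \<and> B = El)" for A B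
  have ZI: "(s, \<lambda>i. x i + y i) \<in> Z" if "good A B" "(s, x) \<in> win d P F A" "(q, y) \<in> win d P F B" for s x y A B
    using that unfolding Z_def Z1_def good_def by blast
  let ?pre = "pre d P" and ?F = "F \<times> UNIV"
  have fires_add: "fires d x z x' \<Longrightarrow> fires d (\<lambda>i. x i + y i) z (\<lambda>i. x' i + y i)" for x y z x'
    unfolding fires_def by auto
  have lift_other: "(s, \<lambda>i. x i + y i) \<in> ?pre E Y"
    if "good A B" "s \<noteq> q" "(s, x) \<in> ?pre A X" "\<And>t x'. (t, x') \<in> X \<Longrightarrow> (t, \<lambda>i. x' i + y i) \<in> Y"
    for A B s x y X Y
  proof -
    have "A = El \<or> A = Er" using that(1) unfolding good_def by blast
    then have eq: "(s, z, t) \<in> A \<longleftrightarrow> (s, z, t) \<in> E" for z t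
      using \<open>s \<noteq> q\<close> other[of "(s, z, t)"] sub by auto
    show ?thesis
    proof (cases "s \<in> P")
      case True
      then show ?thesis using that(3,4) fires_add unfolding pre_P[OF True] eq by meson
    next
      case False
      then show ?thesis using that(3,4) fires_add unfolding pre_1[OF False] eq by meson
    qed
  qed
  \<comment> \<open>At \<open>q\<close> the edge chosen by the opponent decides which of the two
    plays moves on; the other one stays suspended at \<open>q\<close>, so the roles of
    \<open>A\<close> and \<open>B\<close> may swap.\<close>
  have lift_q: "(q, \<lambda>i. x i + y i) \<in> ?pre E Y"
    if g: "good A B" "(q, x) \<in> ?pre A X" "(q, y) \<in> ?pre B X'"
      "\<And>t x'. (t, x') \<in> X \<Longrightarrow> (t, \<lambda>i. x' i + y i) \<in> Y"
      "\<And>t y'. (t, y') \<in> X' \<Longrightarrow> (t, \<lambda>i. y' i + x i) \<in> Y"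
    for A B x y X X' Y
    unfolding pre_P[OF q]
  proof (intro conjI allI impI)
    show "\<exists>z t. (q, z, t) \<in> E"
      using g(1,2) sub unfolding pre_P[OF q] good_def by blast
    fix z t assume "(q, z, t) \<in> E"
    then have "(q, z, t) \<in> A \<or> (q, z, t) \<in> B"
      using g(1) cover[of "(q, z, t)"] unfolding good_def by auto
    then show "\<exists>x'. fires d (\<lambda>i. x i + y i) z x' \<and> (t, x') \<in> Y"
    proof
      assume "(q, z, t) \<in> A"
      then obtain x' where "fires d x z x'" "(t, x') \<in> X" using g(2) unfolding pre_P[OF q] by blast
      then show ?thesis using g(4) fires_add by blast
    next
      assume "(q, z, t) \<in> B"
      then obtain y' where "fires d y z y'" "(t, y') \<in> X'" using g(3) unfolding pre_P[OF q] by blast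
      then show ?thesis using g(5) fires_add[of y z y' x] by (metis (no_types, lifting) ext add.commute)
    qed
  qed
  let ?W = "win d P F"
  have pre_attZ: "?pre E (att (?pre E) ?F Z) \<subseteq> att (?pre E) ?F Z"
    by (rule pre_att[OF mono_pre continuous_pre[OF fin]])
  have F_attZ: "?F \<inter> ?pre E Z \<subseteq> att (?pre E) ?F Z"
    using attn_subset_att[of "?pre E" ?F "Suc 0" Z] by auto
  have sub_pre: "attn (?pre A) ?F n (?W A) \<subseteq> ?pre A (?W A)" for A n
    unfolding win_def by (rule attn_buchi_pre[OF mono_pre])
  have sub_win: "attn (?pre A) ?F n (?W A) \<subseteq> ?W A" for A n
    unfolding win_def by (rule attn_buchi_subset[OF mono_pre])
  have main: "(s, \<lambda>i. x i + y i) \<in> att (?pre E) ?F Z"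
    if "good A B" "(s, x) \<in> attn (?pre A) ?F n (?W A)" "(q, y) \<in> attn (?pre B) ?F m (?W B)" "n + m \<le> k"
    for k n m A B s x y
    using that
  proof (induction k arbitrary: n m A B s x y)
    case (Suc k)
    obtain n' where n': "n = Suc n'" using Suc.prems(2) by (cases n) auto
    obtain m' where m': "m = Suc m'" using Suc.prems(3) by (cases m) auto
    have good': "good B A" using Suc.prems(1) unfolding good_def by blast
    have x: "(s, x) \<in> ?pre A (?W A)" and y: "(q, y) \<in> ?pre B (?W B)"
      using Suc.prems(2,3) sub_pre by blast+
    have xw: "(s, x) \<in> ?W A" and yw: "(q, y) \<in> ?W B"
      using Suc.prems(2,3) sub_win by blast+
    show ?case
    proof (cases "s = q")
      case False
      show ?thesis
      proof (cases "s \<in> F")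
        case True
        have "(s, \<lambda>i. x i + y i) \<in> ?pre E Z"
          by (rule lift_other[OF Suc.prems(1) False x]) (rule ZI[OF Suc.prems(1) _ yw])
        then show ?thesis using F_attZ True by blast
      next
        case F: False
        then have x': "(s, x) \<in> ?pre A (attn (?pre A) ?F n' (?W A))"
          using Suc.prems(2) n' by auto
        have "(s, \<lambda>i. x i + y i) \<in> ?pre E (att (?pre E) ?F Z)"
          by (rule lift_other[OF Suc.prems(1) False x'], rule Suc.IH[OF Suc.prems(1) _ Suc.prems(3)])
            (use Suc.prems(4) n' in auto)
        then show ?thesis using pre_attZ by blast
      qed
    next
      case True
      show ?thesis
      proof (cases "q \<in> F")
        case qF: True
        have "(s, \<lambda>i. x i + y i) \<in> ?pre E Z" unfolding True
          by (rule lift_q[OF Suc.prems(1) x[unfolded True] y])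
            (rule ZI[OF Suc.prems(1) _ yw] ZI[OF good' _ xw[unfolded True]], assumption)+
        then show ?thesis using F_attZ True qF by blast
      next
        case F: False
        then have x': "(q, x) \<in> ?pre A (attn (?pre A) ?F n' (?W A))"
          and y': "(q, y) \<in> ?pre B (attn (?pre B) ?F m' (?W B))"
          using Suc.prems(2,3) n' m' True by auto
        have "(q, \<lambda>i. x i + y i) \<in> ?pre E (att (?pre E) ?F Z)"
          by (rule lift_q[OF Suc.prems(1) x' y'], rule Suc.IH[OF Suc.prems(1) _ Suc.prems(3)], assumption)
            (use Suc.prems(4) n' m' True in \<open>auto intro: Suc.IH[OF good' _ Suc.prems(2)[unfolded True]]\<close>)
        then show ?thesis using pre_attZ True by blast
      qed
    qed
  qed simp
  have Z1sub: "Z1 A B \<subseteq> att (?pre E) ?F Z" if "good A B" for A B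
  proof
    fix c assume "c \<in> Z1 A B"
    then obtain s x y where c: "c = (s, \<lambda>i. x i + y i)" "(s, x) \<in> ?W A" "(q, y) \<in> ?W B"
      unfolding Z1_def by blast
    then have "(s, x) \<in> att (?pre A) ?F (?W A)" "(q, y) \<in> att (?pre B) ?F (?W B)"
      using win_unfold by blast+
    then show "c \<in> att (?pre E) ?F Z" unfolding att_def c(1)
      using main[OF that _ _ order_refl] by (auto simp: att_def)
  qed
  have "Z \<subseteq> att (?pre E) ?F Z" using Z1sub unfolding good_def Z_def by blast
  then have "Z \<subseteq> ?W E" unfolding win_def by (rule buchi_coinduct)
  then show ?thesis using ZI[OF _ s qr] unfolding good_def by blast
qed

text \<open>A play that stays in the winning set never visits \<open>q\<close>, so the edges at
  \<open>q\<close> may be exchanged without affecting it.\<close>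

lemma win_avoid:
  assumes same: "\<And>z t s. s \<noteq> q \<Longrightarrow> (s, z, t) \<in> E \<longleftrightarrow> (s, z, t) \<in> E'"
    and q: "\<And>x. (q, x) \<notin> win d P F E'" and s: "(s, x) \<in> win d P F E'"
  shows "(s, x) \<in> win d P F E"
proof -
  let ?pre = "pre d P" and ?F = "F \<times> UNIV" and ?W = "win d P F E'"
  have lift: "(s, x) \<in> ?pre E X" if "(s, x) \<in> ?W" "(s, x) \<in> ?pre E' X" for s x X
  proof -
    have "s \<noteq> q" using that(1) q by blast
    then show ?thesis using that(2) same[of s] by (cases "s \<in> P") (simp_all add: pre_P pre_1)
  qed
  have sub: "attn (?pre E') ?F n ?W \<subseteq> ?W" for n
    unfolding win_def by (rule attn_buchi_subset[OF mono_pre])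
  have "attn (?pre E') ?F n ?W \<subseteq> attn (?pre E) ?F n ?W" for n
  proof (induction n)
    case (Suc n)
    show ?case
    proof
      fix c assume c: "c \<in> attn (?pre E') ?F (Suc n) ?W"
      then have "c \<in> ?W" using sub by blast
      then have "c \<in> ?pre E' X \<Longrightarrow> c \<in> ?pre E X" for X using lift by (cases c) blast
      moreover have "?pre E (attn (?pre E') ?F n ?W) \<subseteq> ?pre E (attn (?pre E) ?F n ?W)"
        using Suc by (rule monoD[OF mono_pre])
      ultimately show "c \<in> attn (?pre E) ?F (Suc n) ?W" using c by auto
    qed
  qed simp
  then have "att (?pre E') ?F ?W \<subseteq> att (?pre E) ?F ?W" unfolding att_def by blast
  then have "?W \<subseteq> att (?pre E) ?F ?W" using win_unfold[of d P F E'] by blast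
  then have "?W \<subseteq> win d P F E" unfolding win_def[of d P F E] by (rule buchi_coinduct)
  then show ?thesis using s by blast
qed

text \<open>Split the alternatives at an opponent vertex \<open>q\<close> into one edge and the
  rest. If Player 1 won from \<open>s\<close> against either half, \<open>win_avoid\<close> would
  let her win from \<open>q\<close> as well, and \<open>win_interleave\<close> would add up the
  credits to a win against all edges. So one half already defeats her for every credit, and
  induction on the number of edges applies to it.\<close>

lemma memoryless_opponent:
  assumes "finite E" "\<And>x. (s, x) \<notin> win d P F E"
  shows "\<exists>E'\<subseteq>E. (\<forall>e\<in>E. src e \<notin> P \<longrightarrow> e \<in> E') \<and>
    (\<forall>e\<in>E. src e \<in> P \<longrightarrow> (\<exists>e'\<in>E'. src e' = src e)) \<and>
    (\<forall>e\<in>E'. \<forall>e'\<in>E'. src e \<in> P \<and> src e = src e' \<longrightarrow> e = e') \<and>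
    (\<forall>x. (s, x) \<notin> win d P F E')"
  using assms
proof (induction "card E" arbitrary: E rule: less_induct)
  case less
  show ?case
  proof (cases "\<exists>e1\<in>E. \<exists>e2\<in>E. e1 \<noteq> e2 \<and> src e1 \<in> P \<and> src e1 = src e2")
    case False
    then show ?thesis using less.prems by (intro exI[of _ E]) blast
  next
    case True
    then obtain e1 e2 where e: "e1 \<in> E" "e2 \<in> E" "e1 \<noteq> e2" "src e1 \<in> P" "src e1 = src e2" by blast
    define q where "q = src e1"
    define El where "El = E - {e1}"
    define Er where "Er = {e \<in> E. src e = q \<longrightarrow> e = e1}"
    have sub: "El \<subset> E" "Er \<subset> E" using e unfolding El_def Er_def q_def by auto
    have same: "s \<noteq> q \<Longrightarrow> (s, z, t) \<in> E \<longleftrightarrow> (s, z, t) \<in> El" "s \<noteq> q \<Longrightarrow> (s, z, t) \<in> E \<longleftrightarrow> (s, z, t) \<in> Er"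
      for s z t unfolding El_def Er_def q_def by auto
    have "(\<forall>x. (s, x) \<notin> win d P F El) \<or> (\<forall>x. (s, x) \<notin> win d P F Er)"
    proof (rule ccontr)
      assume "\<not> ?thesis"
      then obtain x y where x: "(s, x) \<in> win d P F El" and y: "(s, y) \<in> win d P F Er" by blast
      have "\<exists>x. (q, x) \<in> win d P F El" using win_avoid[OF same(1) _ x] less.prems(2) by blast
      moreover have "\<exists>x. (q, x) \<in> win d P F Er" using win_avoid[OF same(2) _ y] less.prems(2) by blast
      then obtain b where b: "(q, b) \<in> win d P F Er" by blast
      have "(s, \<lambda>i. x i + b i) \<in> win d P F E"
        by (rule win_interleave[OF less.prems(1) _ _ _ _ _ x b])
          (use e in \<open>auto simp: q_def El_def Er_def\<close>)
      then show False using less.prems(2) by blast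
    qed
    then obtain E1 where E1: "E1 = El \<or> E1 = Er" "\<forall>x. (s, x) \<notin> win d P F E1" by blast
    then have "E1 \<subset> E" using sub by blast
    then have "card E1 < card E" "finite E1"
      using less.prems(1) by (auto intro: psubset_card_mono finite_subset)
    then obtain E' where E': "E' \<subseteq> E1" "\<forall>e\<in>E1. src e \<notin> P \<longrightarrow> e \<in> E'"
      "\<forall>e\<in>E1. src e \<in> P \<longrightarrow> (\<exists>e'\<in>E'. src e' = src e)"
      "\<forall>e\<in>E'. \<forall>e'\<in>E'. src e \<in> P \<and> src e = src e' \<longrightarrow> e = e'"
      "\<forall>x. (s, x) \<notin> win d P F E'"
      using less.hyps[of E1] E1(2) by blast
    have keep: "\<exists>e'\<in>E1. src e' = src e" if "e \<in> E" for e
      using that E1(1) e unfolding El_def Er_def q_def by (cases "src e = src e1") auto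
    have "e \<in> E1" if "e \<in> E" "src e \<notin> P" for e
      using that E1(1) e unfolding El_def Er_def q_def by auto
    moreover have "\<exists>e'\<in>E'. src e' = src e" if "e \<in> E" "src e \<in> P" for e
      using keep[OF that(1)] E'(3) that(2) by metis
    ultimately show ?thesis using E' \<open>E1 \<subset> E\<close>
      by (intro exI[of _ E']) auto
  qed
qed

section \<open>Fourier--Motzkin elimination\<close>

text \<open>A row \<open>r\<close> stands for the inequality \<open>(\<Sum>i. r (Some i) * y i) \<le> r None\<close>.\<close>

inductive_set cone :: "('j \<Rightarrow> int) set \<Rightarrow> ('j \<Rightarrow> int) set" for A where
  cone_base: "a \<in> A \<Longrightarrow> a \<in> cone A"
| cone_add: "a \<in> cone A \<Longrightarrow> b \<in> cone A \<Longrightarrow> (\<lambda>j. a j + b j) \<in> cone A"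

lemma cone_scale:
  assumes "a \<in> cone A" "0 < (k::int)"
  shows "(\<lambda>j. k * a j) \<in> cone A"
proof -
  have "(\<lambda>j. int (Suc n) * a j) \<in> cone A" for n
  proof (induction n)
    case (Suc n)
    have "(\<lambda>j. int (Suc n) * a j + a j) \<in> cone A" by (rule cone_add[OF Suc assms(1)])
    then show ?case by (simp add: algebra_simps)
  qed (simp add: assms(1))
  from this[of "nat k - 1"] show ?thesis using assms(2) by simp
qed

lemma cone_subset: "A \<subseteq> cone B \<Longrightarrow> cone A \<subseteq> cone B"
proof
  fix x assume "A \<subseteq> cone B" "x \<in> cone A"
  from this(2,1) show "x \<in> cone B" by induction (auto intro: cone_add)
qed

lemma ex_between:
  fixes L U :: "'a::linorder set"
  assumes "finite L" "finite U" "\<And>l u. l \<in> L \<Longrightarrow> u \<in> U \<Longrightarrow> l \<le> u"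
  shows "\<exists>t. (\<forall>l\<in>L. l \<le> t) \<and> (\<forall>u\<in>U. t \<le> u)"
proof (cases "L = {}")
  case True
  then show ?thesis using Min_le[OF assms(2)] by (cases "U = {}") auto
next
  case False
  then show ?thesis using assms Max_ge[OF assms(1)] Max_in[OF assms(1) False] by blast
qed

text \<open>Eliminating \<open>k\<close> replaces each pair of rows with opposite signs at
  \<open>k\<close> by the combination in which \<open>k\<close> cancels. A refutation of the new
  system is one of the old; a solution extends to \<open>k\<close> because every lower bound for
  \<open>k\<close> is below every upper bound. Multipliers stay integral, so that a refutation
  counts rows with multiplicity; these rows later become the edges of a circulation.\<close>

lemma fourier_motzkin:
  fixes A :: "('i option \<Rightarrow> int) set"
  assumes "finite I" "finite A" "\<And>r i. r \<in> A \<Longrightarrow> i \<notin> I \<Longrightarrow> r (Some i) = 0"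
  shows "(\<exists>y::'i \<Rightarrow> rat. \<forall>r\<in>A. (\<Sum>i\<in>I. of_int (r (Some i)) * y i) \<le> of_int (r None)) \<or>
    (\<exists>r\<in>cone A. (\<forall>i. r (Some i) = 0) \<and> r None < 0)"
  using assms
proof (induction I arbitrary: A rule: finite_induct)
  case empty
  then have zero: "\<And>r i. r \<in> A \<Longrightarrow> r (Some i) = 0" by simp
  show ?case
  proof (cases "\<exists>r\<in>A. r None < 0")
    case True
    then show ?thesis using zero cone_base by metis
  next
    case False
    then show ?thesis by (auto simp: not_less)
  qed
next
  case (insert k I)
  define A0 where "A0 = {r \<in> A. r (Some k) = 0}"
  define Ap where "Ap = {r \<in> A. r (Some k) > 0}"
  define An where "An = {r \<in> A. r (Some k) < 0}"
  define comb where "comb p n = (\<lambda>j. (- n (Some k)) * p j + p (Some k) * n j)" for p n :: "'i option \<Rightarrow> int"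
  define A' where "A' = A0 \<union> (\<lambda>(p, n). comb p n) ` (Ap \<times> An)"
  have fin: "finite A0" "finite Ap" "finite An" "finite A'"
    using insert.prems(1) unfolding A0_def Ap_def An_def A'_def by auto
  have comb_cone: "comb p n \<in> cone A" if "p \<in> Ap" "n \<in> An" for p n
    unfolding comb_def using that
    by (intro cone_add cone_scale cone_base) (auto simp: Ap_def An_def)
  have A'_cone: "A' \<subseteq> cone A"
    unfolding A'_def using comb_cone by (auto simp: A0_def intro: cone_base)
  have zero': "r (Some i) = 0" if "r \<in> A'" "i \<notin> I" for r i
  proof (cases "i = k")
    case True
    then show ?thesis using that unfolding A'_def A0_def comb_def by auto
  next
    case False
    then have z: "r (Some i) = 0" if "r \<in> A" for r
      using insert.prems(2)[OF that, of i] \<open>i \<notin> I\<close> by simp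
    from that(1) show ?thesis
      unfolding A'_def A0_def Ap_def An_def comb_def by (auto simp: z)
  qed
  show ?case
  proof (rule disjE[OF insert.IH[OF fin(4)]])
    show "r (Some i) = 0" if "r \<in> A'" "i \<notin> I" for r i by (rule zero'[OF that])
  next
    assume "\<exists>r\<in>cone A'. (\<forall>i. r (Some i) = 0) \<and> r None < 0"
    then show ?thesis using cone_subset[OF A'_cone] by blast
  next
    assume "\<exists>y::'i \<Rightarrow> rat. \<forall>r\<in>A'. (\<Sum>i\<in>I. of_int (r (Some i)) * y i) \<le> of_int (r None)"
    then obtain y :: "'i \<Rightarrow> rat"
      where y: "\<And>r. r \<in> A' \<Longrightarrow> (\<Sum>i\<in>I. of_int (r (Some i)) * y i) \<le> of_int (r None)" by blast
    define s where "s r = (\<Sum>i\<in>I. of_int (r (Some i)) * y i)" for r :: "'i option \<Rightarrow> int"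
    define b where "b r = (of_int (r None) - s r) / of_int (r (Some k))" for r :: "'i option \<Rightarrow> int"
    have "b n \<le> b p" if "n \<in> An" "p \<in> Ap" for n p
    proof -
      have "comb p n \<in> A'" unfolding A'_def using that by force
      from y[OF this] have "s (comb p n) \<le> of_int (comb p n None)" unfolding s_def .
      moreover have "s (comb p n) = of_int (- n (Some k)) * s p + of_int (p (Some k)) * s n"
        unfolding s_def comb_def sum_distrib_left
        by (simp add: sum.distrib[symmetric] algebra_simps)
      ultimately have "of_int (- n (Some k)) * s p + of_int (p (Some k)) * s n
          \<le> of_int (- n (Some k)) * of_int (p None) + of_int (p (Some k)) * of_int (n None)"
        unfolding comb_def by simp
      moreover have "of_int (n (Some k)) < (0::rat)" "of_int (p (Some k)) > (0::rat)"
        using that unfolding An_def Ap_def by auto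
      ultimately show ?thesis unfolding b_def
        by (simp add: field_simps)
    qed
    then have "\<exists>t. (\<forall>l\<in>b ` An. l \<le> t) \<and> (\<forall>u\<in>b ` Ap. t \<le> u)"
      by (intro ex_between) (use fin in auto)
    then obtain t where t: "\<And>n. n \<in> An \<Longrightarrow> b n \<le> t" "\<And>p. p \<in> Ap \<Longrightarrow> t \<le> b p"
      by auto
    have "(\<Sum>i\<in>insert k I. of_int (r (Some i)) * (y(k := t)) i) \<le> of_int (r None)" if r: "r \<in> A" for r
    proof -
      have "(\<Sum>i\<in>insert k I. of_int (r (Some i)) * (y(k := t)) i) = of_int (r (Some k)) * t + s r"
        unfolding s_def using insert.hyps by (auto intro!: sum.cong)
      also have "\<dots> \<le> of_int (r None)"
      proof (rule linorder_cases[of "r (Some k)" 0])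
        assume "r (Some k) = 0"
        then show ?thesis using y[of r] r unfolding A'_def A0_def s_def by auto
      next
        assume *: "r (Some k) < 0"
        then have "b r \<le> t" using t(1) r unfolding An_def by blast
        then show ?thesis using * unfolding b_def by (simp add: field_simps)
      next
        assume *: "r (Some k) > 0"
        then have "t \<le> b r" using t(2) r unfolding Ap_def by blast
        then show ?thesis using * unfolding b_def by (simp add: field_simps)
      qed
      finally show ?thesis .
    qed
    then show ?thesis by blast
  qed
qed

lemma common_denominator:
  fixes y :: "'i \<Rightarrow> rat"
  assumes "finite I"
  shows "\<exists>N>0. \<exists>Y::'i \<Rightarrow> int. \<forall>i\<in>I. of_int (Y i) = of_int N * y i"
  using assms
proof induction
  case empty
  then show ?case by (intro exI[of _ 1]) simp
next
  case (insert k I)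
  then obtain N Y where NY: "(0::int) < N" "\<forall>i\<in>I. of_int (Y i) = of_int N * y i" by blast
  obtain a b where ab: "y k = of_int a / of_int b" "b > 0"
    using quotient_of_div quotient_of_denom_pos by (metis surj_pair)
  show ?case
    using NY ab insert.hyps
    by (intro exI[of _ "N * b"] conjI exI[of _ "\<lambda>i. if i = k then N * a else b * Y i"]) auto
qed

section \<open>Circulations and closed walks\<close>

definition effect :: "'v edge list \<Rightarrow> nat \<Rightarrow> int" where
  "effect es i = (\<Sum>e\<leftarrow>es. coord (lab e) i)"

lemma effect_simps [simp]:
  "effect [] i = 0" "effect (e # es) i = coord (lab e) i + effect es i"
  "effect (es @ es') i = effect es i + effect es' i"
  by (simp_all add: effect_def)

text \<open>Integral circulations: Kirchhoff's law at every vertex.\<close>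

definition balanced :: "'v edge multiset \<Rightarrow> bool" where
  "balanced M \<longleftrightarrow> image_mset src M = image_mset tgt M"

text \<open>The linear system for a ranking function. Its unknowns are a potential for each vertex
  (\<open>Inl\<close>) and a weight for each counter (\<open>Inr\<close>); the row of an edge says
  that the ranking function does not grow along it and, for \<open>e0\<close>, that it drops by at
  least 1. The rows \<open>sign_row i\<close> make the weights non-negative.\<close>

definition row :: "nat \<Rightarrow> 'v edge \<Rightarrow> 'v edge \<Rightarrow> ('v + nat) option \<Rightarrow> int" where
  "row d e0 e j = (case j of None \<Rightarrow> if e = e0 then -1 else 0
     | Some (Inl v) \<Rightarrow> (if tgt e = v then 1 else 0) - (if src e = v then 1 else 0)
     | Some (Inr i) \<Rightarrow> if i < d then coord (lab e) i else 0)"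

definition sign_row :: "nat \<Rightarrow> ('v + nat) option \<Rightarrow> int" where
  "sign_row i j = (if j = Some (Inr i) then -1 else 0)"

lemma cone_rows:
  assumes "r \<in> cone (row d e0 ` E \<union> sign_row ` {..<d})"
  shows "\<exists>es us. set es \<subseteq> E \<and> set us \<subseteq> {..<d} \<and>
    r = (\<lambda>j. (\<Sum>e\<leftarrow>es. row d e0 e j) + (\<Sum>i\<leftarrow>us. sign_row i j))"
  using assms
proof induction
  case (cone_base a)
  then consider e where "e \<in> E" "a = row d e0 e" | i where "i < d" "a = sign_row i" by blast
  then show ?case
  proof cases
    case 1
    then show ?thesis by (intro exI[of _ "[e]"] exI[of _ "[]"]) auto
  next
    case 2
    then show ?thesis by (intro exI[of _ "[]"] exI[of _ "[i]"]) auto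
  qed
next
  case (cone_add a b)
  then obtain es us es' us' where
    "set es \<subseteq> E" "set us \<subseteq> {..<d}" "a = (\<lambda>j. (\<Sum>e\<leftarrow>es. row d e0 e j) + (\<Sum>i\<leftarrow>us. sign_row i j))"
    "set es' \<subseteq> E" "set us' \<subseteq> {..<d}" "b = (\<lambda>j. (\<Sum>e\<leftarrow>es'. row d e0 e j) + (\<Sum>i\<leftarrow>us'. sign_row i j))"
    by blast
  then show ?case by (intro exI[of _ "es @ es'"] exI[of _ "us @ us'"]) auto
qed

lemma count_image_mset_sum:
  "int (count (mset (map f es)) v) = (\<Sum>e\<leftarrow>es. if f e = v then 1 else 0)"
  by (induction es) auto

text \<open>Read a refutation of the system column by column: vanishing at \<open>Inl v\<close> is
  balance at \<open>v\<close>, vanishing at \<open>Inr i\<close> says that the effect equals the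
  number of sign rows used for \<open>i\<close>, and the negative right-hand side forces
  \<open>e0\<close> to occur.\<close>

lemma farkas_circulation:
  fixes E :: "'v edge set"
  assumes "finite E" "e0 \<in> E"
  shows "(\<exists>es. set es \<subseteq> E \<and> e0 \<in> set es \<and> balanced (mset es) \<and> (\<forall>i<d. 0 \<le> effect es i)) \<or>
    (\<exists>(l::nat \<Rightarrow> nat) (p::'v \<Rightarrow> int). \<forall>e\<in>E.
       p (tgt e) - p (src e) + (\<Sum>i<d. int (l i) * coord (lab e) i) \<le> (if e = e0 then -1 else 0))"
proof -
  define V where "V = src ` E \<union> tgt ` E"
  define I :: "('v + nat) set" where "I = Inl ` V \<union> Inr ` {..<d}"
  define A where "A = row d e0 ` E \<union> sign_row ` {..<d}"
  have finV: "finite V" and finI: "finite I" and finA: "finite A"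
    using assms(1) unfolding V_def I_def A_def by auto
  have zero: "r (Some i) = 0" if "r \<in> A" "i \<notin> I" for r i
  proof -
    from that(1) consider e where "e \<in> E" "r = row d e0 e" | j where "j < d" "r = sign_row j"
      unfolding A_def by blast
    then show ?thesis
    proof cases
      case 1
      then have "src e \<in> V" "tgt e \<in> V" unfolding V_def by auto
      then show ?thesis using that(2) 1(2) unfolding I_def by (cases i) (auto simp: row_def)
    next
      case 2
      then show ?thesis using that(2) unfolding I_def by (auto simp: sign_row_def)
    qed
  qed
  show ?thesis
  proof (rule disjE[OF fourier_motzkin[OF finI finA]])
    show "r (Some i) = 0" if "r \<in> A" "i \<notin> I" for r i by (rule zero[OF that])
  next
    assume "\<exists>r\<in>cone A. (\<forall>i. r (Some i) = 0) \<and> r None < 0"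
    then obtain r where r: "r \<in> cone A" "\<And>i. r (Some i) = 0" "r None < 0" by blast
    then obtain es us where es: "set es \<subseteq> E" "set us \<subseteq> {..<d}"
      and req: "r = (\<lambda>j. (\<Sum>e\<leftarrow>es. row d e0 e j) + (\<Sum>i\<leftarrow>us. sign_row i j))"
      using cone_rows unfolding A_def by blast
    have neg: "(\<Sum>i\<leftarrow>us. sign_row i j) \<le> 0" for j :: "('v + nat) option"
      by (induction us) (auto simp: sign_row_def)
    have zero: "(\<Sum>i\<leftarrow>us. sign_row i (None :: ('v + nat) option)) = 0" "(\<Sum>i\<leftarrow>us. sign_row i (Some (Inl v))) = 0" for v :: 'v
      by (induction us) (auto simp: sign_row_def)
    have "e0 \<in> set es"
    proof (rule ccontr)
      assume "e0 \<notin> set es"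
      then have "(\<Sum>e\<leftarrow>es. row d e0 e None) = 0" by (induction es) (auto simp: row_def)
      then show False using r(3) zero(1) unfolding req by simp
    qed
    moreover have "balanced (mset es)"
    proof -
      have "int (count (mset (map src es)) v) = int (count (mset (map tgt es)) v)" for v
      proof -
        have "(\<Sum>e\<leftarrow>es. row d e0 e (Some (Inl v))) = 0"
          using r(2)[of "Inl v"] zero(2) unfolding req by simp
        then show ?thesis unfolding count_image_mset_sum
          by (simp add: row_def sum_list_subtractf)
      qed
      then show ?thesis unfolding balanced_def by (intro multiset_eqI) simp
    qed
    moreover have "0 \<le> effect es i" if "i < d" for i
    proof -
      have "(\<Sum>e\<leftarrow>es. row d e0 e (Some (Inr i))) = effect es i"
        unfolding effect_def using that by (simp add: row_def)
      then show ?thesis using r(2)[of "Inr i"] neg[of "Some (Inr i)"] unfolding req by simp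
    qed
    ultimately show ?thesis using es(1) by blast
  next
    assume "\<exists>y::'v + nat \<Rightarrow> rat. \<forall>r\<in>A. (\<Sum>i\<in>I. of_int (r (Some i)) * y i) \<le> of_int (r None)"
    then obtain y :: "'v + nat \<Rightarrow> rat"
      where y: "\<And>r. r \<in> A \<Longrightarrow> (\<Sum>i\<in>I. of_int (r (Some i)) * y i) \<le> of_int (r None)" by blast
    \<comment> \<open>Clearing denominators turns the right-hand side at \<open>e0\<close> into
      \<open>-N\<close>, which is at most -1.\<close>
    obtain N Y where N: "N > 0" and Y: "\<And>i. i \<in> I \<Longrightarrow> of_int (Y i) = of_int N * y i"
      using common_denominator[OF finI, of y] by blast
    have YA: "(\<Sum>i\<in>I. r (Some i) * Y i) \<le> N * r None" if "r \<in> A" for r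
    proof -
      have "of_int (\<Sum>i\<in>I. r (Some i) * Y i) = of_int N * (\<Sum>i\<in>I. of_int (r (Some i)) * y i)"
        unfolding sum_distrib_left of_int_sum of_int_mult
        by (rule sum.cong) (simp_all add: Y)
      also have "\<dots> \<le> of_int N * of_int (r None)"
        using y[OF that] N by (intro mult_left_mono) auto
      also have "\<dots> = of_int (N * r None)" by simp
      finally show ?thesis unfolding of_int_le_iff .
    qed
    have sumI: "(\<Sum>i\<in>I. f i) = (\<Sum>v\<in>V. f (Inl v)) + (\<Sum>i<d. f (Inr i))" for f :: "'v + nat \<Rightarrow> int"
      unfolding I_def using finV
      by (subst sum.union_disjoint) (auto simp: sum.reindex inj_on_def)
    have Ynonneg: "0 \<le> Y (Inr i)" if "i < d" for i
    proof -
      have "(\<Sum>j<d. sign_row i (Some (Inr j :: 'v + nat)) * Y (Inr j)) = (\<Sum>j<d. if i = j then - Y (Inr j) else 0)"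
        by (rule sum.cong) (auto simp: sign_row_def)
      also have "\<dots> = - Y (Inr i)" using that by (simp add: sum.delta')
      moreover have "(\<Sum>j\<in>I. sign_row i (Some j) * Y j) \<le> N * sign_row i (None :: ('v + nat) option)"
        by (rule YA) (use that in \<open>auto simp: A_def\<close>)
      ultimately show ?thesis unfolding sumI by (simp add: sign_row_def)
    qed
    have "Y (Inl (tgt e)) - Y (Inl (src e)) + (\<Sum>i<d. int (nat (Y (Inr i))) * coord (lab e) i)
        \<le> (if e = e0 then -1 else 0)" if e: "e \<in> E" for e
    proof -
      have V: "src e \<in> V" "tgt e \<in> V" using e unfolding V_def by auto
      have "(\<Sum>v\<in>V. row d e0 e (Some (Inl v)) * Y (Inl v)) =
          (\<Sum>v\<in>V. (if tgt e = v then Y (Inl v) else 0) - (if src e = v then Y (Inl v) else 0))"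
        by (rule sum.cong) (auto simp: row_def)
      also have "\<dots> = Y (Inl (tgt e)) - Y (Inl (src e))"
        using V finV by (simp add: sum_subtractf)
      finally have 1: "(\<Sum>v\<in>V. row d e0 e (Some (Inl v)) * Y (Inl v)) = Y (Inl (tgt e)) - Y (Inl (src e))" .
      have 2: "(\<Sum>i<d. row d e0 e (Some (Inr i)) * Y (Inr i)) = (\<Sum>i<d. int (nat (Y (Inr i))) * coord (lab e) i)"
        by (rule sum.cong) (auto simp: row_def Ynonneg)
      have "(\<Sum>i\<in>I. row d e0 e (Some i) * Y i) \<le> N * row d e0 e None"
        by (rule YA) (use e in \<open>auto simp: A_def\<close>)
      then show ?thesis unfolding sumI 1 2 using N by (auto simp: row_def split: if_splits)
    qed
    then have "\<forall>e\<in>E. (Y \<circ> Inl) (tgt e) - (Y \<circ> Inl) (src e) +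
        (\<Sum>i<d. int ((nat \<circ> Y \<circ> Inr) i) * coord (lab e) i) \<le> (if e = e0 then -1 else 0)" by simp
    then show ?thesis by blast
  qed
qed

section \<open>Closed walks and Euler's theorem\<close>

fun walk :: "'v \<Rightarrow> 'v edge list \<Rightarrow> 'v \<Rightarrow> bool" where
  "walk s [] t \<longleftrightarrow> s = t"
| "walk s (e # es) t \<longleftrightarrow> src e = s \<and> walk (tgt e) es t"

lemma walk_append: "walk s (a @ b) t \<longleftrightarrow> (\<exists>u. walk s a u \<and> walk u b t)"
  by (induction a arbitrary: s) auto

lemma walk_balance:
  "walk s es t \<Longrightarrow> add_mset t (image_mset src (mset es)) = add_mset s (image_mset tgt (mset es))"
  by (induction es arbitrary: s) (auto simp: add_mset_commute)

lemma walk_visit: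
  assumes "walk s es t" "u = s \<or> u \<in> tgt ` set es"
  shows "\<exists>a b. es = a @ b \<and> walk s a u \<and> walk u b t"
  using assms(2)
proof
  assume "u = s"
  then show ?thesis using assms(1) by (intro exI[of _ "[]"] exI[of _ es]) simp
next
  assume "u \<in> tgt ` set es"
  then obtain e a b where "es = a @ e # b" "tgt e = u" by (auto dest: split_list)
  then show ?thesis using assms(1)
    by (intro exI[of _ "a @ [e]"] exI[of _ b]) (auto simp: walk_append)
qed

lemma ex_max_length:
  assumes "P xs" "\<And>xs. P xs \<Longrightarrow> length xs \<le> n"
  shows "\<exists>xs. P xs \<and> (\<forall>ys. P ys \<longrightarrow> length ys \<le> length xs)"
  using ex_has_greatest_nat[of P xs length "Suc n"] assms by (auto simp: le_imp_less_Suc)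

lemma balanced_closed_trail:
  assumes M: "balanced M" and u: "u \<in># image_mset src M"
  shows "\<exists>es. es \<noteq> [] \<and> walk u es u \<and> mset es \<subseteq># M"
proof -
  define P where "P es \<longleftrightarrow> (es \<noteq> [] \<and> (\<exists>t. walk u es t) \<and> mset es \<subseteq># M)" for es
  obtain e where e: "e \<in># M" "src e = u" using u by auto
  have "P [e]" unfolding P_def using e by auto
  moreover have "length es \<le> size M" if "P es" for es
    using that size_mset_mono unfolding P_def by fastforce
  ultimately obtain es where es: "P es" and max: "\<And>ys. P ys \<Longrightarrow> length ys \<le> length es"
    using ex_max_length[of P] by blast
  obtain t where t: "walk u es t" using es unfolding P_def by blast
  have "t = u"
  proof (rule ccontr)
    assume "t \<noteq> u"
    obtain M' where M': "M = mset es + M'" using es unfolding P_def by (auto simp: mset_subset_eq_exists_conv)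
    have "count (image_mset src M) t = count (image_mset tgt M) t" using M unfolding balanced_def by simp
    moreover have "Suc (count (image_mset src (mset es)) t) = count (image_mset tgt (mset es)) t"
      using walk_balance[OF t] \<open>t \<noteq> u\<close> by (metis count_add_mset)
    ultimately have "count (image_mset src M') t > 0"
      unfolding M' image_mset_union count_union by linarith
    then have "t \<in># image_mset src M'" by (rule count_greater_zero_iff[THEN iffD1])
    then obtain e where e: "e \<in># M'" "src e = t" by auto
    then have "P (es @ [e])" using t es unfolding P_def M' by (auto simp: walk_append)
    then show False using max by fastforce
  qed
  then show ?thesis using t es unfolding P_def by blast
qed

text \<open>A longest closed trail through \<open>v\<close> uses everything: what is left is again
  balanced and, unless empty, touches the trail, so another closed trail could be spliced in.
  Connectivity is phrased through sets \<open>C\<close> that no edge enters or leaves, since these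
  are the sets that \<open>step_ok\<close> tests.\<close>

lemma eulerian_circuit:
  assumes M: "balanced M"
    and conn: "\<And>C. v \<in> C \<Longrightarrow> (\<And>e. e \<in># M \<Longrightarrow> src e \<in> C \<longleftrightarrow> tgt e \<in> C) \<Longrightarrow> \<forall>e\<in>#M. src e \<in> C"
  shows "\<exists>es. walk v es v \<and> mset es = M"
proof -
  define P where "P es \<longleftrightarrow> (walk v es v \<and> mset es \<subseteq># M)" for es
  have "P []" unfolding P_def by simp
  moreover have "length es \<le> size M" if "P es" for es
    using that size_mset_mono unfolding P_def by fastforce
  ultimately obtain es where es: "P es" and max: "\<And>ys. P ys \<Longrightarrow> length ys \<le> length es"
    using ex_max_length[of P] by blast
  have walk: "walk v es v" using es unfolding P_def by simp
  obtain M' where M': "M = mset es + M'" using es unfolding P_def by (auto simp: mset_subset_eq_exists_conv)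
  have bal_es: "image_mset src (mset es) = image_mset tgt (mset es)" using walk_balance[OF walk] by simp
  then have bal': "balanced M'" using M unfolding balanced_def M' by simp
  have "M' = {#}"
  proof (rule ccontr)
    assume "M' \<noteq> {#}"
    define C where "C = insert v (tgt ` set es)"
    have "src ` set es = tgt ` set es" using arg_cong[OF bal_es, of set_mset] by simp
    then have esC: "src e \<in> C \<and> tgt e \<in> C" if "e \<in> set es" for e using that unfolding C_def by blast
    have "\<exists>e. e \<in># M' \<and> src e \<in> C"
    proof (rule ccontr)
      assume no: "\<nexists>e. e \<in># M' \<and> src e \<in> C"
      have "src ` set_mset M' = tgt ` set_mset M'"
        using arg_cong[OF bal'[unfolded balanced_def], of set_mset] by simp
      then have "src e \<notin> C \<and> tgt e \<notin> C" if "e \<in># M'" for e using that no by (metis imageE imageI)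
      note out = this
      have "\<forall>e\<in>#M. src e \<in> C"
      proof (rule conn)
        show "v \<in> C" unfolding C_def by simp
        fix e assume "e \<in># M"
        then have "e \<in> set es \<or> e \<in># M'" unfolding M' by simp
        then show "src e \<in> C \<longleftrightarrow> tgt e \<in> C" using esC[of e] out[of e] by blast
      qed
      moreover obtain e where "e \<in># M'" using \<open>M' \<noteq> {#}\<close> by blast
      moreover from this have "e \<in># M" unfolding M' by simp
      ultimately show False using no by blast
    qed
    then obtain e where "e \<in># M'" "src e \<in> C" by blast
    then obtain u where u: "u \<in> C" "u \<in># image_mset src M'"
      by (metis image_eqI set_image_mset)
    then obtain es' where es': "es' \<noteq> []" "walk u es' u" "mset es' \<subseteq># M'"
      using balanced_closed_trail[OF bal'] by blast
    obtain a b where ab: "es = a @ b" "walk v a u" "walk u b v"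
      using walk_visit[OF walk] u(1) unfolding C_def by blast
    have "P (a @ es' @ b)"
      unfolding P_def using ab es' by (auto simp: walk_append M' union_commute)
    then show False using max ab(1) es'(1) by fastforce
  qed
  then show ?thesis using walk M' by auto
qed

section \<open>Refuting non-negative closed walks\<close>

text \<open>Weights of the counters, a table of vertex potentials and a set of vertices, all as
  lists so that a step can be coded as a number.\<close>

type_synonym 'v rank_step = "nat list \<times> ('v \<times> int) list \<times> 'v list"

text \<open>Table lookup written as a sum: vertices missing from the table get potential 0.\<close>

definition pot :: "('v \<times> int) list \<Rightarrow> 'v \<Rightarrow> int" where
  "pot p v = (\<Sum>a\<leftarrow>filter (\<lambda>a. fst a = v) p. snd a)"

definition drift :: "nat \<Rightarrow> nat list \<Rightarrow> ('v \<times> int) list \<Rightarrow> 'v edge \<Rightarrow> int" where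
  "drift d l p e = pot p (tgt e) - pot p (src e) + (\<Sum>i<d. int (nth_default 0 l i) * coord (lab e) i)"

text \<open>The vertex set is a union of weakly connected components and contains the one of
  \<open>v\<close>. A closed walk through \<open>v\<close> cannot leave it, so the ranking function
  has to be controlled only there; edges outside it, or with a strict drop, are the ones that
  \<open>step_edges\<close> discards.\<close>

definition step_ok :: "nat \<Rightarrow> 'v \<Rightarrow> 'v edge list \<Rightarrow> 'v rank_step \<Rightarrow> bool" where
  "step_ok d v E s \<longleftrightarrow> v \<in> set (snd (snd s)) \<and>
    (\<forall>e\<in>set E. (src e \<in> set (snd (snd s)) \<longleftrightarrow> tgt e \<in> set (snd (snd s))) \<and>
       (src e \<in> set (snd (snd s)) \<longrightarrow> drift d (fst s) (fst (snd s)) e \<le> 0))"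

definition step_edges :: "nat \<Rightarrow> 'v edge list \<Rightarrow> 'v rank_step \<Rightarrow> 'v edge list" where
  "step_edges d E s =
     filter (\<lambda>e. src e \<in> set (snd (snd s)) \<and> drift d (fst s) (fst (snd s)) e = 0) E"

text \<open>\<open>blocked d v E ss\<close>: the steps \<open>ss\<close> successively discard edges that no closed walk through \<open>v\<close>
  with non-negative effect can use, until none leaves \<open>v\<close>.\<close>

fun blocked :: "nat \<Rightarrow> 'v \<Rightarrow> 'v edge list \<Rightarrow> 'v rank_step list \<Rightarrow> bool" where
  "blocked d v E [] \<longleftrightarrow> (\<forall>e\<in>set E. src e \<noteq> v)"
| "blocked d v E (s # ss) \<longleftrightarrow> step_ok d v E s \<and> blocked d v (step_edges d E s) ss"

lemma walk_stays:
  assumes "walk s es t" "s \<in> C" "\<And>e. e \<in> set es \<Longrightarrow> src e \<in> C \<Longrightarrow> tgt e \<in> C"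
  shows "\<forall>e\<in>set es. src e \<in> C"
  using assms by (induction es arbitrary: s) auto

lemma walk_drift:
  "walk s es t \<Longrightarrow> (\<Sum>e\<leftarrow>es. drift d l p e) =
    pot p t - pot p s + (\<Sum>i<d. int (nth_default 0 l i) * effect es i)"
  by (induction es arbitrary: s) (auto simp: drift_def sum.distrib algebra_simps)

lemma sum_list_nonpos_zero:
  fixes f :: "'a \<Rightarrow> int"
  assumes "\<And>x. x \<in> set xs \<Longrightarrow> f x \<le> 0" "0 \<le> (\<Sum>x\<leftarrow>xs. f x)"
  shows "\<forall>x\<in>set xs. f x = 0"
  using assms
proof (induction xs)
  case (Cons a xs)
  have "(\<Sum>x\<leftarrow>xs. f x) \<le> 0" using Cons.prems(1) by (intro sum_list_nonpos) auto
  moreover have "f a \<le> 0" using Cons.prems(1) by simp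
  moreover have "0 \<le> f a + (\<Sum>x\<leftarrow>xs. f x)" using Cons.prems(2) by simp
  ultimately have "f a = 0" "0 \<le> (\<Sum>x\<leftarrow>xs. f x)" by linarith+
  moreover have "\<forall>x\<in>set xs. f x = 0"
    by (rule Cons.IH) (use Cons.prems(1) calculation in auto)
  ultimately show ?case by simp
qed simp

text \<open>On a closed walk the potentials telescope, so the total drift is the weighted effect,
  which is non-negative. As no edge of the walk has positive drift, all have drift 0 and survive the
  step.\<close>

lemma blocked_sound:
  assumes "blocked d v E ss" "walk v es v" "set es \<subseteq> set E" "\<forall>i<d. 0 \<le> effect es i"
  shows "es = []"
  using assms(1,3)
proof (induction ss arbitrary: E)
  case Nil
  then show ?case using assms(2) by (cases es) auto
next
  case (Cons s ss)
  let ?C = "set (snd (snd s))" and ?f = "drift d (fst s) (fst (snd s))"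
  have ok: "v \<in> ?C" "\<And>e. e \<in> set es \<Longrightarrow> (src e \<in> ?C \<longleftrightarrow> tgt e \<in> ?C) \<and> (src e \<in> ?C \<longrightarrow> ?f e \<le> 0)"
    using Cons.prems unfolding blocked.simps step_ok_def by auto
  have C: "\<forall>e\<in>set es. src e \<in> ?C" using walk_stays[OF assms(2) ok(1)] ok(2) by blast
  have "0 \<le> (\<Sum>e\<leftarrow>es. ?f e)"
    unfolding walk_drift[OF assms(2)] using assms(4) by (auto intro!: sum_nonneg)
  then have "\<forall>e\<in>set es. ?f e = 0"
    using sum_list_nonpos_zero[of es ?f] ok(2) C by blast
  then have "set es \<subseteq> set (step_edges d E s)"
    using C Cons.prems(2) unfolding step_edges_def by auto
  then show ?case using Cons.IH[of "step_edges d E s"] Cons.prems(1) by simp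
qed

lemma pot_map:
  assumes "distinct vs" "v \<in> set vs"
  shows "pot (map (\<lambda>v. (v, p v)) vs) v = p v"
proof -
  have "filter (\<lambda>u. u = v) vs = [v]" using assms by (induction vs) (auto simp: filter_empty_conv)
  then show ?thesis unfolding pot_def filter_map by (simp add: comp_def)
qed

text \<open>Discard edges as long as some step does. When none does, Farkas puts every edge on a
  circulation of non-negative effect. The sum of these circulations uses every edge and is
  connected, since no proper component can be split off; hence it has an Euler circuit at
  \<open>v\<close>. By assumption that circuit is empty, so no edge is left.\<close>

lemma blocked_complete:
  fixes E :: "'v edge list"
  assumes "\<And>es. walk v es v \<Longrightarrow> set es \<subseteq> set E \<Longrightarrow> \<forall>i<d. 0 \<le> effect es i \<Longrightarrow> es = []"
  shows "\<exists>ss. blocked d v E ss"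
  using assms
proof (induction "length E" arbitrary: E rule: less_induct)
  case less
  show ?case
  proof (rule ccontr)
    assume no: "\<nexists>ss. blocked d v E ss"
    have tight: "\<forall>e\<in>set E. src e \<in> set (snd (snd s)) \<and> drift d (fst s) (fst (snd s)) e = 0"
      if ok: "step_ok d v E s" for s
    proof (rule ccontr)
      assume "\<not> ?thesis"
      then have "length (step_edges d E s) < length E"
        unfolding step_edges_def by (auto intro: length_filter_less)
      moreover have "set (step_edges d E s) \<subseteq> set E" unfolding step_edges_def by auto
      ultimately obtain ss where "blocked d v (step_edges d E s) ss"
        using less.hyps[of "step_edges d E s"] less.prems by blast
      then have "blocked d v E (s # ss)" using ok by simp
      then show False using no by blast
    qed
    define vs where "vs = remdups (v # map src E @ map tgt E)"
    have vs: "distinct vs" "v \<in> set vs" "\<And>e. e \<in> set E \<Longrightarrow> src e \<in> set vs \<and> tgt e \<in> set vs"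
      unfolding vs_def by auto
    have "\<exists>es. set es \<subseteq> set E \<and> e0 \<in> set es \<and> balanced (mset es) \<and> (\<forall>i<d. 0 \<le> effect es i)"
      if e0: "e0 \<in> set E" for e0
    proof (rule ccontr)
      assume "\<not> ?thesis"
      then obtain l :: "nat \<Rightarrow> nat" and p :: "'v \<Rightarrow> int" where lp: "\<And>e. e \<in> set E \<Longrightarrow>
        p (tgt e) - p (src e) + (\<Sum>i<d. int (l i) * coord (lab e) i) \<le> (if e = e0 then -1 else 0)"
        using farkas_circulation[of "set E" e0 d] e0 by blast
      define s where "s = (map l [0..<d], map (\<lambda>v. (v, p v)) vs, vs)"
      have "drift d (fst s) (fst (snd s)) e \<le> (if e = e0 then -1 else 0)" if "e \<in> set E" for e
      proof -
        have "(\<Sum>i<d. int (nth_default 0 (map l [0..<d]) i) * coord (lab e) i) =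
            (\<Sum>i<d. int (l i) * coord (lab e) i)"
          by (rule sum.cong) (auto simp: nth_default_def)
        then show ?thesis using lp[OF that] vs(3)[OF that] pot_map[OF vs(1)]
          unfolding drift_def s_def by simp
      qed
      note dr = this
      then have "step_ok d v E s"
        unfolding step_ok_def using vs by (fastforce simp: s_def split: if_splits)
      then show False using tight[of s] dr[OF e0] e0 by force
    qed
    then obtain f where f: "\<And>e. e \<in> set E \<Longrightarrow>
      set (f e) \<subseteq> set E \<and> e \<in> set (f e) \<and> balanced (mset (f e)) \<and> (\<forall>i<d. 0 \<le> effect (f e) i)"
      by metis
    define L where "L = concat (map f E)"
    have setL: "set L = set E"
    proof
      show "set L \<subseteq> set E" unfolding L_def using f by (simp add: UN_subset_iff)
      show "set E \<subseteq> set L" unfolding L_def using f by (intro subsetI) (simp, blast)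
    qed
    have "balanced (mset (concat (map f xs)))" if "\<forall>e\<in>set xs. balanced (mset (f e))" for xs
      using that by (induction xs) (auto simp: balanced_def)
    then have balL: "balanced (mset L)" unfolding L_def using f by blast
    have "0 \<le> effect (concat (map f xs)) i" if "\<forall>e\<in>set xs. 0 \<le> effect (f e) i" for xs i
      using that by (induction xs) auto
    then have effL: "0 \<le> effect L i" if "i < d" for i
      unfolding L_def using f that by blast
    have "\<exists>es. walk v es v \<and> mset es = mset L"
    proof (rule eulerian_circuit[OF balL])
      fix C assume C: "v \<in> C" "\<And>e. e \<in># mset L \<Longrightarrow> (src e \<in> C) = (tgt e \<in> C)"
      \<comment> \<open>The zero ranking function has no strict drops, so this step can discard
        edges only by leaving them outside \<open>C\<close>.\<close>
      define s :: "'v rank_step" where "s = ([], [], filter (\<lambda>u. u \<in> C) vs)"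
      have "drift d (fst s) (fst (snd s)) e = 0" for e
        by (simp add: drift_def s_def pot_def nth_default_def)
      then have "step_ok d v E s"
        unfolding step_ok_def using C vs setL by (auto simp: s_def)
      then show "\<forall>e\<in>#mset L. src e \<in> C" using tight[of s] setL unfolding s_def by auto
    qed
    then obtain es where es: "walk v es v" "mset es = mset L" by blast
    have "effect es i = effect L i" for i
    proof -
      have "mset (map (\<lambda>e. coord (lab e) i) es) = mset (map (\<lambda>e. coord (lab e) i) L)"
        using es(2) by simp
      then show ?thesis unfolding effect_def by (metis sum_mset_sum_list)
    qed
    moreover have "set es = set E" using es(2) setL by (metis set_mset_mset)
    ultimately have "es = []" using less.prems[OF es(1)] effL by simp
    then have "E = []" using \<open>set es = set E\<close> by simp
    then have "blocked d v E []" by simp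
    then show False using no by blast
  qed
qed

section \<open>Dickson's lemma\<close>

text \<open>A monotone subsequence exists; if it decreases, it is constant from the position of its
  minimum on.\<close>

lemma nat_mono_subseq:
  fixes s :: "nat \<Rightarrow> nat"
  shows "\<exists>r::nat \<Rightarrow> nat. strict_mono r \<and> (\<forall>i j. i \<le> j \<longrightarrow> s (r i) \<le> s (r j))"
proof -
  obtain f where f: "strict_mono (f :: nat \<Rightarrow> nat)" "monoseq (\<lambda>n. s (f n))"
    using seq_monosub[of s] by blast
  show ?thesis
  proof (cases "\<forall>m. \<forall>n\<ge>m. s (f m) \<le> s (f n)")
    case True
    then show ?thesis using f(1) by auto
  next
    case False
    then have dec: "\<And>m n. m \<le> n \<Longrightarrow> s (f n) \<le> s (f m)" using f(2) unfolding monoseq_def by blast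
    obtain N where N: "\<And>n. s (f N) \<le> s (f n)"
      using ex_has_least_nat[of "\<lambda>_. True" 0 "\<lambda>n. s (f n)"] by auto
    have "strict_mono (\<lambda>n. f (n + N))" using f(1) by (auto simp: strict_mono_def)
    moreover have "s (f (i + N)) \<le> s (f (j + N))" for i j
      using dec[of N "i + N"] N[of "j + N"] by simp
    ultimately show ?thesis by blast
  qed
qed

lemma dickson_subseq:
  fixes f :: "nat \<Rightarrow> 'v \<times> (nat \<Rightarrow> nat)"
  assumes "finite J" "finite (range (\<lambda>n. fst (f n)))"
  shows "\<exists>r. strict_mono (r :: nat \<Rightarrow> nat) \<and>
    (\<forall>i j. i \<le> j \<longrightarrow> fst (f (r i)) = fst (f (r j)) \<and> (\<forall>k\<in>J. snd (f (r i)) k \<le> snd (f (r j)) k))"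
  using assms(1)
proof induction
  case empty
  obtain n0 where inf: "infinite {n \<in> UNIV. fst (f n) = fst (f n0)}"
    using pigeonhole_infinite[OF infinite_UNIV_nat assms(2)] by auto
  then obtain r :: "nat \<Rightarrow> nat" where "strict_mono r" "\<And>n. fst (f (r n)) = fst (f n0)"
    using infinite_enumerate[OF inf] by auto
  then show ?case by (intro exI[of _ r]) simp
next
  case (insert k J)
  then obtain r where r: "strict_mono (r :: nat \<Rightarrow> nat)"
    "\<And>i j. i \<le> j \<Longrightarrow> fst (f (r i)) = fst (f (r j)) \<and> (\<forall>k\<in>J. snd (f (r i)) k \<le> snd (f (r j)) k)"
    by blast
  obtain g where g: "strict_mono (g :: nat \<Rightarrow> nat)" "\<And>i j. i \<le> j \<Longrightarrow> snd (f (r (g i))) k \<le> snd (f (r (g j))) k"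
    using nat_mono_subseq[of "\<lambda>n. snd (f (r n)) k"] by blast
  have "strict_mono (\<lambda>n. r (g n))" using r(1) g(1) by (auto simp: strict_mono_def)
  moreover have "g i \<le> g j" if "i \<le> j" for i j
    using that g(1) by (simp add: strict_mono_less_eq)
  ultimately show ?case using r(2) g(2) by (intro exI[of _ "\<lambda>n. r (g n)"]) auto
qed

lemma dickson:
  fixes f :: "nat \<Rightarrow> 'v \<times> (nat \<Rightarrow> nat)"
  assumes "finite J" "finite (range (\<lambda>n. fst (f n)))"
  shows "\<exists>i j. i < j \<and> fst (f i) = fst (f j) \<and> (\<forall>k\<in>J. snd (f i) k \<le> snd (f j) k)"
proof -
  obtain r where r: "strict_mono (r :: nat \<Rightarrow> nat)"
    "\<And>i j. i \<le> j \<Longrightarrow> fst (f (r i)) = fst (f (r j)) \<and> (\<forall>k\<in>J. snd (f (r i)) k \<le> snd (f (r j)) k)"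
    using dickson_subseq[OF assms] by blast
  have "r 0 < r 1" using r(1) by (simp add: strict_mono_def)
  then show ?thesis using r(2)[of 0 1] by (intro exI[of _ "r 0"] exI[of _ "r 1"]) simp
qed

text \<open>Otherwise every finite part of \<open>A\<close> leaves some element of \<open>A\<close>
  undominated, and picking such elements in turn yields a sequence without the pair promised by
  \<open>dickson\<close>. Comparing only the coordinates in \<open>J\<close> is what
  \<open>uniform_bound\<close> relies on.\<close>

lemma finite_basis:
  fixes A :: "('v \<times> (nat \<Rightarrow> nat)) set"
  assumes "finite J" "finite (fst ` A)"
  shows "\<exists>U\<subseteq>A. finite U \<and> (\<forall>(q, x)\<in>A. \<exists>x0. (q, x0) \<in> U \<and> (\<forall>k\<in>J. x0 k \<le> x k))"
proof (rule ccontr)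
  assume no: "\<not> ?thesis"
  have no': "\<exists>c\<in>A. \<forall>c0\<in>U. \<not> (fst c0 = fst c \<and> (\<forall>k\<in>J. snd c0 k \<le> snd c k))"
    if "U \<subseteq> A" "finite U" for U
  proof (rule ccontr)
    assume *: "\<not> ?thesis"
    have "\<exists>x0. (q, x0) \<in> U \<and> (\<forall>k\<in>J. x0 k \<le> x k)" if qx: "(q, x) \<in> A" for q x
    proof -
      have "\<exists>c0\<in>U. fst c0 = fst (q, x) \<and> (\<forall>k\<in>J. snd c0 k \<le> snd (q, x) k)" using * qx by blast
      then obtain c0 where "c0 \<in> U" "fst c0 = q" "\<forall>k\<in>J. snd c0 k \<le> x k" by auto
      then show ?thesis by (intro exI[of _ "snd c0"]) auto
    qed
    then show False using no that by blast
  qed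
  define P where "P f i r \<longleftrightarrow> r \<in> A \<and>
    (\<forall>j<i. \<not> (fst (f j) = fst r \<and> (\<forall>k\<in>J. snd (f j) k \<le> snd r k)))"
    for f :: "nat \<Rightarrow> 'v \<times> (nat \<Rightarrow> nat)" and i r
  have "\<exists>f. \<forall>i. P f i (f i)"
  proof (rule dependent_wellorder_choice)
    show "P f i r = P g i r" if "\<And>j. j < i \<Longrightarrow> f j = g j" for r f g i
      using that unfolding P_def by simp
    show "\<exists>r. P f i r" if "\<And>j. j < i \<Longrightarrow> P f j (f j)" for i f
    proof -
      have "f ` {..<i} \<subseteq> A" "finite (f ` {..<i})" using that unfolding P_def by auto
      from no'[OF this] obtain c where "c \<in> A"
        "\<forall>c0\<in>f ` {..<i}. \<not> (fst c0 = fst c \<and> (\<forall>k\<in>J. snd c0 k \<le> snd c k))" ..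
      then have "P f i c" unfolding P_def by simp
      then show ?thesis by blast
    qed
  qed
  then obtain f where f: "\<And>i. P f i (f i)" by blast
  then have "range (\<lambda>n. fst (f n)) \<subseteq> fst ` A" unfolding P_def by auto
  then have "finite (range (\<lambda>n. fst (f n)))" using assms(2) finite_subset by blast
  from dickson[OF assms(1) this] show False using f unfolding P_def by blast
qed

section \<open>A uniform bound for counters from Dickson's lemma\<close>

lemma win_src: "(q, x) \<in> win d P F E \<Longrightarrow> q \<in> src ` E"
proof -
  assume "(q, x) \<in> win d P F E"
  then obtain n where n: "(q, x) \<in> attn (pre d P E) (F \<times> UNIV) n (win d P F E)"
    using win_unfold unfolding att_def by blast
  have "(q, x) \<in> pre d P E (win d P F E)"
    using n attn_buchi_pre[OF mono_pre] unfolding win_def by blast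
  then show ?thesis by (cases "q \<in> P") (force simp: pre_P pre_1)+
qed

text \<open>For each \<open>J\<close>, take a finite basis of the winning set with respect to the
  coordinates in \<open>J\<close>, and let \<open>B\<close> be at least every value in all these
  bases. A basis element below \<open>x\<close> on \<open>J\<close> is then below \<open>B\<close>
  elsewhere. The lower limit \<open>N\<close> lets the caller place \<open>B\<close> above a given
  vector.\<close>

lemma uniform_bound:
  assumes "finite E"
  shows "\<exists>B\<ge>N. \<forall>q x J. (q, x) \<in> win d P F E \<and> J \<subseteq> {..<d} \<longrightarrow> (q, \<lambda>i. if i \<in> J then x i else B) \<in> win d P F E"
proof -
  let ?W = "win d P F E"
  have "fst ` ?W \<subseteq> src ` E" using win_src by fastforce
  then have fin: "finite (fst ` ?W)" using assms finite_subset by blast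
  have "\<exists>U\<subseteq>?W. finite U \<and> (\<forall>(q, x)\<in>?W. \<exists>x0. (q, x0) \<in> U \<and> (\<forall>k\<in>J. x0 k \<le> x k))"
    if "J \<subseteq> {..<d}" for J
    by (rule finite_basis[OF _ fin]) (use that finite_subset in blast)
  then have "\<forall>J\<in>Pow {..<d}. \<exists>U\<subseteq>?W. finite U \<and>
      (\<forall>(q, x)\<in>?W. \<exists>x0. (q, x0) \<in> U \<and> (\<forall>k\<in>J. x0 k \<le> x k))" by blast
  from bchoice[OF this] obtain U where "\<forall>J\<in>Pow {..<d}. U J \<subseteq> ?W \<and> finite (U J) \<and>
      (\<forall>(q, x)\<in>?W. \<exists>x0. (q, x0) \<in> U J \<and> (\<forall>k\<in>J. x0 k \<le> x k))" ..
  then have U: "U J \<subseteq> ?W \<and> finite (U J) \<and> (\<forall>(q, x)\<in>?W. \<exists>x0. (q, x0) \<in> U J \<and> (\<forall>k\<in>J. x0 k \<le> x k))"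
    if "J \<subseteq> {..<d}" for J using that by simp
  define UU where "UU = (\<Union>J\<in>Pow {..<d}. U J)"
  have finU: "finite UU" unfolding UU_def using U by auto
  define B where "B = N + (\<Sum>c\<in>UU. \<Sum>i<d. snd c i)"
  have B: "snd c i \<le> B" if "c \<in> UU" "i < d" for c i
  proof -
    have "snd c i \<le> (\<Sum>i<d. snd c i)" using that(2) by (intro member_le_sum) auto
    also have "\<dots> \<le> (\<Sum>c\<in>UU. \<Sum>i<d. snd c i)" using that(1) finU by (intro member_le_sum) auto
    finally show ?thesis unfolding B_def by simp
  qed
  have "(q, \<lambda>i. if i \<in> J then x i else B) \<in> ?W" if w: "(q, x) \<in> ?W" and J: "J \<subseteq> {..<d}" for q x J
  proof -
    obtain x0 where x0: "(q, x0) \<in> U J" "\<forall>k\<in>J. x0 k \<le> x k" using U[OF J] w by blast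
    then have "(q, x0) \<in> UU" and "(q, x0) \<in> ?W" using U[OF J] J unfolding UU_def by blast+
    have "\<forall>i<d. x0 i \<le> (if i \<in> J then x i else B)"
      using x0(2) B[OF \<open>(q, x0) \<in> UU\<close>] by simp
    with \<open>(q, x0) \<in> ?W\<close> assms show ?thesis by (rule win_up)
  qed
  moreover have "N \<le> B" unfolding B_def by simp
  ultimately show ?thesis by blast
qed

section \<open>Saturated counters in the control state\<close>

text \<open>Counters are also tracked in the control state up to \<open>B\<close>, where \<open>B\<close> stands for an arbitrarily
  large value and is never left.\<close>

abbreviation entry :: "nat list \<Rightarrow> nat \<Rightarrow> nat" where "entry \<equiv> nth_default 0"

definition sat :: "nat \<Rightarrow> nat \<Rightarrow> int \<Rightarrow> nat" where
  "sat B a z = (if a = B then B else if int B \<le> int a + z then B else nat (int a + z))"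

definition sat_vec :: "nat \<Rightarrow> nat \<Rightarrow> nat list \<Rightarrow> int list \<Rightarrow> nat list" where
  "sat_vec d B u z = map (\<lambda>i. sat B (entry u i) (coord z i)) [0..<d]"

definition ok_vec :: "nat \<Rightarrow> nat \<Rightarrow> nat list \<Rightarrow> int list \<Rightarrow> bool" where
  "ok_vec d B u z \<longleftrightarrow> (\<forall>i<d. entry u i = B \<or> 0 \<le> int (entry u i) + coord z i)"

definition box :: "nat \<Rightarrow> nat \<Rightarrow> nat list set" where
  "box d B = {u. length u = d \<and> (\<forall>i<d. entry u i \<le> B)}"

text \<open>The labels remain, so the game still has counters. Small counters are policed by the
  control state, which makes their initial credit immaterial; this reduces a given initial vector to
  unknown initial credit.\<close>

definition saturated :: "nat \<Rightarrow> nat \<Rightarrow> 'v edge set \<Rightarrow> ('v \<times> nat list) edge set" where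
  "saturated d B E = {((q, u), z, (q', sat_vec d B u z)) | q u z q'.
     (q, z, q') \<in> E \<and> u \<in> box d B \<and> ok_vec d B u z}"

lemma saturated_iff: "((q, u), z, t) \<in> saturated d B E \<longleftrightarrow>
    (\<exists>q'. t = (q', sat_vec d B u z) \<and> (q, z, q') \<in> E \<and> u \<in> box d B \<and> ok_vec d B u z)"
  unfolding saturated_def by auto

lemma entry_sat_vec: "i < d \<Longrightarrow> entry (sat_vec d B u z) i = sat B (entry u i) (coord z i)"
  by (simp add: sat_vec_def nth_default_def)

lemma sat_vec_box: "sat_vec d B u z \<in> box d B"
  by (auto simp: box_def entry_sat_vec sat_def) (simp add: sat_vec_def)

lemma finite_box: "finite (box d B)"
proof -
  have "box d B \<subseteq> {xs. set xs \<subseteq> {..B} \<and> length xs = d}"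
    unfolding box_def by (auto simp: in_set_conv_nth nth_default_def)
  then show ?thesis using finite_lists_length_eq[of "{..B}" d] finite_subset by blast
qed

lemma finite_saturated:
  assumes "finite E"
  shows "finite (saturated d B E)"
proof -
  have "saturated d B E \<subseteq> (\<lambda>((q, z, q'), u). ((q, u), z, (q', sat_vec d B u z))) ` (E \<times> box d B)"
    unfolding saturated_def by force
  then show ?thesis using assms finite_box[of d B] finite_subset by blast
qed

definition static :: "nat \<Rightarrow> 'v set \<Rightarrow> 'v edge set \<Rightarrow> bool" where
  "static d P E \<longleftrightarrow> (\<forall>e\<in>E. src e \<in> P \<longrightarrow> (\<forall>i<d. coord (lab e) i = 0))"

text \<open>Opponent edges are never blocked by \<open>ok_vec\<close>, so saturation takes no choice
  away from the opponent. This is one of the places where it matters that only Player 1 changes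
  counters.\<close>

lemma static_ok_vec: "static d P E \<Longrightarrow> (q, z, q') \<in> E \<Longrightarrow> q \<in> P \<Longrightarrow> ok_vec d B u z"
  unfolding static_def ok_vec_def by force

lemma win_saturated:
  assumes fin: "finite E" and st: "static d P E" and w: "(q, x) \<in> win d P F E"
    and u: "u \<in> box d B" "\<forall>i<d. entry u i = B \<or> entry u i = x i"
  shows "((q, u), x) \<in> win d (P \<times> UNIV) (F \<times> UNIV) (saturated d B E)"
proof -
  \<comment> \<open>The simulating play never lowers a counter spontaneously: otherwise the values
    tracked in the control state would no longer match. Its counters therefore dominate those of the
    simulated play.\<close>
  define R where "R a b \<longleftrightarrow> fst a = fst (fst b) \<and> snd (fst b) \<in> box d B \<and>
    (\<forall>i<d. snd a i \<le> snd b i \<and> (entry (snd (fst b)) i = B \<or> entry (snd (fst b)) i = snd b i))"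
    for a :: "'a \<times> (nat \<Rightarrow> nat)" and b :: "('a \<times> nat list) \<times> (nat \<Rightarrow> nat)"
  have edge: "ok_vec d B u z \<and> (\<exists>x1'. fires d x' z x1' \<and> R (t, x1) ((t, sat_vec d B u z), x1'))"
    if R: "R (s, x) ((s, u), x')" and f: "fires d x z x1" for s u x x' z t x1
  proof (intro conjI exI)
    have *: "0 \<le> int (x' i) + coord z i" "x1 i \<le> nat (int (x' i) + coord z i)"
      "entry u i = B \<or> entry u i = x' i" if "i < d" for i
      using R f that unfolding R_def fires_def by fastforce+
    show "ok_vec d B u z" unfolding ok_vec_def using * by metis
    show "fires d x' z (\<lambda>i. nat (int (x' i) + coord z i))" unfolding fires_def using * by simp
    have "sat B (entry u i) (coord z i) = B \<or> sat B (entry u i) (coord z i) = nat (int (x' i) + coord z i)"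
      if "i < d" for i using *(3)[OF that] unfolding sat_def by auto
    then show "R (t, x1) ((t, sat_vec d B u z), \<lambda>i. nat (int (x' i) + coord z i))"
      unfolding R_def using * by (auto simp: sat_vec_box entry_sat_vec)
  qed
  show ?thesis
  proof (rule win_sim[where R = R, OF _ _ finite_saturated[OF fin] _ w])
    show "R (q, x) ((q, u), x)" unfolding R_def using u by simp
    show "R (s, x) (s', x') \<Longrightarrow> s \<in> F \<Longrightarrow> s' \<in> F \<times> UNIV" for s x s' x'
      unfolding R_def by (simp add: mem_Times_iff)
    fix s x s' x' X
    assume R: "R (s, x) (s', x')" and pre: "(s, x) \<in> pre d P E X"
    obtain u where s': "s' = (s, u)" and box: "u \<in> box d B" using R unfolding R_def by (cases s') auto
    show "(s', x') \<in> pre d (P \<times> UNIV) (saturated d B E) {b. \<exists>a\<in>X. R a b}"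
    proof (cases "s \<in> P")
      case True
      then have P: "s' \<in> P \<times> UNIV" unfolding s' by simp
      have ok: "(s, z, t) \<in> E \<Longrightarrow> ok_vec d B u z" for z t
        using static_ok_vec[OF st _ True] .
      show ?thesis using pre edge[OF R[unfolded s']] box ok
        unfolding pre_P[OF True] pre_P[OF P] unfolding s' saturated_iff by fastforce
    next
      case False
      then have P: "s' \<notin> P \<times> UNIV" unfolding s' by simp
      obtain z t x1 where 1: "(s, z, t) \<in> E" "fires d x z x1" "(t, x1) \<in> X"
        using pre unfolding pre_1[OF False] by blast
      obtain x1' where 2: "ok_vec d B u z" "fires d x' z x1'" "R (t, x1) ((t, sat_vec d B u z), x1')"
        using edge[OF R[unfolded s'] 1(2)] by blast
      then show ?thesis using 1 box unfolding pre_1[OF P] unfolding s' saturated_iff by fast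
    qed
  qed
qed

text \<open>As long as the set \<open>J\<close> of unsaturated counters stays the same, the play is
  simulated with the tracked values on \<open>J\<close> and a surplus of \<open>B\<close> elsewhere.
  When a further counter reaches \<open>B\<close>, the surplus keeps all saturated counters at
  \<open>B\<close> or above, and the induction hypothesis, for fewer unsaturated counters, declares
  the successor winning.\<close>

lemma saturated_win:
  assumes fin: "finite E" and st: "static d P E"
    and B: "\<And>q x J. (q, x) \<in> win d P F E \<Longrightarrow> J \<subseteq> {..<d} \<Longrightarrow> (q, \<lambda>i. if i \<in> J then x i else B) \<in> win d P F E"
    and w: "((q, u), x) \<in> win d (P \<times> UNIV) (F \<times> UNIV) (saturated d B E)"
  shows "(q, entry u) \<in> win d P F E"
  using w
proof (induction "card {k. k < d \<and> entry u k < B}" arbitrary: q u x rule: less_induct)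
  case less
  let ?W = "win d P F E" and ?G = "win d (P \<times> UNIV) (F \<times> UNIV) (saturated d B E)"
  define J where "J = {k. k < d \<and> entry u k < B}"
  define R where "R a b \<longleftrightarrow> fst b = fst (fst a) \<and> snd (fst a) \<in> box d B \<and>
    {k. k < d \<and> entry (snd (fst a)) k < B} = J \<and> (\<forall>k\<in>J. snd b k = entry (snd (fst a)) k) \<and>
    (\<forall>k<d. k \<notin> J \<longrightarrow> snd a k + B \<le> snd b k)"
    for b :: "'a \<times> (nat \<Rightarrow> nat)" and a :: "('a \<times> nat list) \<times> (nat \<Rightarrow> nat)"
  have J: "J \<subseteq> {..<d}" "finite J" unfolding J_def by auto
  have ubox: "u \<in> box d B"
    using win_src[OF less.prems] by (auto simp: saturated_def)
  have IH: "(q', entry u') \<in> ?W"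
    if "card {k. k < d \<and> entry u' k < B} < card J" "((q', u'), x') \<in> ?G" for q' u' x'
    by (rule less.hyps[OF _ that(2)]) (use that(1) in \<open>simp add: J_def\<close>)
  have edge: "\<exists>y1. fires d y z y1 \<and> (R ((t, sat_vec d B u z), x1) (t, y1) \<or> (t, y1) \<in> ?W)"
    if Rab: "R ((s, u), x) (s, y)" and f: "fires d x z x1" and ok: "ok_vec d B u z"
      and G: "((t, sat_vec d B u z), x1) \<in> ?G" for s u x y z t x1
  proof -
    define y1 where "y1 = (\<lambda>i. nat (int (y i) + coord z i))"
    define u1 where "u1 = sat_vec d B u z"
    have uJ: "entry u k < B \<longleftrightarrow> k \<in> J" "entry u k \<le> B" if "k < d" for k
      using Rab that unfolding R_def box_def by auto
    have inJ: "y k = entry u k" "0 \<le> int (y k) + coord z k" if "k \<in> J" for k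
    proof -
      show "y k = entry u k" using Rab that unfolding R_def by simp
      moreover have "k < d" using that J(1) by blast
      ultimately show "0 \<le> int (y k) + coord z k" using ok uJ(1)[of k] that unfolding ok_vec_def by auto
    qed
    have notJ: "0 \<le> int (y k) + coord z k" "x1 k + B \<le> y1 k" "entry u k = B" if "k < d" "k \<notin> J" for k
    proof -
      have "x k + B \<le> y k" "int (x1 k) \<le> int (x k) + coord z k"
        using Rab f that unfolding R_def fires_def by auto
      then show "0 \<le> int (y k) + coord z k" "x1 k + B \<le> y1 k" unfolding y1_def by linarith+
      show "entry u k = B" using uJ[OF that(1)] that(2) by simp
    qed
    have fy: "fires d y z y1" unfolding fires_def y1_def using inJ notJ by (metis int_nat_eq order_refl)
    have u1: "entry u1 k = sat B (entry u k) (coord z k)" if "k < d" for k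
      unfolding u1_def by (rule entry_sat_vec[OF that])
    have le: "entry u1 k \<le> y1 k" if "k < d" for k
    proof (cases "k \<in> J")
      case True
      then show ?thesis unfolding u1[OF that] sat_def y1_def using inJ[OF True] uJ[OF that] by auto
    next
      case False
      then show ?thesis unfolding u1[OF that] sat_def using notJ[OF that False] by simp
    qed
    have sub: "{k. k < d \<and> entry u1 k < B} \<subseteq> J"
    proof
      fix k assume k: "k \<in> {k. k < d \<and> entry u1 k < B}"
      then have "entry u k \<noteq> B" using u1[of k] by (auto simp: sat_def)
      then show "k \<in> J" using uJ[of k] k by auto
    qed
    show ?thesis
    proof (cases "{k. k < d \<and> entry u1 k < B} = J")
      case True
      have "y1 k = entry u1 k" if "k \<in> J" for k
      proof -
        have "k < d" "entry u1 k < B" using True that by auto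
        then show ?thesis using u1[of k] inJ[OF that] unfolding sat_def y1_def by (auto split: if_splits)
      qed
      then have "R ((t, u1), x1) (t, y1)"
        unfolding R_def using True notJ by (auto simp: u1_def sat_vec_box)
      then show ?thesis using fy unfolding u1_def by blast
    next
      case False
      then have "card {k. k < d \<and> entry u1 k < B} < card J"
        using sub J(2) by (intro psubset_card_mono) auto
      then have "(t, entry u1) \<in> ?W" using G[folded u1_def] by (rule IH)
      then have "(t, y1) \<in> ?W" using fin by (rule win_up) (use le in blast)
      then show ?thesis using fy by blast
    qed
  qed
  have Z: "(q, y) \<in> ?W" if "R ((q, u), x) (q, y)" for y
  proof (rule win_sim_upto[where R = R, OF _ _ fin that less.prems])
    show "R (s, x) (s', x') \<Longrightarrow> s \<in> F \<times> UNIV \<Longrightarrow> s' \<in> F" for s x s' x'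
      unfolding R_def by auto
    fix s x s' y X
    assume Rab: "R (s, x) (s', y)" and X: "X \<subseteq> ?G"
      and pre: "(s, x) \<in> pre d (P \<times> UNIV) (saturated d B E) X"
    obtain u where s: "s = (s', u)" and box: "u \<in> box d B" using Rab unfolding R_def by (cases s) auto
    let ?Y = "{b. \<exists>a\<in>X. R a b} \<union> ?W"
    have edge': "\<exists>y1. fires d y z y1 \<and> (t, y1) \<in> ?Y"
      if "fires d x z x1" "ok_vec d B u z" "((t, sat_vec d B u z), x1) \<in> X" for z t x1
      using edge[OF Rab[unfolded s] that(1,2)] that(3) X by blast
    show "(s', y) \<in> pre d P E ?Y"
    proof (cases "s' \<in> P")
      case True
      then have P: "s \<in> P \<times> UNIV" unfolding s by simp
      note pre' = pre[unfolded pre_P[OF P], unfolded s saturated_iff]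
      have "\<exists>y1. fires d y z y1 \<and> (t, y1) \<in> ?Y" if "(s', z, t) \<in> E" for z t
      proof -
        have ok: "ok_vec d B u z" by (rule static_ok_vec[OF st that True])
        then have "((s', u), z, (t, sat_vec d B u z)) \<in> saturated d B E"
          unfolding saturated_iff using that box by blast
        then obtain x1 where "fires d x z x1" "((t, sat_vec d B u z), x1) \<in> X"
          using pre[unfolded pre_P[OF P], unfolded s] by blast
        then show ?thesis using edge' ok by blast
      qed
      then show ?thesis unfolding pre_P[OF True] using pre' by blast
    next
      case False
      then have P: "s \<notin> P \<times> UNIV" unfolding s by simp
      note pre' = pre[unfolded pre_1[OF P], unfolded s saturated_iff]
      then obtain z t x1 where "(s', z, t) \<in> E" "fires d x z x1" "ok_vec d B u z"
        "((t, sat_vec d B u z), x1) \<in> X" by blast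
      then show ?thesis unfolding pre_1[OF False] using edge' by blast
    qed
  qed
  \<comment> \<open>Outside \<open>J\<close> the credit \<open>x i + B\<close> can be cut down to
    \<open>B\<close> by the hypothesis on \<open>B\<close>, and \<open>B\<close> is the value of
    \<open>entry u i\<close> there.\<close>
  have "(q, \<lambda>i. if i \<in> J then entry u i else x i + B) \<in> ?W"
    by (rule Z) (use ubox J(1) in \<open>auto simp: R_def J_def\<close>)
  from B[OF this J(1)] fin show ?case
    by (rule win_up) (use ubox in \<open>auto simp: J_def box_def\<close>)
qed

section \<open>Games without opponent\<close>

lemma walk_tgt: "walk s es t \<Longrightarrow> es \<noteq> [] \<Longrightarrow> t \<in> tgt ` set es"
  by (induction es arbitrary: s) (auto, metis image_eqI snd_conv walk.simps(1))

text \<open>Enough credit for one pass through \<open>es\<close>: no prefix lowers a counter by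
  more.\<close>

definition total_abs :: "'v edge list \<Rightarrow> nat \<Rightarrow> nat" where
  "total_abs es i = (\<Sum>e\<leftarrow>es. nat \<bar>coord (lab e) i\<bar>)"

lemma effect_ge: "- int (total_abs es i) \<le> effect es i"
  by (induction es) (auto simp: total_abs_def)

text \<open>The opponent has no choice left, so Player 1 just goes around the closed walk. Credit
  for one pass suffices for ever since the effect is non-negative; the path leading to
  \<open>v\<close> is paid for in advance by the absolute values of its labels.\<close>

lemma win_closed_walk:
  assumes fin: "finite E"
    and det: "\<And>e e'. e \<in> E \<Longrightarrow> e' \<in> E \<Longrightarrow> src e \<in> P \<Longrightarrow> src e = src e' \<Longrightarrow> e = e'"
    and v: "v \<in> F" and es: "walk v es v" "es \<noteq> []" "set es \<subseteq> E" "\<forall>i<d. 0 \<le> effect es i"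
    and path: "walk s ps v" "set ps \<subseteq> E"
  shows "\<exists>x. (s, x) \<in> win d P F E"
proof -
  let ?pre = "pre d P E" and ?F = "F \<times> UNIV"
  have preI: "(src e, x) \<in> ?pre X" if "e \<in> E" "fires d x (lab e) x'" "(tgt e, x') \<in> X" for e x x' X
  proof -
    have e: "(src e, lab e, tgt e) \<in> E" using that(1) by simp
    show ?thesis
    proof (cases "src e \<in> P")
      case True
      have "z = lab e \<and> t = tgt e" if "(src e, z, t) \<in> E" for z t
        using det[OF e that] True by (metis fst_conv snd_conv)
      then show ?thesis unfolding pre_P[OF True] using e that by blast
    next
      case False
      then show ?thesis unfolding pre_1[OF False] using e that by blast
    qed
  qed
  \<comment> \<open>Configurations somewhere on the closed walk, with the part \<open>a\<close> of
    the current pass behind them and the counters no lower than the starting credit plus the effect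
    of \<open>a\<close>.\<close>
  define Z where "Z = {(u, x). \<exists>a c. es = a @ c \<and> walk u c v \<and>
    (\<forall>i<d. int (total_abs es i) + effect a i \<le> int (x i))}"
  have ZI: "(u, x) \<in> Z"
    if "es = a @ c" "walk u c v" "\<forall>i<d. int (total_abs es i) + effect a i \<le> int (x i)" for u x a c
    using that unfolding Z_def by blast
  have attZ: "?pre (att ?pre ?F Z) \<subseteq> att ?pre ?F Z"
    by (rule pre_att[OF mono_pre continuous_pre[OF fin]])
  have FZ: "?F \<inter> ?pre Z \<subseteq> att ?pre ?F Z"
    using attn_subset_att[of ?pre ?F "Suc 0" Z] by auto
  have step: "\<exists>x'. fires d x (lab e) x' \<and>
      (\<forall>i<d. int (total_abs es i) + effect (a @ [e]) i \<le> int (x' i))"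
    if "es = a @ e # c" "\<forall>i<d. int (total_abs es i) + effect a i \<le> int (x i)" for a e c x
  proof (intro exI conjI allI impI)
    have *: "0 \<le> int (x i) + coord (lab e) i" if "i < d" for i
    proof -
      have "- int (total_abs (a @ [e]) i) \<le> effect (a @ [e]) i" by (rule effect_ge)
      moreover have "total_abs (a @ [e]) i \<le> total_abs es i" unfolding that \<open>es = a @ e # c\<close> total_abs_def by simp
      moreover have "int (total_abs es i) + effect a i \<le> int (x i)"
        using \<open>\<forall>i<d. int (total_abs es i) + effect a i \<le> int (x i)\<close> that by blast
      ultimately show ?thesis by simp
    qed
    show "fires d x (lab e) (\<lambda>i. nat (int (x i) + coord (lab e) i))" unfolding fires_def using * by simp
    show "int (total_abs es i) + effect (a @ [e]) i \<le> int (nat (int (x i) + coord (lab e) i))"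
      if "i < d" for i using \<open>\<forall>i<d. int (total_abs es i) + effect a i \<le> int (x i)\<close> that * by auto
  qed
  have main: "(u, x) \<in> att ?pre ?F Z"
    if "es = a @ c" "walk u c v" "\<forall>i<d. int (total_abs es i) + effect a i \<le> int (x i)" for u x a c
    using that
  proof (induction c arbitrary: u x a)
    case Nil
    \<comment> \<open>The pass is complete: the play is back at the target \<open>v\<close>, and the
      first edge \<open>e\<close> of the next pass leads into \<open>Z\<close>.\<close>
    obtain e c where ec: "es = e # c" using es(2) by (cases es) auto
    have uv: "u = v" using Nil by simp
    have "int (total_abs es i) \<le> int (x i)" if "i < d" for i
      using Nil.prems(1,3) es(4) that by fastforce
    then obtain x' where x': "fires d x (lab e) x'"
      "\<forall>i<d. int (total_abs es i) + effect [e] i \<le> int (x' i)"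
      using step[of "[]" e c x] ec by auto
    have "(tgt e, x') \<in> Z"
      by (rule ZI[of "[e]" c]) (use x'(2) ec es(1) in simp_all)
    then have "(src e, x) \<in> ?pre Z" using es(3) ec x'(1) by (intro preI) auto
    then have "(v, x) \<in> ?F \<inter> ?pre Z" using es(1) ec v by simp
    then show ?case using FZ uv by blast
  next
    case (Cons e c)
    obtain x' where x': "fires d x (lab e) x'"
      "\<forall>i<d. int (total_abs es i) + effect (a @ [e]) i \<le> int (x' i)"
      using step[OF Cons.prems(1,3)] by blast
    have "(tgt e, x') \<in> att ?pre ?F Z"
      by (rule Cons.IH[of "a @ [e]"]) (use Cons.prems x'(2) in auto)
    then have "(src e, x) \<in> ?pre (att ?pre ?F Z)"
      using es(3) Cons.prems(1) x'(1) by (intro preI) auto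
    then show ?case using attZ Cons.prems(2) by auto
  qed
  have "Z \<subseteq> att ?pre ?F Z"
  proof
    fix b assume "b \<in> Z"
    then obtain u x a c where b: "b = (u, x)" and c: "es = a @ c" "walk u c v"
      "\<forall>i<d. int (total_abs es i) + effect a i \<le> int (x i)" unfolding Z_def by blast
    show "b \<in> att ?pre ?F Z" unfolding b by (rule main[OF c])
  qed
  then have "Z \<subseteq> win d P F E" unfolding win_def by (rule buchi_coinduct)
  moreover have "(v, total_abs es) \<in> Z"
    by (rule ZI[of "[]" es]) (use es(1) in simp_all)
  ultimately have vw: "\<exists>x. (v, x) \<in> win d P F E" by blast
  show ?thesis using path
  proof (induction ps arbitrary: s)
    case Nil
    then show ?case using vw by simp
  next
    case (Cons e ps)
    then obtain x where x: "(tgt e, x) \<in> win d P F E" by auto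
    have "fires d (\<lambda>i. x i + nat \<bar>coord (lab e) i\<bar>) (lab e) x" unfolding fires_def by auto
    then have "(src e, \<lambda>i. x i + nat \<bar>coord (lab e) i\<bar>) \<in> ?pre (win d P F E)"
      using Cons.prems(2) x by (intro preI) auto
    then have "(src e, \<lambda>i. x i + nat \<bar>coord (lab e) i\<bar>) \<in> win d P F E"
      using pre_win[OF fin, of d P F] by blast
    then show ?case using Cons.prems(1) by auto
  qed
qed

text \<open>Let the opponent answer within \<open>E'\<close> while Player 1 follows her win.
  Infinitely many visits to target vertices in the finite set \<open>R\<close> contain, by Dickson,
  two at the same vertex with no counter smaller at the later one; the walk between them is the
  closed walk sought.\<close>

lemma closed_walk_of_win:
  assumes finR: "finite R"
    and R1: "\<And>e. e \<in> E \<Longrightarrow> src e \<in> R \<Longrightarrow> src e \<notin> P \<Longrightarrow> e \<in> E'"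
    and RP: "\<And>e. e \<in> E \<Longrightarrow> src e \<in> R \<Longrightarrow> src e \<in> P \<Longrightarrow> \<exists>e'\<in>E \<inter> E'. src e' = src e"
    and Rt: "\<And>e. e \<in> E' \<Longrightarrow> tgt e \<in> R"
    and s: "s \<in> R" "(s, x) \<in> win d P F E"
  shows "\<exists>v\<in>R \<inter> F. \<exists>es. es \<noteq> [] \<and> walk v es v \<and> set es \<subseteq> E' \<and> (\<forall>i<d. 0 \<le> effect es i)"
proof -
  let ?pre = "pre d P E" and ?F = "F \<times> UNIV" and ?W = "win d P F E"
  have step: "\<exists>e x'. e \<in> E' \<and> src e = s \<and> tgt e \<in> R \<and> fires d x (lab e) x' \<and> (tgt e, x') \<in> X"
    if g: "(s, x) \<in> ?pre X" "s \<in> R" for s x X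
  proof (cases "s \<in> P")
    case True
    note pre = g(1)[unfolded pre_P[OF True]]
    then obtain z t where "(s, z, t) \<in> E" by blast
    then obtain e where e: "e \<in> E" "e \<in> E'" "src e = s" using RP[of "(s, z, t)"] g(2) True by auto
    then have "(s, lab e, tgt e) \<in> E" by auto
    then obtain x' where "fires d x (lab e) x'" "(tgt e, x') \<in> X" using pre by blast
    then show ?thesis using e Rt by blast
  next
    case False
    note pre = g(1)[unfolded pre_1[OF False]]
    then obtain z t x' where e: "(s, z, t) \<in> E" "fires d x z x'" "(t, x') \<in> X" by blast
    then have "(s, z, t) \<in> E'" using R1[of "(s, z, t)"] g(2) False by simp
    then show ?thesis using e Rt[of "(s, z, t)"] by (intro exI[of _ "(s, z, t)"] exI[of _ x']) simp
  qed
  \<comment> \<open>An inequality because counters may be lowered on the way. This is the harmless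
    direction: if the counters at the end are no smaller than at the start, the effect is still
    non-negative.\<close>
  define path where "path c es c' \<longleftrightarrow> walk (fst c) es (fst c') \<and> set es \<subseteq> E' \<and>
    (\<forall>i<d. int (snd c' i) \<le> int (snd c i) + effect es i)"
    for c c' :: "'a \<times> (nat \<Rightarrow> nat)" and es
  have path_trans: "path a es b \<Longrightarrow> path b es' c \<Longrightarrow> path a (es @ es') c" for a b c es es'
    unfolding path_def by (auto simp: walk_append) (smt (verit))
  define G where "G = {c. fst c \<in> R \<inter> F \<and> c \<in> ?pre ?W}"
  have path_step: "\<exists>es c'. es \<noteq> [] \<and> path c es c' \<and> fst c' \<in> R \<and> c' \<in> X"
    if c: "c \<in> ?pre X" "fst c \<in> R" for c X
  proof -
    have "(fst c, snd c) \<in> ?pre X" using c(1) by simp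
    from step[OF this c(2)] obtain e x' where e: "e \<in> E'" "src e = fst c" "tgt e \<in> R"
      "fires d (snd c) (lab e) x'" "(tgt e, x') \<in> X" by blast
    then have "path c [e] (tgt e, x')" unfolding path_def fires_def by simp
    then show ?thesis using e by (intro exI[of _ "[e]"] exI[of _ "(tgt e, x')"]) simp
  qed
  have to_G: "\<exists>es c'. path c es c' \<and> c' \<in> G" if "c \<in> attn ?pre ?F n ?W" "fst c \<in> R" for n c
    using that
  proof (induction n arbitrary: c)
    case (Suc n)
    show ?case
    proof (cases "c \<in> ?F \<inter> ?pre ?W")
      case True
      then have "c \<in> G" "path c [] c" unfolding G_def path_def using Suc.prems(2) by auto
      then show ?thesis by blast
    next
      case False
      then have "c \<in> ?pre (attn ?pre ?F n ?W)" using Suc.prems(1) unfolding attn.simps by blast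
      then obtain es c' where c': "path c es c'" "fst c' \<in> R" "c' \<in> attn ?pre ?F n ?W"
        using path_step[OF _ Suc.prems(2)] by blast
      then show ?thesis using Suc.IH[OF c'(3,2)] path_trans by blast
    qed
  qed simp
  have W_to_G: "\<exists>es c'. path c es c' \<and> c' \<in> G" if "c \<in> ?W" "fst c \<in> R" for c
    using to_G[OF _ that(2)] that(1) win_unfold[of d P F E] unfolding att_def by blast
  have next_G: "\<exists>c' es. es \<noteq> [] \<and> path c es c' \<and> c' \<in> G" if c: "c \<in> G" for c
  proof -
    have "c \<in> ?pre ?W" "fst c \<in> R" using c unfolding G_def by auto
    then obtain es c' where 1: "es \<noteq> []" "path c es c'" "fst c' \<in> R" "c' \<in> ?W"
      using path_step by blast
    obtain es' c'' where "path c' es' c''" "c'' \<in> G" using W_to_G[OF 1(4,3)] by blast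
    then show ?thesis using path_trans[OF 1(2)] 1(1) by (intro exI[of _ c''] exI[of _ "es @ es'"]) simp
  qed
  obtain c0 where c0: "c0 \<in> G" using W_to_G[OF s(2)] s(1) by auto
  have "\<exists>f. \<forall>n. f n \<in> G \<and> (\<exists>es. es \<noteq> [] \<and> path (f n) es (f (Suc n)))"
    by (rule dependent_nat_choice) (use c0 next_G in blast)+
  then obtain f where f: "\<And>n. f n \<in> G" "\<And>n. \<exists>es. es \<noteq> [] \<and> path (f n) es (f (Suc n))" by blast
  have "range (\<lambda>n. fst (f n)) \<subseteq> R" using f(1) unfolding G_def by auto
  then have "finite (range (\<lambda>n. fst (f n)))" using finR finite_subset by blast
  then obtain i j where ij: "i < j" "fst (f i) = fst (f j)" "\<forall>k\<in>{..<d}. snd (f i) k \<le> snd (f j) k"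
    using dickson[of "{..<d}" f] by auto
  have "\<exists>es. es \<noteq> [] \<and> path (f i) es (f (i + Suc n))" for n
  proof (induction n)
    case 0
    then show ?case using f(2) by simp
  next
    case (Suc n)
    obtain es where "es \<noteq> []" "path (f i) es (f (i + Suc n))" using Suc by blast
    moreover obtain es' where "path (f (i + Suc n)) es' (f (i + Suc (Suc n)))" using f(2)[of "i + Suc n"] by auto
    ultimately show ?case using path_trans by (metis append_is_Nil_conv)
  qed
  then obtain es where es: "es \<noteq> []" "path (f i) es (f j)"
    using ij(1) by (metis less_iff_Suc_add add_Suc_right)
  have "0 \<le> effect es k" if "k < d" for k
    using es(2) ij(3) that unfolding path_def by (smt (verit) lessThan_iff of_nat_mono)
  then show ?thesis using es ij(2) f(1)[of i] unfolding path_def G_def by auto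
qed

section \<open>Certificates\<close>

subsection \<open>Losing configurations\<close>

type_synonym 'v lose_cert = "nat \<times> ('v \<times> nat list) list \<times> ('v \<times> nat list) edge list \<times>
  (('v \<times> nat list) \<times> ('v \<times> nat list) rank_step list) list"

definition sat_edge :: "nat \<Rightarrow> nat \<Rightarrow> nat list \<Rightarrow> 'v edge \<Rightarrow> ('v \<times> nat list) edge" where
  "sat_edge d B u e = ((src e, u), lab e, (tgt e, sat_vec d B u (lab e)))"

text \<open>A certificate consists of the bound \<open>B\<close>, a set of vertices that the opponent can enforce to stay
  in, the edges that then remain, and for each target vertex the steps that refute closed walks.\<close>

definition lose_ok :: "nat \<Rightarrow> 'v list \<Rightarrow> 'v \<Rightarrow> 'v edge list \<Rightarrow> 'v \<times> nat list \<Rightarrow> 'v lose_cert \<Rightarrow> bool" where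
  "lose_ok d P f E c w \<longleftrightarrow> (case w of (B, R, Es, Ch) \<Rightarrow>
     c \<in> set R \<and> (\<forall>a\<in>set (snd c). a \<le> B) \<and>
     (\<forall>r\<in>set R. if fst r \<in> set P
        then (\<exists>e\<in>set E. src e = fst r) \<longrightarrow> (\<exists>e\<in>set E. src e = fst r \<and> sat_edge d B (snd r) e \<in> set Es)
        else (\<forall>e\<in>set E. src e = fst r \<and> ok_vec d B (snd r) (lab e) \<longrightarrow> sat_edge d B (snd r) e \<in> set Es)) \<and>
     (\<forall>e\<in>set Es. tgt e \<in> set R) \<and>
     (\<forall>r\<in>set R. fst r = f \<longrightarrow> (\<exists>h\<in>set Ch. fst h = r \<and> blocked d r Es (snd h))))"

lemma sat_edge_saturated: "sat_edge d B u e \<in> saturated d B E \<longleftrightarrow> e \<in> E \<and> u \<in> box d B \<and> ok_vec d B u (lab e)"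
  unfolding sat_edge_def saturated_iff by simp

lemma saturatedE:
  assumes "g \<in> saturated d B E"
  obtains e where "e \<in> E" "snd (src g) \<in> box d B" "ok_vec d B (snd (src g)) (lab e)"
    "src e = fst (src g)" "g = sat_edge d B (snd (src g)) e"
  using assms unfolding saturated_def sat_edge_def by force

lemma static_ok: "static d P E \<Longrightarrow> e \<in> E \<Longrightarrow> src e \<in> P \<Longrightarrow> ok_vec d B u (lab e)"
  unfolding static_def ok_vec_def by force

lemma entry_le: "\<forall>a\<in>set v. a \<le> B \<Longrightarrow> entry v i \<le> B"
  by (simp add: nth_default_def)

text \<open>\<open>win_saturated\<close> holds for every \<open>B\<close>, so the checker need not
  know whether \<open>B\<close> is a bound as in \<open>uniform_bound\<close>; only
  \<open>lose_ok_complete\<close> has to supply such a bound.\<close>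

lemma lose_ok_sound:
  assumes st: "static d (set P) (set E)" and len: "length v0 = d"
    and ok: "lose_ok d P f E (q0, v0) w"
  shows "(q0, entry v0) \<notin> win d (set P) {f} (set E)"
proof
  assume win: "(q0, entry v0) \<in> win d (set P) {f} (set E)"
  obtain B R Es Ch where w: "w = (B, R, Es, Ch)" by (cases w) auto
  let ?G = "saturated d B (set E)"
  have c: "(q0, v0) \<in> set R" "\<forall>a\<in>set v0. a \<le> B"
    and RP: "\<And>r. r \<in> set R \<Longrightarrow> fst r \<in> set P \<Longrightarrow> (\<exists>e\<in>set E. src e = fst r) \<longrightarrow>
      (\<exists>e\<in>set E. src e = fst r \<and> sat_edge d B (snd r) e \<in> set Es)"
    and R1: "\<And>r e. r \<in> set R \<Longrightarrow> fst r \<notin> set P \<Longrightarrow> e \<in> set E \<Longrightarrow> src e = fst r \<Longrightarrow>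
      ok_vec d B (snd r) (lab e) \<Longrightarrow> sat_edge d B (snd r) e \<in> set Es"
    and Rt: "\<And>e. e \<in> set Es \<Longrightarrow> tgt e \<in> set R"
    and Ch: "\<And>r. r \<in> set R \<Longrightarrow> fst r = f \<Longrightarrow> \<exists>h\<in>set Ch. fst h = r \<and> blocked d r Es (snd h)"
    using ok unfolding lose_ok_def w by (auto split: if_splits)
  have "v0 \<in> box d B" unfolding box_def using len entry_le[OF c(2)] by blast
  then have winG: "((q0, v0), entry v0) \<in> win d (set P \<times> UNIV) ({f} \<times> UNIV) ?G"
    by (intro win_saturated[OF finite_set st win]) simp_all
  have "\<exists>v\<in>set R \<inter> ({f} \<times> UNIV). \<exists>es. es \<noteq> [] \<and> walk v es v \<and> set es \<subseteq> set Es \<and>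
      (\<forall>i<d. 0 \<le> effect es i)"
  proof (rule closed_walk_of_win[OF _ _ _ Rt c(1) winG])
    fix g assume g: "g \<in> ?G" "src g \<in> set R" "src g \<notin> set P \<times> UNIV"
    then obtain e where e: "e \<in> set E" "ok_vec d B (snd (src g)) (lab e)" "src e = fst (src g)"
      "g = sat_edge d B (snd (src g)) e" by (blast elim: saturatedE)
    have "fst (src g) \<notin> set P" using g(3) by (simp add: mem_Times_iff)
    from R1[OF g(2) this e(1,3,2)] show "g \<in> set Es" using e(4) by simp
  next
    fix g assume g: "g \<in> ?G" "src g \<in> set R" "src g \<in> set P \<times> UNIV"
    then obtain e where e: "e \<in> set E" "src e = fst (src g)" "snd (src g) \<in> box d B"
      by (blast elim: saturatedE)
    have P: "fst (src g) \<in> set P" using g(3) by (simp add: mem_Times_iff)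
    then obtain e' where e': "e' \<in> set E" "src e' = fst (src g)" "sat_edge d B (snd (src g)) e' \<in> set Es"
      using RP[OF g(2)] e(1,2) by blast
    then have "sat_edge d B (snd (src g)) e' \<in> ?G"
      unfolding sat_edge_saturated using e(3) P by (auto intro: static_ok[OF st])
    moreover have "src (sat_edge d B (snd (src g)) e') = src g"
      unfolding sat_edge_def using e'(2) by simp
    ultimately show "\<exists>e'\<in>?G \<inter> set Es. src e' = src g" using e'(3) by blast
  qed simp
  then obtain v es where v: "v \<in> set R" "fst v = f" and es: "es \<noteq> []" "walk v es v" "set es \<subseteq> set Es"
    "\<forall>i<d. 0 \<le> effect es i" by fastforce
  obtain ss where "blocked d v Es ss" using Ch[OF v] by blast
  from blocked_sound[OF this es(2-4)] show False using es(1) by blast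
qed

text \<open>The certificate is restricted to the vertices reachable from the initial one: a
  non-empty closed walk of non-negative effect at a reachable target would be a win for some credit
  by \<open>win_closed_walk\<close>, so \<open>blocked_complete\<close> applies to every target
  vertex that has to be checked.\<close>

lemma lose_ok_complete:
  assumes st: "static d (set P) (set E)" and len: "length v0 = d"
    and lose: "(q0, entry v0) \<notin> win d (set P) {f} (set E)"
  shows "\<exists>w. lose_ok d P f E (q0, v0) w"
proof -
  \<comment> \<open>The sum of the entries of \<open>v0\<close> is a convenient upper bound for each
    of them.\<close>
  obtain B where B0: "sum_list v0 \<le> B" "\<forall>q x J. (q, x) \<in> win d (set P) {f} (set E) \<and> J \<subseteq> {..<d} \<longrightarrow>
      (q, \<lambda>i. if i \<in> J then x i else B) \<in> win d (set P) {f} (set E)"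
    using uniform_bound[OF finite_set, of "sum_list v0" d "set P" "{f}" E] by (elim exE conjE)
  have B: "sum_list v0 \<le> B"
    "\<And>q x J. (q, x) \<in> win d (set P) {f} (set E) \<Longrightarrow> J \<subseteq> {..<d} \<Longrightarrow>
      (q, \<lambda>i. if i \<in> J then x i else B) \<in> win d (set P) {f} (set E)"
    using B0 by simp_all
  have v0B: "\<forall>a\<in>set v0. a \<le> B" using order_trans[OF member_le_sum_list B(1)] by simp
  then have v0: "v0 \<in> box d B" unfolding box_def using len entry_le by blast
  let ?G = "saturated d B (set E)" and ?P = "set P \<times> (UNIV :: nat list set)"
    and ?F = "{f} \<times> (UNIV :: nat list set)"
  let ?s = "(q0, v0)"
  have "(?s, x) \<notin> win d ?P ?F ?G" for x
    using saturated_win[OF _ st B(2), of q0 v0 x] lose by auto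
  from memoryless_opponent[OF finite_saturated[OF finite_set] this]
  obtain E' where E': "E' \<subseteq> ?G" "\<And>e. e \<in> ?G \<Longrightarrow> src e \<notin> ?P \<Longrightarrow> e \<in> E'"
    "\<And>e. e \<in> ?G \<Longrightarrow> src e \<in> ?P \<Longrightarrow> \<exists>e'\<in>E'. src e' = src e"
    "\<And>e e'. e \<in> E' \<Longrightarrow> e' \<in> E' \<Longrightarrow> src e \<in> ?P \<Longrightarrow> src e = src e' \<Longrightarrow> e = e'"
    "\<And>x. (?s, x) \<notin> win d ?P ?F E'" by metis
  have finE': "finite E'" using E'(1) finite_saturated[of "set E" d B] finite_subset by blast
  define R where "R = {t. \<exists>es. walk ?s es t \<and> set es \<subseteq> E'}"
  have "R \<subseteq> insert ?s (tgt ` E')"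
  proof
    fix t assume "t \<in> R"
    then obtain es where "walk ?s es t" "set es \<subseteq> E'" unfolding R_def by blast
    then show "t \<in> insert ?s (tgt ` E')" using walk_tgt[of ?s es t] by (cases "es = []") auto
  qed
  then have finR: "finite R" using finE' finite_subset by blast
  have sR: "?s \<in> R" unfolding R_def by (auto intro!: exI[of _ "[]"])
  have step: "tgt e \<in> R" if "e \<in> E'" "src e \<in> R" for e
  proof -
    obtain es where "walk ?s es (src e)" "set es \<subseteq> E'" using \<open>src e \<in> R\<close> unfolding R_def by blast
    then have "walk ?s (es @ [e]) (tgt e)" unfolding walk_append by (intro exI[of _ "src e"]) simp
    moreover have "set (es @ [e]) \<subseteq> E'" using \<open>set es \<subseteq> E'\<close> that(1) by simp
    ultimately show ?thesis unfolding R_def by blast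
  qed
  have Rbox: "snd r \<in> box d B" if "r \<in> R" for r
  proof -
    have "r = ?s \<or> r \<in> tgt ` ?G" using that \<open>R \<subseteq> _\<close> E'(1) by blast
    then show ?thesis using v0 by (auto simp: saturated_def sat_vec_box)
  qed
  obtain Rl where Rl: "set Rl = R" using finite_list[OF finR] by blast
  have "finite {e \<in> E'. src e \<in> R}" using finE' by simp
  then obtain Es where Es: "set Es = {e \<in> E'. src e \<in> R}" using finite_list by blast
  have "\<exists>ss. blocked d r Es ss" if r: "r \<in> R" "fst r = f" for r
  proof (rule blocked_complete)
    fix es assume es: "walk r es r" "set es \<subseteq> set Es" "\<forall>i<d. 0 \<le> effect es i"
    obtain ps where ps: "walk ?s ps r" "set ps \<subseteq> E'" using r(1) unfolding R_def by blast
    show "es = []"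
    proof (rule ccontr)
      assume "es \<noteq> []"
      have "set es \<subseteq> E'" using es(2) Es by blast
      have "r \<in> ?F" using r(2) by (simp add: mem_Times_iff)
      have "\<exists>x. (?s, x) \<in> win d ?P ?F E'"
        by (rule win_closed_walk[OF finE' E'(4) \<open>r \<in> ?F\<close> es(1) \<open>es \<noteq> []\<close> \<open>set es \<subseteq> E'\<close> es(3) ps])
      then show False using E'(5) by blast
    qed
  qed
  then obtain ss where ss: "\<And>r. r \<in> R \<Longrightarrow> fst r = f \<Longrightarrow> blocked d r Es (ss r)" by metis
  have "lose_ok d P f E ?s (B, Rl, Es, map (\<lambda>r. (r, ss r)) Rl)"
    unfolding lose_ok_def split Rl
  proof (intro conjI ballI)
    show "?s \<in> R" by fact
    show "a \<le> B" if "a \<in> set (snd ?s)" for a using v0B that by simp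
    show "tgt e \<in> R" if "e \<in> set Es" for e using that step unfolding Es by blast
    show "fst r = f \<longrightarrow> (\<exists>h\<in>set (map (\<lambda>r. (r, ss r)) Rl). fst h = r \<and> blocked d r Es (snd h))"
      if "r \<in> R" for r using that ss Rl by auto
  next
    fix r assume r: "r \<in> R"
    have src: "src (sat_edge d B (snd r) e) = r" if "src e = fst r" for e
      using that by (simp add: sat_edge_def)
    show "if fst r \<in> set P
        then (\<exists>e\<in>set E. src e = fst r) \<longrightarrow> (\<exists>e\<in>set E. src e = fst r \<and> sat_edge d B (snd r) e \<in> set Es)
        else (\<forall>e\<in>set E. src e = fst r \<and> ok_vec d B (snd r) (lab e) \<longrightarrow> sat_edge d B (snd r) e \<in> set Es)"
    proof (cases "fst r \<in> set P")
      case True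
      have "\<exists>e\<in>set E. src e = fst r \<and> sat_edge d B (snd r) e \<in> set Es" if e: "e \<in> set E" "src e = fst r" for e
      proof -
        have "sat_edge d B (snd r) e \<in> ?G"
          unfolding sat_edge_saturated using e Rbox[OF r] static_ok[OF st] True by auto
        then obtain g where g: "g \<in> E'" "src g = r"
          using E'(3) src[OF e(2)] True by (metis UNIV_I mem_Times_iff)
        then have "g \<in> ?G" using E'(1) by blast
        then obtain e' where e': "e' \<in> set E" "src e' = fst r" "g = sat_edge d B (snd r) e'"
          by (rule saturatedE) (use g(2) in blast)
        have "g \<in> set Es" unfolding Es using g r by simp
        then show ?thesis using e' by blast
      qed
      then show ?thesis using True by auto
    next
      case False
      have "sat_edge d B (snd r) e \<in> set Es"
        if e: "e \<in> set E" "src e = fst r" "ok_vec d B (snd r) (lab e)" for e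
      proof -
        have "sat_edge d B (snd r) e \<in> ?G"
          unfolding sat_edge_saturated using e Rbox[OF r] by blast
        then have "sat_edge d B (snd r) e \<in> E'"
          by (rule E'(2)) (use src[OF e(2)] False in \<open>simp add: mem_Times_iff\<close>)
        then show ?thesis using src[OF e(2)] r unfolding Es by simp
      qed
      then show ?thesis using False by simp
    qed
  qed
  then show ?thesis by blast
qed

subsection \<open>Winning configurations\<close>

text \<open>\<open>pre\<close> with all quantifiers bounded by lists or by \<open>d\<close>, which
  makes it decidable; see \<open>justified_iff\<close>.\<close>

definition justified :: "nat \<Rightarrow> 'v list \<Rightarrow> 'v edge list \<Rightarrow> ('v \<times> nat list) list \<Rightarrow> 'v \<times> nat list \<Rightarrow> bool" where
  "justified d P E L c \<longleftrightarrow> (if fst c \<in> set P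
     then (\<exists>e\<in>set E. src e = fst c) \<and> (\<forall>e\<in>set E. src e = fst c \<longrightarrow>
       (\<exists>b\<in>set L. fst b = tgt e \<and> (\<forall>i<d. int (entry (snd b) i) \<le> int (entry (snd c) i) + coord (lab e) i)))
     else (\<exists>e\<in>set E. src e = fst c \<and>
       (\<exists>b\<in>set L. fst b = tgt e \<and> (\<forall>i<d. int (entry (snd b) i) \<le> int (entry (snd c) i) + coord (lab e) i))))"

text \<open>Entries rely only on \<open>X\<close> and on entries further to the right, so the list
  is a well-founded proof that each of them lies in the attractor for \<open>X\<close>.\<close>

fun derivation :: "nat \<Rightarrow> 'v list \<Rightarrow> 'v \<Rightarrow> 'v edge list \<Rightarrow> ('v \<times> nat list) list \<Rightarrow> ('v \<times> nat list) list \<Rightarrow> bool" where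
  "derivation d P f E X [] \<longleftrightarrow> True"
| "derivation d P f E X (y # ys) \<longleftrightarrow>
     (fst y = f \<and> justified d P E X y \<or> justified d P E ys y) \<and> derivation d P f E X ys"

text \<open>The first component of a certificate generates an upward closed set each of whose generators
  is derived in the second component.\<close>

definition win_ok :: "nat \<Rightarrow> 'v list \<Rightarrow> 'v \<Rightarrow> 'v edge list \<Rightarrow> 'v \<times> nat list \<Rightarrow>
    ('v \<times> nat list) list \<times> ('v \<times> nat list) list \<Rightarrow> bool" where
  "win_ok d P f E c w \<longleftrightarrow> (\<forall>x\<in>set (fst w). x \<in> set (snd w)) \<and> derivation d P f E (fst w) (snd w) \<and>
     (\<exists>b\<in>set (fst w). fst b = fst c \<and> (\<forall>i<d. entry (snd b) i \<le> entry (snd c) i))"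

abbreviation cfg :: "'v \<times> nat list \<Rightarrow> 'v \<times> (nat \<Rightarrow> nat)" where
  "cfg c \<equiv> (fst c, entry (snd c))"

lemma bex_edges_from: "(\<exists>e\<in>E. src e = s \<and> Q (lab e) (tgt e)) \<longleftrightarrow> (\<exists>z t. (s, z, t) \<in> E \<and> Q z t)"
  by force

lemma ball_edges_from: "(\<forall>e\<in>E. src e = s \<longrightarrow> Q (lab e) (tgt e)) \<longleftrightarrow> (\<forall>z t. (s, z, t) \<in> E \<longrightarrow> Q z t)"
  by force

lemma justified_iff: "justified d P E L c \<longleftrightarrow> cfg c \<in> pre d (set P) (set E) (cfg ` set L)"
proof -
  have *: "(\<exists>b\<in>set L. fst b = t \<and> (\<forall>i<d. int (entry (snd b) i) \<le> int (entry (snd c) i) + coord z i)) \<longleftrightarrow>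
      (\<exists>x'. fires d (entry (snd c)) z x' \<and> (t, x') \<in> cfg ` set L)" for z t
    unfolding fires_def by force
  note ** = ball_edges_from[of "set E" "fst c" "\<lambda>z t. \<exists>x'. fires d (entry (snd c)) z x' \<and> (t, x') \<in> cfg ` set L"]
    bex_edges_from[of "set E" "fst c" "\<lambda>z t. \<exists>x'. fires d (entry (snd c)) z x' \<and> (t, x') \<in> cfg ` set L"]
    bex_edges_from[of "set E" "fst c" "\<lambda>z t. True", simplified]
  show ?thesis unfolding justified_def * ** pre_def mem_Collect_eq split
    by (simp only: conj_assoc ex_simps)
qed

lemma justified_mono: "justified d P E L c \<Longrightarrow> set L \<subseteq> set L' \<Longrightarrow> justified d P E L' c"
  unfolding justified_iff using monoD[OF mono_pre, of "cfg ` set L" "cfg ` set L'"] by blast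

lemma derivation_append:
  "derivation d P f E X ys \<Longrightarrow> derivation d P f E X zs \<Longrightarrow> derivation d P f E X (ys @ zs)"
  by (induction ys) (auto intro: justified_mono)

lemma derivation_sound:
  "derivation d P f E X ys \<Longrightarrow> cfg ` set ys \<subseteq> att (pre d (set P) (set E)) ({f} \<times> UNIV) (cfg ` set X)"
proof (induction ys)
  case (Cons y ys)
  let ?pre = "pre d (set P) (set E)" and ?F = "{f} \<times> UNIV" and ?X = "cfg ` set X"
  have IH: "cfg ` set ys \<subseteq> att ?pre ?F ?X" using Cons by simp
  have "cfg y \<in> att ?pre ?F ?X"
  proof (cases "justified d P E ys y")
    case True
    then have "cfg y \<in> ?pre (att ?pre ?F ?X)"
      unfolding justified_iff using monoD[OF mono_pre IH] by blast
    then show ?thesis using pre_att[OF mono_pre continuous_pre[OF finite_set]] by blast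
  next
    case False
    then have "cfg y \<in> ?F \<inter> ?pre ?X" using Cons.prems by (auto simp: justified_iff)
    then show ?thesis using attn_subset_att[of ?pre ?F "Suc 0" ?X] by auto
  qed
  then show ?case using IH by simp
qed simp

lemma win_ok_sound:
  assumes "win_ok d P f E c w"
  shows "cfg c \<in> win d (set P) {f} (set E)"
proof -
  let ?X = "cfg ` set (fst w)"
  have "?X \<subseteq> att (pre d (set P) (set E)) ({f} \<times> UNIV) ?X"
    using assms derivation_sound[of d P f E "fst w" "snd w"] unfolding win_ok_def by blast
  then have X: "?X \<subseteq> win d (set P) {f} (set E)" unfolding win_def by (rule buchi_coinduct)
  obtain b where b: "b \<in> set (fst w)" "fst b = fst c" "\<forall>i<d. entry (snd b) i \<le> entry (snd c) i"
    using assms unfolding win_ok_def by blast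
  then have "(fst c, entry (snd b)) \<in> win d (set P) {f} (set E)" using X by force
  then show ?thesis using finite_set by (rule win_up) (rule b(3))
qed

lemma pre_dom:
  assumes "\<And>q x. (q, x) \<in> A \<Longrightarrow> \<exists>x'. (q, x') \<in> A' \<and> (\<forall>i<d. x' i \<le> x i)"
  shows "pre d P E A \<subseteq> pre d P E A'"
proof -
  have *: "\<exists>x'. fires d x z x' \<and> (t, x') \<in> A'" if f: "fires d x z x1" and t: "(t, x1) \<in> A" for x z t x1
  proof -
    obtain x' where "(t, x') \<in> A'" "\<forall>i<d. x' i \<le> x1 i" using assms[OF t] by blast
    moreover from this have "fires d x z x'"
      using f unfolding fires_def by (meson of_nat_mono order_trans)
    ultimately show ?thesis by blast
  qed
  show ?thesis
  proof
    fix c assume "c \<in> pre d P E A"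
    then show "c \<in> pre d P E A'"
      by (cases c, cases "fst c \<in> P") (use * in \<open>simp_all add: pre_P pre_1, blast+\<close>)
  qed
qed

lemma attn_up:
  assumes "(s, x) \<in> attn (pre d P E) (F \<times> UNIV) n X" "\<forall>i<d. x i \<le> y i"
  shows "(s, y) \<in> attn (pre d P E) (F \<times> UNIV) n X"
  using assms by (cases n) (auto intro: pre_up)

lemma entry_map: "i < d \<Longrightarrow> entry (map x [0..<d]) i = x i"
  by (simp add: nth_default_def)

text \<open>One successor for each of the finitely many edges is enough. Truncating it to the first
  \<open>d\<close> counters makes it a list, and the assumption on \<open>A\<close>, which looks at
  the first \<open>d\<close> counters only, keeps it in \<open>A\<close>.\<close>

lemma pre_finite_support:
  assumes fin: "finite E" and c: "(q, x) \<in> pre d P E A"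
    and A: "\<And>s x y. (s, x) \<in> A \<Longrightarrow> \<forall>i<d. x i \<le> y i \<Longrightarrow> (s, y) \<in> A"
  shows "\<exists>S. finite S \<and> cfg ` S \<subseteq> A \<and> (q, x) \<in> pre d P E (cfg ` S)"
proof -
  define N where "N e = (SOME x'. fires d x (lab e) x' \<and> (tgt e, x') \<in> A)" for e
  define h where "h e = (tgt e, map (N e) [0..<d])" for e :: "'a edge"
  have hA: "cfg (h e) \<in> A \<and> fires d x (lab e) (entry (snd (h e)))"
    if "\<exists>x'. fires d x (lab e) x' \<and> (tgt e, x') \<in> A" for e
  proof -
    have "fires d x (lab e) (N e) \<and> (tgt e, N e) \<in> A" unfolding N_def by (rule someI_ex[OF that])
    moreover from this have "cfg (h e) \<in> A" unfolding h_def by (auto intro: A simp: entry_map)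
    ultimately show ?thesis unfolding fires_def h_def by (simp add: entry_map)
  qed
  define S where "S = h ` {e \<in> E. \<exists>x'. fires d x (lab e) x' \<and> (tgt e, x') \<in> A}"
  have "finite S" unfolding S_def using fin by simp
  moreover have "cfg ` S \<subseteq> A"
  proof
    fix b assume "b \<in> cfg ` S"
    then obtain e where "b = cfg (h e)" "\<exists>x'. fires d x (lab e) x' \<and> (tgt e, x') \<in> A"
      unfolding S_def by blast
    then show "b \<in> A" using hA by blast
  qed
  moreover have "(q, x) \<in> pre d P E (cfg ` S)"
  proof -
    have *: "\<exists>x'. fires d x z x' \<and> (t, x') \<in> cfg ` S"
      if "(q, z, t) \<in> E" "\<exists>x'. fires d x z x' \<and> (t, x') \<in> A" for z t
    proof -
      have "h (q, z, t) \<in> S" unfolding S_def using that by auto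
      then have "(t, entry (snd (h (q, z, t)))) \<in> cfg ` S" by (force simp: h_def)
      then show ?thesis using hA[of "(q, z, t)"] that(2) by auto
    qed
    show ?thesis
    proof (cases "q \<in> P")
      case True
      note c' = c[unfolded pre_P[OF True]]
      show ?thesis unfolding pre_P[OF True]
      proof (intro conjI allI impI)
        show "\<exists>z t. (q, z, t) \<in> E" using c' by blast
        fix z t assume e: "(q, z, t) \<in> E"
        then have "\<exists>x'. fires d x z x' \<and> (t, x') \<in> A" using c' by blast
        then show "\<exists>x'. fires d x z x' \<and> (t, x') \<in> cfg ` S" by (rule *[OF e])
      qed
    next
      case False
      from c[unfolded pre_1[OF False]] obtain z t
        where e: "(q, z, t) \<in> E" "\<exists>x'. fires d x z x' \<and> (t, x') \<in> A" by blast
      then show ?thesis using *[OF e] unfolding pre_1[OF False] by blast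
    qed
  qed
  ultimately show ?thesis by blast
qed

lemma derivation_finite:
  assumes "finite S" "\<And>c. c \<in> S \<Longrightarrow> \<exists>ys. derivation d P f E X ys \<and> c \<in> set ys"
  shows "\<exists>ys. derivation d P f E X ys \<and> S \<subseteq> set ys"
  using assms
proof induction
  case empty
  then show ?case by (intro exI[of _ "[]"]) simp
next
  case (insert c S)
  then obtain ys where ys: "derivation d P f E X ys" "S \<subseteq> set ys" by blast
  obtain zs where zs: "derivation d P f E X zs" "c \<in> set zs" using insert.prems by blast
  show ?case using derivation_append[OF ys(1) zs(1)] ys(2) zs(2) by (intro exI[of _ "ys @ zs"]) auto
qed

lemma win_ok_complete:
  assumes win: "cfg c \<in> win d (set P) {f} (set E)"
  shows "\<exists>w. win_ok d P f E c w"
proof -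
  let ?pre = "pre d (set P) (set E)" and ?F = "{f} \<times> (UNIV :: (nat \<Rightarrow> nat) set)"
    and ?W = "win d (set P) {f} (set E)"
  have "fst ` ?W \<subseteq> src ` set E" using win_src by fastforce
  then have "finite (fst ` ?W)" using finite_subset by blast
  from finite_basis[OF finite_lessThan this, of d] obtain U where U: "U \<subseteq> ?W" "finite U"
    "\<forall>(q, x)\<in>?W. \<exists>x0. (q, x0) \<in> U \<and> (\<forall>k\<in>{..<d}. x0 k \<le> x k)" by blast
  define g where "g = (\<lambda>(q :: 'a, x). (q, map x [0..<d]) :: 'a \<times> nat list)"
  obtain X where X: "set X = g ` U" using finite_list[of "g ` U"] U(2) by blast
  have XW: "cfg ` set X \<subseteq> ?W"
  proof
    fix b assume "b \<in> cfg ` set X"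
    then obtain q x where "(q, x) \<in> U" "b = (q, entry (map x [0..<d]))" unfolding X g_def by auto
    moreover from this(1) have "(q, x) \<in> ?W" using U(1) by blast
    then have "(q, entry (map x [0..<d])) \<in> ?W" using finite_set by (rule win_up) (simp add: entry_map)
    ultimately show "b \<in> ?W" by simp
  qed
  have dom: "\<exists>x'. (q, x') \<in> cfg ` set X \<and> (\<forall>i<d. x' i \<le> x i)" if qx: "(q, x) \<in> ?W" for q x
  proof -
    obtain x0 where x0: "(q, x0) \<in> U" "\<forall>k\<in>{..<d}. x0 k \<le> x k" using U(3) qx by blast
    then have "g (q, x0) \<in> set X" unfolding X by blast
    then have "(q, entry (map x0 [0..<d])) \<in> cfg ` set X" unfolding g_def by force
    then show ?thesis using x0(2) by (intro exI[of _ "entry (map x0 [0..<d])"]) (simp add: entry_map)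
  qed
  \<comment> \<open>Since counters may be lowered, a step into the winning set can be turned into a
    step into its basis.\<close>
  have preX: "?pre ?W \<subseteq> ?pre (cfg ` set X)" by (rule pre_dom) (rule dom)
  have *: "\<exists>ys. derivation d P f E X ys \<and> b \<in> set ys" if "cfg b \<in> attn ?pre ?F n ?W" for n b
    using that
  proof (induction n arbitrary: b)
    case (Suc n)
    show ?case
    proof (cases "cfg b \<in> ?F \<inter> ?pre ?W")
      case True
      then have "derivation d P f E X [b]" using preX by (auto simp: justified_iff)
      then show ?thesis by (intro exI[of _ "[b]"]) simp
    next
      case False
      then have b: "cfg b \<in> ?pre (attn ?pre ?F n ?W)" using Suc.prems unfolding attn.simps by blast
      have "\<exists>S. finite S \<and> cfg ` S \<subseteq> attn ?pre ?F n ?W \<and> cfg b \<in> ?pre (cfg ` S)"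
        by (rule pre_finite_support[OF finite_set b]) (rule attn_up)
      then obtain S where
        S: "finite S" "cfg ` S \<subseteq> attn ?pre ?F n ?W" "cfg b \<in> ?pre (cfg ` S)" by (elim exE conjE)
      have "\<exists>ys. derivation d P f E X ys \<and> c \<in> set ys" if "c \<in> S" for c
        using Suc.IH[of c] S(2) that by blast
      from derivation_finite[OF S(1) this]
      obtain ys where ys: "derivation d P f E X ys" "S \<subseteq> set ys" by blast
      have "justified d P E ys b"
        unfolding justified_iff using S(3) monoD[OF mono_pre image_mono[OF ys(2)]] by blast
      then show ?thesis using ys(1) by (intro exI[of _ "b # ys"]) simp
    qed
  qed simp
  have "\<exists>ys. derivation d P f E X ys \<and> b \<in> set ys" if "b \<in> set X" for b
  proof -
    have "cfg b \<in> att ?pre ?F ?W" using that XW win_unfold[of d "set P" "{f}" "set E"] by blast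
    then show ?thesis using * unfolding att_def by blast
  qed
  then obtain ys where ys: "derivation d P f E X ys" "set X \<subseteq> set ys"
    using derivation_finite[of "set X"] by blast
  have "\<exists>b\<in>set X. fst b = fst c \<and> (\<forall>i<d. entry (snd b) i \<le> entry (snd c) i)"
    using dom[OF win] by auto (metis fst_conv snd_conv)
  then have "win_ok d P f E c (X, ys)" unfolding win_ok_def using ys by auto
  then show ?thesis by blast
qed

section \<open>Strategies and fixpoints\<close>

text \<open>Membership in \<open>G\<close> counts as success at once, even in a deadlock.
  Reachability uses the target set for \<open>G\<close>, repeated reachability the empty
  set.\<close>

definition mpre :: "'c mdp \<Rightarrow> 'c set \<Rightarrow> 'c set \<Rightarrow> 'c set" where
  "mpre M G X = {c \<in> confs M. if c \<in> confs1 M then \<exists>c'\<in>X. (c, c') \<in> edges M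
     else (\<exists>c'. (c, c') \<in> edges M) \<and> (\<forall>c'. (c, c') \<in> edges M \<longrightarrow> c' \<in> X)} \<union> G"

fun visits :: "'c set \<Rightarrow> 'c play \<Rightarrow> bool" where
  "visits G (Fin \<rho>) \<longleftrightarrow> (\<exists>c\<in>set \<rho>. c \<in> G)"
| "visits G (Inf r) \<longleftrightarrow> (\<exists>i. r i \<in> G)"

fun visits_often :: "'c set \<Rightarrow> 'c play \<Rightarrow> bool" where
  "visits_often F (Fin \<rho>) \<longleftrightarrow> False"
| "visits_often F (Inf r) \<longleftrightarrow> (\<exists>\<^sub>\<infinity>i. r i \<in> F)"

definition finitary :: "'c mdp \<Rightarrow> bool" where
  "finitary M \<longleftrightarrow> edges M \<subseteq> confs M \<times> confs M \<and> (\<forall>c. finite {c'. (c, c') \<in> edges M})"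

lemma mono_mpre: "mono (mpre M G)"
  by (rule monoI) (auto simp: mpre_def split: if_splits)

lemma continuous_mpre:
  assumes "finitary M"
  shows "omega_continuous (mpre M G)"
  unfolding omega_continuous_def
proof (intro allI impI subsetI)
  fix A :: "nat \<Rightarrow> 'a set" and c
  assume A: "incseq A" and c: "c \<in> mpre M G (\<Union>n. A n)"
  show "c \<in> (\<Union>n. mpre M G (A n))"
  proof (cases "c \<in> G \<or> c \<in> confs1 M")
    case True
    then show ?thesis using c unfolding mpre_def by auto
  next
    case False
    let ?S = "{c'. (c, c') \<in> edges M}"
    have fin: "finite ?S" using assms unfolding finitary_def by blast
    have ex: "c \<in> confs M" "\<exists>c'. (c, c') \<in> edges M" and all: "\<forall>c'\<in>?S. \<exists>n. c' \<in> A n"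
      using c False unfolding mpre_def by auto
    from bchoice[OF all] obtain N where N: "\<forall>c'\<in>?S. c' \<in> A (N c')" ..
    have "c' \<in> A (Max (N ` ?S))" if "c' \<in> ?S" for c'
    proof -
      have "N c' \<le> Max (N ` ?S)" using fin that by simp
      then show ?thesis using N that incseqD[OF A] by blast
    qed
    then have "c \<in> mpre M G (A (Max (N ` ?S)))" unfolding mpre_def using False ex by simp
    then show ?thesis by blast
  qed
qed

text \<open>The strategy is positional: it stays in the winning set and, outside \<open>F\<close>,
  lowers the rank. An infinite play that avoids \<open>G\<close> must therefore return to
  \<open>F\<close> again and again, and no play that avoids \<open>G\<close> ends in a
  deadlock.\<close>

lemma strategy_of_buchi:
  assumes fin: "finitary M" and G: "G \<subseteq> F" and c0: "c0 \<in> buchi (mpre M G) F"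
  shows "\<exists>\<sigma>. strategy M \<sigma> \<and> (\<forall>\<pi>\<in>Outcome M c0 \<sigma>. visits G \<pi> \<or> visits_often F \<pi>)"
proof -
  let ?W = "buchi (mpre M G) F" and ?attn = "\<lambda>n. attn (mpre M G) F n (buchi (mpre M G) F)"
  define rank where "rank c = (LEAST n. c \<in> ?attn n)" for c
  define good where "good c c' \<longleftrightarrow> (c \<in> ?W \<and> c \<notin> G \<longrightarrow> c' \<in> ?W \<and> (c \<notin> F \<longrightarrow> rank c' < rank c))" for c c'
  have rank: "c \<in> ?attn (rank c)" if "c \<in> ?W" for c
  proof -
    have "\<exists>n. c \<in> ?attn n" using that buchi_unfold[OF mono_mpre, of M G F] unfolding att_def by blast
    then show ?thesis unfolding rank_def by (rule LeastI_ex)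
  qed
  have rank_le: "rank c \<le> n" if "c \<in> ?attn n" for c n
    unfolding rank_def by (rule Least_le) (rule that)
  have W_pre: "c \<in> mpre M G ?W" if "c \<in> ?W" for c
    by (rule subsetD[OF attn_buchi_pre[OF mono_mpre] rank[OF that]])
  have succ: "\<exists>Y\<subseteq>{c'. good c c'}. c \<in> mpre M G Y" if c: "c \<in> ?W" for c
  proof (cases "c \<in> F")
    case True
    then show ?thesis using W_pre[OF c] unfolding good_def by (intro exI[of _ ?W]) auto
  next
    case False
    obtain m where m: "rank c = Suc m" using rank[OF c] by (cases "rank c") auto
    then have "c \<in> mpre M G (?attn m)" using rank[OF c] False by simp
    moreover have "c' \<in> ?W \<and> rank c' < rank c" if "c' \<in> ?attn m" for c'
      using attn_buchi_subset[OF mono_mpre, of M G F m] rank_le[OF that] that m by auto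
    then have "?attn m \<subseteq> {c'. good c c'}" unfolding good_def by blast
    ultimately show ?thesis by blast
  qed
  have ex1: "\<exists>c'. (c, c') \<in> edges M \<and> good c c'" if "c \<in> confs1 M" "\<not> deadlock M c" for c
  proof (cases "c \<in> ?W \<and> c \<notin> G")
    case True
    then obtain Y where Y: "Y \<subseteq> {c'. good c c'}" "c \<in> mpre M G Y" using succ by blast
    then have "\<exists>c'\<in>Y. (c, c') \<in> edges M" using True that(1) unfolding mpre_def by auto
    then show ?thesis using Y(1) by blast
  next
    case False
    then show ?thesis using that(2) unfolding good_def deadlock_def by blast
  qed
  have allP: "good c c'" if "c \<notin> confs1 M" "(c, c') \<in> edges M" for c c'
  proof (cases "c \<in> ?W \<and> c \<notin> G")
    case True
    then obtain Y where Y: "Y \<subseteq> {c'. good c c'}" "c \<in> mpre M G Y" using succ by blast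
    then have "c' \<in> Y" using True that unfolding mpre_def by auto
    then show ?thesis using Y(1) by blast
  next
    case False
    then show ?thesis unfolding good_def by blast
  qed
  define \<sigma> where "\<sigma> \<rho> = (SOME c'. (last \<rho>, c') \<in> edges M \<and> good (last \<rho>) c')" for \<rho>
  have \<sigma>: "(last \<rho>, \<sigma> \<rho>) \<in> edges M \<and> good (last \<rho>) (\<sigma> \<rho>)"
    if "last \<rho> \<in> confs1 M" "\<not> deadlock M (last \<rho>)" for \<rho>
    unfolding \<sigma>_def by (rule someI_ex) (rule ex1[OF that])
  have "strategy M \<sigma>" unfolding strategy_def using \<sigma> by blast
  moreover have "visits G \<pi> \<or> visits_often F \<pi>" if \<pi>: "\<pi> \<in> Outcome M c0 \<sigma>" for \<pi>
  proof (cases \<pi>)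
    case (Fin \<rho>)
    have \<rho>: "finite_play M \<rho>" "hd \<rho> = c0" "deadlock M (last \<rho>)" "consistent M \<sigma> (Fin \<rho>)"
      using \<pi> unfolding Outcome_def maximal_plays_from_def Fin by auto
    have ne: "\<rho> \<noteq> []" using \<rho>(1) unfolding finite_play_def by simp
    have "visits G (Fin \<rho>)"
    proof (rule ccontr)
      assume nv: "\<not> visits G (Fin \<rho>)"
      have W: "i < length \<rho> \<Longrightarrow> \<rho> ! i \<in> ?W" for i
      proof (induction i)
        case 0
        then show ?case using \<rho>(2) c0 ne by (simp add: hd_conv_nth)
      next
        case (Suc i)
        have e: "(\<rho> ! i, \<rho> ! Suc i) \<in> edges M" using \<rho>(1) Suc.prems unfolding finite_play_def by blast
        have "good (\<rho> ! i) (\<rho> ! Suc i)"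
        proof (cases "\<rho> ! i \<in> confs1 M")
          case True
          have l: "last (take (Suc i) \<rho>) = \<rho> ! i" using Suc.prems by (simp add: take_Suc_conv_app_nth)
          have "\<rho> ! Suc i = \<sigma> (take (Suc i) \<rho>)" using \<rho>(4) Suc.prems True by simp
          moreover have "\<not> deadlock M (\<rho> ! i)" using e unfolding deadlock_def by blast
          ultimately show ?thesis using \<sigma>[of "take (Suc i) \<rho>"] True unfolding l by simp
        next
          case False
          then show ?thesis using allP e by blast
        qed
        moreover have "\<rho> ! i \<notin> G" using nv Suc.prems by simp
        ultimately show ?case using Suc unfolding good_def by simp
      qed
      have l: "last \<rho> = \<rho> ! (length \<rho> - 1)" using ne by (rule last_conv_nth)
      have "last \<rho> \<in> ?W" using W[of "length \<rho> - 1"] ne unfolding l by simp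
      then have "last \<rho> \<in> mpre M G ?W" by (rule W_pre)
      moreover have "last \<rho> \<notin> G" using nv ne by simp
      ultimately show False using \<rho>(3) unfolding mpre_def deadlock_def by (auto split: if_splits)
    qed
    then show ?thesis using Fin by simp
  next
    case (Inf r)
    have r: "infinite_play M r" "r 0 = c0" "consistent M \<sigma> (Inf r)"
      using \<pi> unfolding Outcome_def maximal_plays_from_def Inf by auto
    have "visits_often F (Inf r)" if nv: "\<not> visits G (Inf r)"
    proof -
      have good: "good (r i) (r (Suc i))" for i
      proof -
        have e: "(r i, r (Suc i)) \<in> edges M" using r(1) unfolding infinite_play_def by blast
        show ?thesis
        proof (cases "r i \<in> confs1 M")
          case True
          have l: "last (map r [0..<Suc i]) = r i" by simp
          have "r (Suc i) = \<sigma> (map r [0..<Suc i])" using r(3) True by simp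
          moreover have "\<not> deadlock M (r i)" using e unfolding deadlock_def by blast
          ultimately show ?thesis using \<sigma>[of "map r [0..<Suc i]"] True unfolding l by simp
        next
          case False
          then show ?thesis using allP e by blast
        qed
      qed
      have W: "r i \<in> ?W" for i
      proof (induction i)
        case 0
        then show ?case using r(2) c0 by simp
      next
        case (Suc i)
        then show ?case using good[of i] nv unfolding good_def by simp
      qed
      have "\<exists>j\<ge>i. r j \<in> F" for i
      proof (induction "rank (r i)" arbitrary: i rule: less_induct)
        case less
        show ?case
        proof (cases "r i \<in> F")
          case False
          then have "rank (r (Suc i)) < rank (r i)" using good[of i] W[of i] nv unfolding good_def by simp
          then obtain j where "j \<ge> Suc i" "r j \<in> F" using less by blast
          then show ?thesis by (intro exI[of _ j]) simp
        qed blast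
      qed
      then show ?thesis by (simp add: INFM_nat_le)
    qed
    then show ?thesis using Inf by blast
  qed
  ultimately show ?thesis by blast
qed

text \<open>The ends of the \<open>G\<close>-avoiding histories consistent with the strategy,
  together with \<open>G\<close>, lie in their own attractor. Otherwise some history could be
  prolonged for ever outside the attractor, hence without visiting \<open>G\<close> or returning to
  \<open>F\<close>, and its limit would be an outcome that violates the objective.\<close>

lemma buchi_of_strategy:
  assumes fin: "finitary M" and G: "G \<subseteq> F" and c0: "c0 \<in> confs M"
    and \<sigma>: "strategy M \<sigma>" "\<And>\<pi>. \<pi> \<in> Outcome M c0 \<sigma> \<Longrightarrow> visits G \<pi> \<or> visits_often F \<pi>"
  shows "c0 \<in> buchi (mpre M G) F"
proof -
  define H where "H = {h. finite_play M h \<and> hd h = c0 \<and> consistent M \<sigma> (Fin h) \<and> (\<forall>c\<in>set h. c \<notin> G)}"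
  define X where "X = last ` H \<union> G"
  let ?A = "att (mpre M G) F X"
  have preA: "mpre M G ?A \<subseteq> ?A" by (rule pre_att[OF mono_mpre continuous_mpre[OF fin]])
  have GA: "G \<subseteq> ?A"
    using G attn_subset_att[of "mpre M G" F "Suc 0" X] by (auto simp: mpre_def)
  have FA: "F \<inter> mpre M G X \<subseteq> ?A"
    using attn_subset_att[of "mpre M G" F "Suc 0" X] by auto
  have ext: "h @ [c] \<in> H" if h: "h \<in> H" and e: "(last h, c) \<in> edges M" and c: "c \<notin> G"
    and s: "last h \<in> confs1 M \<Longrightarrow> c = \<sigma> h" for h c
  proof -
    have h': "finite_play M h" "hd h = c0" "consistent M \<sigma> (Fin h)" "\<forall>c\<in>set h. c \<notin> G" "h \<noteq> []"
      using h unfolding H_def finite_play_def by auto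
    have l: "h ! (length h - 1) = last h" using h'(5) by (simp add: last_conv_nth)
    have "((h @ [c]) ! i, (h @ [c]) ! Suc i) \<in> edges M" if "Suc i < length (h @ [c])" for i
    proof (cases "Suc i < length h")
      case True
      then show ?thesis using h'(1) unfolding finite_play_def by (simp add: nth_append)
    next
      case False
      then have "i = length h - 1" "Suc i = length h" using that h'(5) by auto
      then show ?thesis using e l h'(5) by (simp add: nth_append)
    qed
    then have "finite_play M (h @ [c])"
      using h'(1) e fin unfolding finite_play_def finitary_def by auto
    moreover have "(h @ [c]) ! Suc i = \<sigma> (take (Suc i) (h @ [c]))"
      if i: "Suc i < length (h @ [c])" "(h @ [c]) ! i \<in> confs1 M" for i
    proof (cases "Suc i < length h")
      case True
      then show ?thesis using h'(3) i(2) by (simp add: nth_append)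
    next
      case False
      then have "i = length h - 1" "Suc i = length h" using i h'(5) by auto
      then show ?thesis using s l h'(5) i(2) by (simp add: nth_append)
    qed
    then have "consistent M \<sigma> (Fin (h @ [c]))" by simp
    ultimately show ?thesis using h' c unfolding H_def by simp
  qed
  have hist: "last h \<in> confs M \<and> finite_play M h" if "h \<in> H" for h
    using that last_in_set unfolding H_def finite_play_def by blast
  have in_pre: "last h \<in> mpre M G X" if h: "h \<in> H" and nd: "\<not> deadlock M (last h)" for h
  proof (cases "last h \<in> confs1 M")
    case True
    then have e: "(last h, \<sigma> h) \<in> edges M" using \<sigma>(1) hist[OF h] nd unfolding strategy_def by blast
    then have "\<sigma> h \<in> X" using ext[OF h e] unfolding X_def by (cases "\<sigma> h \<in> G") (auto simp: image_iff intro: bexI[of _ "h @ [\<sigma> h]"])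
    then show ?thesis using e True hist[OF h] unfolding mpre_def by auto
  next
    case False
    have "c \<in> X" if "(last h, c) \<in> edges M" for c
      using ext[OF h that] False unfolding X_def by (cases "c \<in> G") (auto simp: image_iff intro: bexI[of _ "h @ [c]"])
    then show ?thesis using nd False hist[OF h] unfolding mpre_def deadlock_def by auto
  qed
  have main: "last h \<in> ?A" if h: "h \<in> H" for h
  proof (rule ccontr)
    assume bad: "last h \<notin> ?A"
    have next_H: "\<exists>c. h @ [c] \<in> H \<and> c \<notin> ?A" and notF: "last h \<notin> F" if h: "h \<in> H" "last h \<notin> ?A" for h
    proof -
      have nd: "\<not> deadlock M (last h)"
      proof
        assume "deadlock M (last h)"
        then have "Fin h \<in> Outcome M c0 \<sigma>"
          using h(1) unfolding H_def Outcome_def maximal_plays_from_def by auto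
        then show False using \<sigma>(2)[of "Fin h"] h(1) unfolding H_def by auto
      qed
      show "last h \<notin> F" using in_pre[OF h(1) nd] FA h(2) by blast
      have np: "last h \<notin> mpre M G ?A" using preA h(2) by blast
      show "\<exists>c. h @ [c] \<in> H \<and> c \<notin> ?A"
      proof (cases "last h \<in> confs1 M")
        case True
        then have e: "(last h, \<sigma> h) \<in> edges M" using \<sigma>(1) hist[OF h(1)] nd unfolding strategy_def by blast
        then have "\<sigma> h \<notin> ?A" using np True hist[OF h(1)] unfolding mpre_def by auto
        then show ?thesis using ext[OF h(1) e] GA by blast
      next
        case False
        then obtain c where c: "(last h, c) \<in> edges M" "c \<notin> ?A"
          using np nd hist[OF h(1)] unfolding mpre_def deadlock_def by auto
        then show ?thesis using ext[OF h(1) c(1)] GA False by blast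
      qed
    qed
    have "\<exists>f. \<forall>n. (f n \<in> H \<and> last (f n) \<notin> ?A \<and> length (f n) = length h + n) \<and> (\<exists>c. f (Suc n) = f n @ [c])"
    proof (rule dependent_nat_choice)
      show "\<exists>x. x \<in> H \<and> last x \<notin> ?A \<and> length x = length h + 0" using h bad by auto
      fix x n assume x: "x \<in> H \<and> last x \<notin> ?A \<and> length x = length h + n"
      then obtain c where "x @ [c] \<in> H" "c \<notin> ?A" using next_H by blast
      then show "\<exists>y. (y \<in> H \<and> last y \<notin> ?A \<and> length y = length h + Suc n) \<and> (\<exists>c. y = x @ [c])"
        using x by (intro exI[of _ "x @ [c]"]) auto
    qed
    then obtain f where f: "\<And>n. f n \<in> H" "\<And>n. last (f n) \<notin> ?A" "\<And>n. length (f n) = length h + n"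
      "\<And>n. \<exists>c. f (Suc n) = f n @ [c]" by blast
    have hne: "h \<noteq> []" using hist[OF h] unfolding finite_play_def by blast
    \<comment> \<open>The histories \<open>f i\<close> extend one another and \<open>f i\<close> is
      longer than \<open>i\<close>; their limit is read off the diagonal.\<close>
    define r where "r i = f i ! i" for i
    have nth: "f n ! i = f m ! i" if "i < length (f m)" "m \<le> n" for i m n
      using that(2)
    proof (induction rule: dec_induct)
      case (step n)
      obtain c where "f (Suc n) = f n @ [c]" using f(4) by blast
      moreover have "i < length (f n)" using that(1) step(1) unfolding f(3) by simp
      ultimately show ?case using step by (simp add: nth_append)
    qed simp
    have r: "f n ! i = r i" if "i < length (f n)" for n i
    proof -
      have "i < length (f i)" using hne unfolding f(3) by simp
      note li = this
      show ?thesis unfolding r_def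
      proof (cases "i \<le> n")
        case True
        show "f n ! i = f i ! i" by (rule nth[OF li True])
      next
        case False
        then have "n \<le> i" by simp
        show "f n ! i = f i ! i" by (rule nth[OF that \<open>n \<le> i\<close>, symmetric])
      qed
    qed
    have len: "i < length (f i)" "Suc i < length (f (Suc i))" for i using hne unfolding f(3) by auto
    have fp: "finite_play M (f n)" "hd (f n) = c0" "consistent M \<sigma> (Fin (f n))" "\<forall>c\<in>set (f n). c \<notin> G" for n
      using f(1)[of n] unfolding H_def by auto
    have edge: "(r i, r (Suc i)) \<in> edges M" for i
      using fp(1)[of "Suc i"] len[of i] r[of i "Suc i"] r[of "Suc i" "Suc i"]
      unfolding finite_play_def by (metis Suc_lessD)
    have "r i \<in> confs M" for i
      using edge[of i] fin unfolding finitary_def by blast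
    then have play: "infinite_play M r" unfolding infinite_play_def using edge by blast
    have r0: "r 0 = c0" using fp(2)[of 0] len(1)[of 0] unfolding r_def by (simp add: hd_conv_nth)
    have "r (Suc i) = \<sigma> (map r [0..<Suc i])" if "r i \<in> confs1 M" for i
    proof -
      have "take (Suc i) (f (Suc i)) = map r [0..<Suc i]"
        by (rule nth_equalityI) (use len(2)[of i] r[of _ "Suc i"] in \<open>auto simp del: upt_Suc\<close>)
      moreover have "f (Suc i) ! i = r i" "f (Suc i) ! Suc i = r (Suc i)" using r[of _ "Suc i"] len(2)[of i] by auto
      ultimately show ?thesis using fp(3)[of "Suc i"] len(2)[of i] that unfolding consistent.simps by metis
    qed
    then have "Inf r \<in> Outcome M c0 \<sigma>"
      unfolding Outcome_def maximal_plays_from_def using play r0 by auto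
    moreover have "r i \<notin> G" for i using fp(4)[of i] len(1)[of i] unfolding r_def by simp
    ultimately have "\<exists>\<^sub>\<infinity>i. r i \<in> F" using \<sigma>(2)[of "Inf r"] by auto
    \<comment> \<open>Positions beyond \<open>h\<close> are ends of the histories
      \<open>f n\<close>, hence outside \<open>F\<close>; the history ending at position
      \<open>j\<close> is the one of length \<open>Suc j\<close>.\<close>
    then obtain j where j: "j \<ge> length h" "r j \<in> F" unfolding INFM_nat_le by blast
    let ?n = "Suc j - length h"
    have "length (f ?n) = Suc j" unfolding f(3) using j(1) by simp
    then have "last (f ?n) = r j" using r[of j ?n] by (metis diff_Suc_1 last_conv_nth lessI list.size(3) nat.distinct(1))
    then show False using notF[OF f(1,2)[of ?n]] j(2) by simp
  qed
  have "X \<subseteq> ?A" unfolding X_def using main GA unfolding X_def by blast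
  then have "X \<subseteq> buchi (mpre M G) F" by (rule buchi_coinduct)
  moreover have "c0 \<in> X"
  proof (cases "c0 \<in> G")
    case False
    then have "[c0] \<in> H" unfolding H_def finite_play_def using c0 by simp
    then show ?thesis unfolding X_def by force
  qed (simp add: X_def)
  ultimately show ?thesis by blast
qed

section \<open>The two objectives as conditions on visits\<close>

lemma Outcome_plays: "Outcome M c \<sigma> \<subseteq> plays M"
  unfolding Outcome_def maximal_plays_from_def plays_def by auto

lemma reach_iff: "\<pi> \<in> plays (induced_mdp S) \<Longrightarrow>
    \<pi> \<in> reach S f \<longleftrightarrow> visits {c. fst c = f} \<pi> \<or> visits_often {c. fst c = f} \<pi>"
proof (cases \<pi>)
  case (Inf r)
  assume "\<pi> \<in> plays (induced_mdp S)"
  then have "\<pi> \<in> reach S f \<longleftrightarrow> (\<exists>i. fst (r i) = f)" unfolding Inf reach_def by auto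
  then show ?thesis unfolding Inf by (auto simp: INFM_nat_le)
qed (auto simp: reach_def)

lemma repeated_reach_iff: "\<pi> \<in> plays (induced_mdp S) \<Longrightarrow>
    \<pi> \<in> repeated_reach S f \<longleftrightarrow> visits {} \<pi> \<or> visits_often {c. fst c = f} \<pi>"
  by (cases \<pi>) (auto simp: repeated_reach_def)

section \<open>The game of a VASS-MDP\<close>

lemma edges_induced:
  assumes "vass_mdp S" "c \<in> confs (induced_mdp S)"
  shows "(c, c') \<in> edges (induced_mdp S) \<longleftrightarrow> length (snd c') = dim S \<and>
    (\<exists>z. (fst c, z, fst c') \<in> transitions S \<and>
      (\<forall>i<dim S. int (entry (snd c') i) = int (entry (snd c) i) + coord z i))"
proof -
  obtain q v q' w where c: "c = (q, v)" "c' = (q', w)" by (cases c, cases c') auto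
  have v: "q \<in> states S" "length v = dim S" using assms(2) unfolding c induced_mdp_def by auto
  have z: "length z = dim S" if "(q, z, q') \<in> transitions S" for z
    using assms(1) that unfolding vass_mdp_def by blast
  have eq: "map int w = add_vec v z \<longleftrightarrow>
      length w = dim S \<and> (\<forall>i<dim S. int (entry w i) = int (entry v i) + coord z i)"
    if "length z = dim S" for z
    using v(2) that unfolding add_vec_def list_eq_iff_nth_eq by (auto simp: nth_default_def)
  have "(c, c') \<in> edges (induced_mdp S) \<longleftrightarrow>
      (\<exists>z. (q, z, q') \<in> transitions S \<and> (\<forall>x\<in>set (add_vec v z). 0 \<le> x) \<and> map int w = add_vec v z)"
    unfolding c induced_mdp_def enabled_def leads_to_def using v by auto
  \<comment> \<open>Enabledness is implied: the entries of \<open>w\<close> are natural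
    numbers.\<close>
  also have "\<dots> \<longleftrightarrow> (\<exists>z. (q, z, q') \<in> transitions S \<and> map int w = add_vec v z)"
    by (metis (no_types, lifting) ex_map_conv of_nat_0_le_iff)
  also have "\<dots> \<longleftrightarrow> length w = dim S \<and> (\<exists>z. (q, z, q') \<in> transitions S \<and>
      (\<forall>i<dim S. int (entry w i) = int (entry v i) + coord z i))"
    using eq z by blast
  finally show ?thesis unfolding c by simp
qed

lemma confs_induced:
  "c \<in> confs (induced_mdp S) \<longleftrightarrow> fst c \<in> states S \<and> length (snd c) = dim S"
  "c \<in> confs1 (induced_mdp S) \<longleftrightarrow> fst c \<in> states1 S \<and> length (snd c) = dim S"
  by (cases c; auto simp: induced_mdp_def)+

lemma finitary_induced:
  assumes "vass_mdp S"
  shows "finitary (induced_mdp S)"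
  unfolding finitary_def
proof (intro conjI allI)
  let ?M = "induced_mdp S"
  show sub: "edges ?M \<subseteq> confs ?M \<times> confs ?M"
  proof (rule subrelI)
    fix c c' assume e: "(c, c') \<in> edges ?M"
    then have c: "c \<in> confs ?M" unfolding induced_mdp_def by auto
    from e[unfolded edges_induced[OF assms c]] have "fst c' \<in> states S" "length (snd c') = dim S"
      using assms unfolding vass_mdp_def by auto
    then show "(c, c') \<in> confs ?M \<times> confs ?M" using c by (simp add: confs_induced)
  qed
  fix c
  show "finite {c'. (c, c') \<in> edges ?M}"
  proof (cases "c \<in> confs ?M")
    case True
    have "{c'. (c, c') \<in> edges ?M} \<subseteq>
        (\<lambda>t. (snd (snd t), map (\<lambda>i. nat (int (entry (snd c) i) + coord (fst (snd t)) i)) [0..<dim S])) ` transitions S"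
    proof
      fix c' assume "c' \<in> {c'. (c, c') \<in> edges ?M}"
      then obtain z where z: "length (snd c') = dim S" "(fst c, z, fst c') \<in> transitions S"
        "\<forall>i<dim S. int (entry (snd c') i) = int (entry (snd c) i) + coord z i"
        using edges_induced[OF assms True] by blast
      have "snd c' = map (\<lambda>i. nat (int (entry (snd c) i) + coord z i)) [0..<dim S]"
        by (rule nth_equalityI) (use z in \<open>auto simp: nth_default_def\<close>)
      then show "c' \<in> (\<lambda>t. (snd (snd t), map (\<lambda>i. nat (int (entry (snd c) i) + coord (fst (snd t)) i)) [0..<dim S])) ` transitions S"
        using z(2) by (intro image_eqI[of _ _ "(fst c, z, fst c')"]) (auto simp: prod_eq_iff)
    qed
    moreover have "finite (transitions S)" using assms unfolding vass_mdp_def by blast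
    ultimately show ?thesis using finite_subset by blast
  next
    case False
    then have "{c'. (c, c') \<in> edges ?M} = {}" using sub by blast
    then show ?thesis by (simp only: finite.emptyI)
  qed
qed

text \<open>The loop also rescues a target without outgoing edges, as reachability demands.\<close>

definition absorbing :: "nat \<Rightarrow> 'v \<Rightarrow> 'v edge set \<Rightarrow> 'v edge set" where
  "absorbing d f E = insert (f, replicate d 0, f) {e \<in> E. src e \<noteq> f}"

lemma coord_zeros [simp]: "coord (replicate d 0) i = 0"
  by (simp add: nth_default_def)

lemma win_absorbing:
  assumes "finite E"
  shows "(f, x) \<in> win d P {f} (absorbing d f E)"
proof -
  let ?E = "absorbing d f E"
  have "{f} \<times> UNIV \<subseteq> win d P {f} ?E"
    unfolding win_def
  proof (rule buchi_coinduct, rule subsetI)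
    fix c :: "'a \<times> (nat \<Rightarrow> nat)" assume c: "c \<in> {f} \<times> UNIV"
    then have "c \<in> pre d P ?E ({f} \<times> UNIV)"
      unfolding pre_def absorbing_def fires_def by (auto intro: exI[of _ "snd c"])
    then show "c \<in> att (pre d P ?E) ({f} \<times> UNIV) ({f} \<times> UNIV)"
      using c attn_subset_att[of "pre d P ?E" "{f} \<times> UNIV" "Suc 0"] by auto
  qed
  then show ?thesis by blast
qed

text \<open>Reachability (\<open>b\<close>) is repeated reachability in the game where the target is absorbing.\<close>

lemma buchi_induced_iff_win:
  fixes f :: 'q and b :: bool
  assumes S: "one_vass_mdp S" and c: "c \<in> confs (induced_mdp S)"
  defines "E \<equiv> (if b then absorbing (dim S) f (transitions S) else transitions S)"
    and "F \<equiv> {c :: 'q conf. fst c = f}"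
  shows "c \<in> buchi (mpre (induced_mdp S) (if b then F else {})) F \<longleftrightarrow>
    cfg c \<in> win (dim S) (statesP S) {f} E"
proof -
  let ?M = "induced_mdp S" and ?d = "dim S" and ?P = "statesP S" and ?G = "if b then F else {}"
  have vass: "vass_mdp S" using S unfolding one_vass_mdp_def by blast
  have zeroP: "coord z i = 0" if "(q, z, q') \<in> transitions S" "q \<in> statesP S" for q z q' i
  proof -
    have "z = replicate ?d 0" using S that unfolding one_vass_mdp_def by blast
    then show ?thesis by simp
  qed
  have finE: "finite E" using vass unfolding E_def absorbing_def vass_mdp_def by simp
  have same: "(s, z, t) \<in> E \<longleftrightarrow> (s, z, t) \<in> transitions S" if "\<not> (b \<and> s = f)" for s z t
    using that unfolding E_def absorbing_def by auto
  have owner: "c \<in> confs1 ?M \<longleftrightarrow> fst c \<notin> ?P" if "c \<in> confs ?M" for c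
    using that vass unfolding confs_induced vass_mdp_def states_def by blast
  have succ: "c' \<in> confs ?M" if "(c, c') \<in> edges ?M" for c c'
    using that finitary_induced[OF vass] unfolding finitary_def by blast
  show ?thesis
  proof
    define R where "R a b \<longleftrightarrow> a \<in> confs ?M \<and> fst b = fst a \<and> (\<forall>i<?d. snd b i = entry (snd a) i)"
      for a :: "'q conf" and b :: "'q \<times> (nat \<Rightarrow> nat)"
    assume s1: "c \<in> buchi (mpre ?M ?G) F"
    have s2: "R c (cfg c)" unfolding R_def using c by simp
    have s3: "bb \<in> {f} \<times> UNIV" if "R a bb" "a \<in> F" for a bb
      using that unfolding R_def F_def by (simp add: mem_Times_iff)
    have s4: "bb \<in> pre ?d ?P E ({b. \<exists>a\<in>X. R a b} \<union> buchi (pre ?d ?P E) ({f} \<times> UNIV))"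
      if R: "R a bb" and a: "a \<in> mpre ?M ?G X" for a bb X
    proof (cases "b \<and> fst a = f")
      case True
      obtain x where bb: "bb = (f, x)" using R True unfolding R_def by (cases bb) auto
      \<comment> \<open>\<open>mpre\<close> admits \<open>G\<close> without any move, so there is
        nothing to simulate here; the absorbing loop wins instead.\<close>
      have W: "(f, y) \<in> buchi (pre ?d ?P E) ({f} \<times> UNIV)" for y
        using win_absorbing[of "transitions S" f y ?d ?P] vass True
        unfolding win_def E_def vass_mdp_def by simp
      then have "bb \<in> buchi (pre ?d ?P E) ({f} \<times> UNIV)" unfolding bb by blast
      then have "bb \<in> pre ?d ?P E (buchi (pre ?d ?P E) ({f} \<times> UNIV))"
        using attn_buchi_pre[OF mono_pre] buchi_unfold[OF mono_pre] unfolding att_def by blast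
      then show ?thesis using monoD[OF mono_pre, of _ "_ \<union> buchi (pre ?d ?P E) ({f} \<times> UNIV)"] by blast
    next
      case False
      obtain s x where bb: "bb = (s, x)" by fastforce
      have a': "a \<in> confs ?M" "s = fst a" "\<And>i. i < ?d \<Longrightarrow> x i = entry (snd a) i"
        using R unfolding R_def bb by auto
      let ?Y = "{b. \<exists>a\<in>X. R a b} \<union> buchi (pre ?d ?P E) ({f} \<times> UNIV)"
      have nG: "a \<notin> ?G" using False unfolding F_def by auto
      show ?thesis
      proof (cases "s \<in> ?P")
        case True
        then have n1: "a \<notin> confs1 ?M" using owner[OF a'(1)] a'(2) by simp
        have ex: "\<exists>a'. (a, a') \<in> edges ?M" and all: "\<And>a'. (a, a') \<in> edges ?M \<Longrightarrow> a' \<in> X"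
          using a nG n1 unfolding mpre_def by auto
        show ?thesis unfolding bb pre_P[OF True]
        proof (intro conjI allI impI)
          show "\<exists>z t. (s, z, t) \<in> E"
            using ex same False unfolding edges_induced[OF vass a'(1)] a'(2) by blast
          fix z t assume "(s, z, t) \<in> E"
          then have t: "(s, z, t) \<in> transitions S" using same False a'(2) by blast
          \<comment> \<open>An opponent transition changes no counter, so it is enabled and leads to
            the same vector.\<close>
          have e: "(a, (t, snd a)) \<in> edges ?M"
            unfolding edges_induced[OF vass a'(1)]
            using t zeroP[OF t True] a'(1,2) by (auto simp: confs_induced)
          have "R (t, snd a) (t, x)" unfolding R_def using succ[OF e] a'(3) by simp
          moreover have "fires ?d x z x" unfolding fires_def using zeroP[OF t True] by simp
          ultimately show "\<exists>x'. fires ?d x z x' \<and> (t, x') \<in> ?Y" using all[OF e] by blast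
        qed
      next
        case nP: False
        then have "a \<in> confs1 ?M" using owner[OF a'(1)] a'(2) by simp
        then obtain a1 where a1: "a1 \<in> X" "(a, a1) \<in> edges ?M" using a nG unfolding mpre_def by auto
        then obtain z where z: "(s, z, fst a1) \<in> transitions S"
          "\<forall>i<?d. int (entry (snd a1) i) = int (entry (snd a) i) + coord z i"
          unfolding edges_induced[OF vass a'(1)] a'(2) by blast
        have "fires ?d x z (entry (snd a1))" unfolding fires_def using z(2) a'(3) by simp
        moreover have "R a1 (cfg a1)" unfolding R_def using succ[OF a1(2)] by simp
        moreover have "(s, z, fst a1) \<in> E" using z(1) same False a'(2) by blast
        ultimately show ?thesis unfolding bb pre_1[OF nP] using a1(1) by blast
      qed
    qed
    show "cfg c \<in> win ?d ?P {f} E"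
      unfolding win_def
    proof (rule buchi_sim_upto[where R = R, OF _ _ mono_mpre mono_pre continuous_pre[OF finE] s2 s1])
      show "bb \<in> {f} \<times> UNIV" if "R a bb" "a \<in> F" for a bb using that by (rule s3)
      show "bb \<in> pre ?d ?P E ({b. \<exists>a\<in>X. R a b} \<union> buchi (pre ?d ?P E) ({f} \<times> UNIV))"
        if "R a bb" "X \<subseteq> buchi (mpre ?M ?G) F" "a \<in> mpre ?M ?G X" for a bb X
        using that(1,3) by (rule s4)
    qed
  next
    \<comment> \<open>In this direction the relation is an inequality, because the game may lower
      counters while the MDP cannot.\<close>
    define R where "R b a \<longleftrightarrow> a \<in> confs ?M \<and> fst b = fst a \<and> (\<forall>i<?d. snd b i \<le> entry (snd a) i)"
      for a :: "'q conf" and b :: "'q \<times> (nat \<Rightarrow> nat)"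
    assume "cfg c \<in> win ?d ?P {f} E"
    then have s1: "cfg c \<in> buchi (pre ?d ?P E) ({f} \<times> UNIV)" unfolding win_def .
    have s2: "R (cfg c) c" unfolding R_def using c by simp
    have s3: "a \<in> F" if "R bb a" "bb \<in> {f} \<times> UNIV" for a bb
      using that unfolding R_def F_def by (simp add: mem_Times_iff)
    have s4: "a \<in> mpre ?M ?G {a. \<exists>b\<in>X. R b a}" if R: "R bb a" and pre: "bb \<in> pre ?d ?P E X" for a bb X
    proof (cases "b \<and> fst a = f")
      case True
      then show ?thesis unfolding mpre_def F_def by simp
    next
      case False
      obtain s x where bb: "bb = (s, x)" by fastforce
      have a': "a \<in> confs ?M" "s = fst a" "\<And>i. i < ?d \<Longrightarrow> x i \<le> entry (snd a) i"
        using R unfolding R_def bb by auto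
      have ns: "\<not> (b \<and> s = f)" using False a'(2) by simp
      show ?thesis
      proof (cases "s \<in> ?P")
        case True
        note pre' = pre[unfolded bb pre_P[OF True]]
        have n1: "a \<notin> confs1 ?M" using owner[OF a'(1)] a'(2) True by simp
        obtain z t where t: "(s, z, t) \<in> transitions S" using pre' same[OF ns] by blast
        have e: "(a, (t, snd a)) \<in> edges ?M"
          unfolding edges_induced[OF vass a'(1)]
          using t zeroP[OF t True] a'(1,2) by (auto simp: confs_induced)
        have "\<exists>b\<in>X. R b a1" if a1: "(a, a1) \<in> edges ?M" for a1
        proof -
          obtain z where z: "(s, z, fst a1) \<in> transitions S"
            "\<forall>i<?d. int (entry (snd a1) i) = int (entry (snd a) i) + coord z i"
            using a1 unfolding edges_induced[OF vass a'(1)] a'(2) by blast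
          then obtain x' where x': "fires ?d x z x'" "(fst a1, x') \<in> X" using pre' same[OF ns] by blast
          have "x' i \<le> entry (snd a1) i" if "i < ?d" for i
            using z(2) x'(1) a'(3)[OF that] that unfolding fires_def by fastforce
          then have "R (fst a1, x') a1" unfolding R_def using succ[OF a1] by simp
          then show ?thesis using x'(2) by blast
        qed
        then show ?thesis unfolding mpre_def using n1 e a'(1) by auto
      next
        case nP: False
        from pre[unfolded bb pre_1[OF nP]] obtain z t x' where
          t: "(s, z, t) \<in> transitions S" "fires ?d x z x'" "(t, x') \<in> X" using same[OF ns] by blast
        define w where "w = map (\<lambda>i. nat (int (entry (snd a) i) + coord z i)) [0..<?d]"
        have w: "int (entry w i) = int (entry (snd a) i) + coord z i" "x' i \<le> entry w i" if "i < ?d" for i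
        proof -
          have "int (x' i) \<le> int (x i) + coord z i" "x i \<le> entry (snd a) i"
            using t(2) a'(3) that unfolding fires_def by auto
          then have "int (x' i) \<le> int (entry (snd a) i) + coord z i" by linarith
          moreover have "entry w i = nat (int (entry (snd a) i) + coord z i)"
            unfolding w_def using that by (simp add: nth_default_def)
          ultimately show "int (entry w i) = int (entry (snd a) i) + coord z i" "x' i \<le> entry w i"
            by linarith+
        qed
        have e: "(a, (t, w)) \<in> edges ?M"
          unfolding edges_induced[OF vass a'(1)] using t(1) w(1) a'(2) by (auto simp: w_def)
        have "R (t, x') (t, w)" unfolding R_def using succ[OF e] w(2) by simp
        moreover have "a \<in> confs1 ?M" using owner[OF a'(1)] a'(2) nP by simp
        ultimately show ?thesis unfolding mpre_def using e t(3) a'(1) by auto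
      qed
    qed
    show "c \<in> buchi (mpre ?M ?G) F"
    proof (rule buchi_sim[where R = R, OF _ _ mono_pre mono_mpre continuous_mpre[OF finitary_induced[OF vass]] s2 s1])
      show "a \<in> F" if "R bb a" "bb \<in> {f} \<times> UNIV" for a bb using that by (rule s3)
      show "a \<in> mpre ?M ?G {a. \<exists>b\<in>X. R b a}" if "R bb a" "bb \<in> pre ?d ?P E X" for a bb X
        using that by (rule s4)
    qed
  qed
qed

section \<open>Sure winning as membership in a winning region\<close>

lemma strategy_iff_buchi:
  assumes "finitary M" "G \<subseteq> F" "c0 \<in> confs M"
  shows "(\<exists>\<sigma>. strategy M \<sigma> \<and> (\<forall>\<pi>\<in>Outcome M c0 \<sigma>. visits G \<pi> \<or> visits_often F \<pi>)) \<longleftrightarrow>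
    c0 \<in> buchi (mpre M G) F"
  using strategy_of_buchi[OF assms(1,2)] buchi_of_strategy[OF assms] by blast

lemma sure_reachable_iff_win:
  assumes S: "one_vass_mdp S" and c: "c \<in> confs (induced_mdp S)"
  shows "sure_reachable S c f \<longleftrightarrow>
    cfg c \<in> win (dim S) (statesP S) {f} (absorbing (dim S) f (transitions S))"
proof -
  have fin: "finitary (induced_mdp S)" using S unfolding one_vass_mdp_def by (blast intro: finitary_induced)
  have "Outcome (induced_mdp S) c \<sigma> \<subseteq> reach S f \<longleftrightarrow>
      (\<forall>\<pi>\<in>Outcome (induced_mdp S) c \<sigma>. visits {c. fst c = f} \<pi> \<or> visits_often {c. fst c = f} \<pi>)" for \<sigma>
    using Outcome_plays[of "induced_mdp S" c \<sigma>] reach_iff[of _ S f] by blast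
  then show ?thesis
    unfolding sure_reachable_def
    using strategy_iff_buchi[OF fin order_refl c, of "{c. fst c = f}"] buchi_induced_iff_win[OF S c, of True f]
    by simp
qed

lemma sure_repeatedly_reachable_iff_win:
  assumes S: "one_vass_mdp S" and c: "c \<in> confs (induced_mdp S)"
  shows "sure_repeatedly_reachable S c f \<longleftrightarrow> cfg c \<in> win (dim S) (statesP S) {f} (transitions S)"
proof -
  have fin: "finitary (induced_mdp S)" using S unfolding one_vass_mdp_def by (blast intro: finitary_induced)
  have "Outcome (induced_mdp S) c \<sigma> \<subseteq> repeated_reach S f \<longleftrightarrow>
      (\<forall>\<pi>\<in>Outcome (induced_mdp S) c \<sigma>. visits {} \<pi> \<or> visits_often {c. fst c = f} \<pi>)" for \<sigma>
    using Outcome_plays[of "induced_mdp S" c \<sigma>] repeated_reach_iff[of _ S f] by blast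
  then show ?thesis
    unfolding sure_repeatedly_reachable_def
    using strategy_iff_buchi[OF fin empty_subsetI c, of "{c. fst c = f}"] buchi_induced_iff_win[OF S c, of False f]
    by simp
qed

section \<open>Checking certificates is computable\<close>

lemma decidable_justified:
  "decidable_pred (\<lambda>x :: nat \<times> 'v::encodable list \<times> 'v edge list \<times> ('v \<times> nat list) list \<times> 'v \<times> nat list.
     justified (fst x) (fst (snd x)) (fst (snd (snd x))) (fst (snd (snd (snd x)))) (snd (snd (snd (snd x)))))"
  unfolding justified_def by (intro comp_intros)

lemma decidable_pred_justified [comp_intros]:
  assumes "computable d" "computable P" "computable E" "computable L" "computable c"
  shows "decidable_pred (\<lambda>x. justified (d x) (P x) (E x) (L x) (c x))"
  using decidable_pred_comp[OF decidable_justified, of "\<lambda>x. (d x, P x, E x, L x, c x)"] assms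
  by (simp add: comp_intros)

text \<open>The recursion becomes a loop from the right end whose state is a flag and the entries
  already processed. The flag is a number because the state has to be of an encodable type.\<close>

lemma derivation_foldl:
  "foldl (\<lambda>a y. (if (fst y = f \<and> justified d P E X y \<or> justified d P E (snd a) y) \<and> fst a = 1 then 1 else 0 :: nat,
      y # snd a)) (1, []) (rev ys) = (if derivation d P f E X ys then 1 else 0, ys)"
  by (induction ys) auto

lemma decidable_derivation:
  "decidable_pred (\<lambda>x :: nat \<times> 'v::encodable list \<times> 'v \<times> 'v edge list \<times> ('v \<times> nat list) list \<times> ('v \<times> nat list) list.
     derivation (fst x) (fst (snd x)) (fst (snd (snd x))) (fst (snd (snd (snd x))))
       (fst (snd (snd (snd (snd x))))) (snd (snd (snd (snd (snd x))))))"
proof -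
  have eq: "derivation d P f E X ys \<longleftrightarrow> fst (foldl (\<lambda>a y. (if (fst y = f \<and> justified d P E X y \<or>
      justified d P E (snd a) y) \<and> fst a = 1 then 1 else 0 :: nat, y # snd a)) (1, []) (rev ys)) = 1"
    for d P f E X and ys :: "('v \<times> nat list) list"
    unfolding derivation_foldl by simp
  show ?thesis unfolding eq by (intro comp_intros)
qed

lemma decidable_pred_derivation [comp_intros]:
  assumes "computable d" "computable P" "computable f" "computable E" "computable X" "computable ys"
  shows "decidable_pred (\<lambda>x. derivation (d x) (P x) (f x) (E x) (X x) (ys x))"
  using decidable_pred_comp[OF decidable_derivation, of "\<lambda>x. (d x, P x, f x, E x, X x, ys x)"] assms
  by (simp add: comp_intros)

lemma decidable_win_ok:
  "decidable_pred (\<lambda>x :: nat \<times> 'v::encodable list \<times> 'v \<times> 'v edge list \<times> ('v \<times> nat list) \<times>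
      ('v \<times> nat list) list \<times> ('v \<times> nat list) list.
     win_ok (fst x) (fst (snd x)) (fst (snd (snd x))) (fst (snd (snd (snd x))))
       (fst (snd (snd (snd (snd x))))) (snd (snd (snd (snd (snd x))))))"
  unfolding win_ok_def by (intro comp_intros)

lemma computable_pot [comp_intros]:
  fixes v :: "'a::encodable \<Rightarrow> 'v::encodable"
  assumes "computable p" "computable v"
  shows "computable (\<lambda>x. pot (p x) (v x))"
proof -
  have "computable (\<lambda>x :: ('v \<times> int) list \<times> 'v. pot (fst x) (snd x))"
    unfolding pot_def by (intro comp_intros)
  then show ?thesis using assms by (rule computable2)
qed

lemma decidable_step_ok:
  "decidable_pred (\<lambda>x :: nat \<times> 'v::encodable \<times> 'v edge list \<times> 'v rank_step.
     step_ok (fst x) (fst (snd x)) (fst (snd (snd x))) (snd (snd (snd x))))"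
  unfolding step_ok_def drift_def by (intro comp_intros)

lemma computable_step_edges:
  "computable (\<lambda>x :: nat \<times> 'v::encodable edge list \<times> 'v rank_step.
     step_edges (fst x) (fst (snd x)) (snd (snd x)))"
  unfolding step_edges_def drift_def by (intro comp_intros)

text \<open>The loop state is a flag and the current edge list; an arbitrary initial flag
  \<open>k\<close> makes the induction go through.\<close>

lemma blocked_foldl:
  "blocked d v E ss \<and> k = 1 \<longleftrightarrow>
    (\<forall>e\<in>set (snd (foldl (\<lambda>a s. (if step_ok d v (snd a) s \<and> fst a = 1 then 1 else 0 :: nat,
      step_edges d (snd a) s)) (k, E) ss)). src e \<noteq> v) \<and>
    fst (foldl (\<lambda>a s. (if step_ok d v (snd a) s \<and> fst a = 1 then 1 else 0 :: nat,
      step_edges d (snd a) s)) (k, E) ss) = 1"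
proof (induction ss arbitrary: k E)
  case (Cons s ss)
  show ?case
    unfolding foldl_Cons fst_conv snd_conv Cons.IH[symmetric] by auto
qed auto

lemma decidable_blocked:
  "decidable_pred (\<lambda>x :: nat \<times> 'v::encodable \<times> 'v edge list \<times> 'v rank_step list.
     blocked (fst x) (fst (snd x)) (fst (snd (snd x))) (snd (snd (snd x))))"
proof -
  have eq: "blocked d v E ss \<longleftrightarrow>
    (\<forall>e\<in>set (snd (foldl (\<lambda>a s. (if step_ok d v (snd a) s \<and> fst a = 1 then 1 else 0 :: nat,
      step_edges d (snd a) s)) (1, E) ss)). src e \<noteq> v) \<and>
    fst (foldl (\<lambda>a s. (if step_ok d v (snd a) s \<and> fst a = 1 then 1 else 0 :: nat,
      step_edges d (snd a) s)) (1, E) ss) = 1" for d and v :: 'v and E ss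
    using blocked_foldl[of d v E ss 1] by simp
  have 1: "decidable_pred (\<lambda>x. step_ok (d x) (v x) (E x) (s x))"
    if "computable d" "computable v" "computable E" "computable s"
    for d and v :: "'a::encodable \<Rightarrow> 'v" and E s
    using decidable_pred_comp[OF decidable_step_ok, of "\<lambda>x. (d x, v x, E x, s x)"] that
    by (simp add: comp_intros)
  have 2: "computable (\<lambda>x. step_edges (d x) (E x) (s x))"
    if "computable d" "computable E" "computable s"
    for d and E :: "'a::encodable \<Rightarrow> 'v edge list" and s
    using computable_comp[OF computable_step_edges, of "\<lambda>x. (d x, E x, s x)"] that
    by (simp add: comp_intros)
  show ?thesis unfolding eq by (intro 1 2 comp_intros)
qed

lemma decidable_pred_blocked [comp_intros]:
  fixes v :: "'a::encodable \<Rightarrow> 'v::encodable"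
  assumes "computable d" "computable v" "computable E" "computable ss"
  shows "decidable_pred (\<lambda>x. blocked (d x) (v x) (E x) (ss x))"
  using decidable_pred_comp[OF decidable_blocked, of "\<lambda>x. (d x, v x, E x, ss x)"] assms
  by (simp add: comp_intros)

lemma decidable_pred_ok_vec [comp_intros]:
  assumes "computable d" "computable B" "computable u" "computable z"
  shows "decidable_pred (\<lambda>x. ok_vec (d x) (B x) (u x) (z x))"
proof -
  have "decidable_pred (\<lambda>x. ok_vec (fst x) (fst (snd x)) (fst (snd (snd x))) (snd (snd (snd x))))"
    unfolding ok_vec_def by (intro comp_intros)
  from decidable_pred_comp[OF this, of "\<lambda>x. (d x, B x, u x, z x)"] show ?thesis
    using assms by (simp add: comp_intros)
qed

lemma computable_sat_vec [comp_intros]: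
  assumes "computable d" "computable B" "computable u" "computable z"
  shows "computable (\<lambda>x. sat_vec (d x) (B x) (u x) (z x))"
proof -
  have "computable (\<lambda>x. sat_vec (fst x) (fst (snd x)) (fst (snd (snd x))) (snd (snd (snd x))))"
    unfolding sat_vec_def sat_def by (intro comp_intros)
  from computable_comp[OF this, of "\<lambda>x. (d x, B x, u x, z x)"] show ?thesis
    using assms by (simp add: comp_intros)
qed

lemma decidable_lose_ok:
  "decidable_pred (\<lambda>x :: nat \<times> 'v::encodable list \<times> 'v \<times> 'v edge list \<times> ('v \<times> nat list) \<times> 'v lose_cert.
     lose_ok (fst x) (fst (snd x)) (fst (snd (snd x))) (fst (snd (snd (snd x))))
       (fst (snd (snd (snd (snd x))))) (snd (snd (snd (snd (snd x))))))"
  unfolding lose_ok_def sat_edge_def case_prod_beta by (intro comp_intros)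

section \<open>Problem instances\<close>

lemma decidable_pred_distinct [comp_intros]:
  fixes l :: "'a::encodable \<Rightarrow> 'b::encodable list"
  assumes l: "computable l"
  shows "decidable_pred (\<lambda>x. distinct (l x))"
proof -
  have eq: "distinct xs \<longleftrightarrow> (\<forall>i<length xs. \<forall>j<i. nth_default c xs i \<noteq> nth_default c xs j)"
    for xs and c :: 'b
  proof -
    have "distinct xs \<longleftrightarrow> (\<forall>i<length xs. \<forall>j<i. xs ! i \<noteq> xs ! j)"
      unfolding distinct_conv_nth
    proof (intro iffI allI impI)
      fix i j assume *: "\<forall>i<length xs. \<forall>j<i. xs ! i \<noteq> xs ! j" and "i < length xs" "j < length xs" "i \<noteq> j"
      then show "xs ! i \<noteq> xs ! j" using *[rule_format, of i j] *[rule_format, of j i] by (metis linorder_neqE_nat)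
    qed auto
    then show ?thesis by (simp add: nth_default_def)
  qed
  have "decidable_pred (\<lambda>xs :: 'b list. distinct xs)"
    unfolding eq[of _ undefined] by (intro comp_intros)
  then show ?thesis using l by (rule decidable_pred_comp)
qed

text \<open>Zero vectors are built by mapping over \<open>[0..<d]\<close> because computability
  rules for \<open>map\<close> and \<open>upt\<close> are at hand.\<close>

definition edges_of :: "bool \<Rightarrow> problem_instance \<Rightarrow> nat edge list" where
  "edges_of b = (\<lambda>((d, q1s, qPs, tws), c, f).
     if b then (f, map (\<lambda>_. 0) [0..<d], f) # filter (\<lambda>e. src e \<noteq> f) (map fst tws) else map fst tws)"

definition player1_wins :: "bool \<Rightarrow> problem_instance \<Rightarrow> bool" where
  "player1_wins b I = (case I of ((d, q1s, qPs, tws), c, f) \<Rightarrow>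
     cfg c \<in> win d (set qPs) {f} (set (edges_of b I)))"

definition valid :: "problem_instance \<Rightarrow> bool" where
  "valid = (\<lambda>((d, q1s, qPs, tws), c, f).
     distinct (map fst tws) \<and> (\<forall>q\<in>set q1s. q \<notin> set qPs) \<and>
     (\<forall>tw\<in>set tws. src (fst tw) \<in> set (q1s @ qPs) \<and> length (lab (fst tw)) = d \<and>
        tgt (fst tw) \<in> set (q1s @ qPs) \<and> 0 < snd tw \<and>
        (src (fst tw) \<in> set qPs \<longrightarrow> lab (fst tw) = map (\<lambda>_. 0) [0..<d])) \<and>
     fst c \<in> set (q1s @ qPs) \<and> length (snd c) = d \<and> f \<in> set (q1s @ qPs))"

lemma valid_iff: "valid I \<longleftrightarrow> I \<in> one_vass_mdp_instances"
proof -
  obtain d q1s qPs tws c f where I: "I = ((d, q1s, qPs, tws), c, f)" by (metis surj_pair)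
  let ?S = "vass_of (d, q1s, qPs, tws)"
  have S: "dim ?S = d" "states1 ?S = set q1s" "statesP ?S = set qPs" "transitions ?S = fst ` set tws"
    "states ?S = set q1s \<union> set qPs"
    by (simp_all add: vass_of_def states_def)
  have weight: "weight ?S (fst tw) = snd tw" if "distinct (map fst tws)" "tw \<in> set tws" for tw
    using that by (simp add: vass_of_def map_of_eq_Some_iff[THEN iffD2, of tws "fst tw" "snd tw"])
  have rep: "map (\<lambda>_. 0) [0..<n] = replicate n (0::int)" for n by (simp add: map_replicate_const)
  show ?thesis
  proof (cases "distinct (map fst tws)")
    case True
    have disj: "set q1s \<inter> set qPs = {} \<longleftrightarrow> (\<forall>q\<in>set q1s. q \<notin> set qPs)" by blast
    have "vass_mdp ?S \<longleftrightarrow> (\<forall>q\<in>set q1s. q \<notin> set qPs) \<and> (\<forall>tw\<in>set tws. src (fst tw) \<in> set q1s \<union> set qPs \<and>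
        length (lab (fst tw)) = d \<and> tgt (fst tw) \<in> set q1s \<union> set qPs \<and> 0 < snd tw)"
    proof -
      have "fst ` set tws \<subseteq> (set q1s \<union> set qPs) \<times> {z. length z = d} \<times> (set q1s \<union> set qPs) \<longleftrightarrow>
          (\<forall>tw\<in>set tws. src (fst tw) \<in> set q1s \<union> set qPs \<and> length (lab (fst tw)) = d \<and>
            tgt (fst tw) \<in> set q1s \<union> set qPs)"
        by (simp add: image_subset_iff mem_Times_iff)
      moreover have "(\<forall>t\<in>fst ` set tws. 0 < weight ?S t) \<longleftrightarrow> (\<forall>tw\<in>set tws. 0 < snd tw)"
        using weight[OF True] by simp
      moreover have "finite (set q1s \<union> set qPs)" "finite (fst ` set tws)" by simp_all
      ultimately show ?thesis
        unfolding vass_mdp_def S disj by (simp only: ball_conj_distrib conj_assoc simp_thms)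
    qed
    moreover have "(\<forall>(q, z, q')\<in>fst ` set tws. q \<in> set qPs \<longrightarrow> z = replicate d 0) \<longleftrightarrow>
        (\<forall>tw\<in>set tws. src (fst tw) \<in> set qPs \<longrightarrow> lab (fst tw) = replicate d 0)" by fastforce
    ultimately have "one_vass_mdp ?S \<longleftrightarrow> (\<forall>q\<in>set q1s. q \<notin> set qPs) \<and> (\<forall>tw\<in>set tws. src (fst tw) \<in> set (q1s @ qPs) \<and>
        length (lab (fst tw)) = d \<and> tgt (fst tw) \<in> set (q1s @ qPs) \<and> 0 < snd tw \<and>
        (src (fst tw) \<in> set qPs \<longrightarrow> lab (fst tw) = map (\<lambda>_. 0) [0..<d]))"
      unfolding one_vass_mdp_def S rep set_append by (simp only: ball_conj_distrib conj_assoc)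
    then show ?thesis
      unfolding I valid_def one_vass_mdp_instances_def proper_desc_def
      using True by (simp only: split mem_Collect_eq confs_induced S set_append conj_assoc simp_thms)
  next
    case False
    then show ?thesis unfolding I valid_def one_vass_mdp_instances_def proper_desc_def by simp
  qed
qed

lemma
  assumes "valid ((d, q1s, qPs, tws), c, f)"
  shows player1_wins_reach: "player1_wins True ((d, q1s, qPs, tws), c, f) \<longleftrightarrow> sure_reachable (vass_of (d, q1s, qPs, tws)) c f"
    and player1_wins_repeated: "player1_wins False ((d, q1s, qPs, tws), c, f) \<longleftrightarrow>
      sure_repeatedly_reachable (vass_of (d, q1s, qPs, tws)) c f"
    and static_edges_of: "static d (set qPs) (set (edges_of b ((d, q1s, qPs, tws), c, f)))"
    and valid_length: "length (snd c) = d"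
proof -
  let ?S = "vass_of (d, q1s, qPs, tws)"
  have S: "dim ?S = d" "statesP ?S = set qPs" "transitions ?S = fst ` set tws"
    by (simp_all add: vass_of_def)
  have V: "one_vass_mdp ?S" "c \<in> confs (induced_mdp ?S)"
    using assms unfolding valid_iff one_vass_mdp_instances_def by auto
  have rep: "map (\<lambda>_. 0) [0..<n] = replicate n (0::int)" for n by (simp add: map_replicate_const)
  have abs: "absorbing d f (fst ` set tws) = set (edges_of True ((d, q1s, qPs, tws), c, f))"
    unfolding absorbing_def edges_of_def by (auto simp: rep)
  show "player1_wins True ((d, q1s, qPs, tws), c, f) \<longleftrightarrow> sure_reachable ?S c f"
    unfolding sure_reachable_iff_win[OF V] S abs player1_wins_def by simp
  show "player1_wins False ((d, q1s, qPs, tws), c, f) \<longleftrightarrow> sure_repeatedly_reachable ?S c f"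
    unfolding sure_repeatedly_reachable_iff_win[OF V] S player1_wins_def edges_of_def by simp
  have "coord (lab (fst tw)) i = 0" if "tw \<in> set tws" "src (fst tw) \<in> set qPs" for tw i
  proof -
    have "lab (fst tw) = replicate d 0" using assms that unfolding valid_def by (simp add: rep)
    then show ?thesis by simp
  qed
  then have "static d (set qPs) (fst ` set tws)" unfolding static_def by blast
  then show "static d (set qPs) (set (edges_of b ((d, q1s, qPs, tws), c, f)))"
    unfolding static_def edges_of_def by (auto simp: rep)
  show "length (snd c) = d" using assms unfolding valid_def by auto
qed

lemma decidable_player1_wins: "decidable_pred (\<lambda>I. valid I \<and> player1_wins b I)"
proof (rule Post_theorem)
  let ?d = "\<lambda>I :: problem_instance. fst (fst I)" and ?P = "\<lambda>I :: problem_instance. fst (snd (snd (fst I)))"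
    and ?f = "\<lambda>I :: problem_instance. snd (snd I)" and ?c = "\<lambda>I :: problem_instance. fst (snd I)"
  define R where "R I w \<longleftrightarrow> valid I \<and> win_ok (?d I) (?P I) (?f I) (edges_of b I) (?c I) w" for I :: problem_instance and w
  \<comment> \<open>On an invalid instance every certificate refutes.\<close>
  define Q where "Q I w \<longleftrightarrow> valid I \<longrightarrow> lose_ok (?d I) (?P I) (?f I) (edges_of b I) (?c I) w" for I :: problem_instance and w
  have valid: "decidable_pred valid"
    unfolding valid_def case_prod_beta by (intro comp_intros)
  have edges: "computable (edges_of b)"
    unfolding edges_of_def case_prod_beta by (cases b) (simp_all, (intro comp_intros)+)
  note arg = computable_fst[OF computable_id]
  show "decidable_pred (\<lambda>p. R (fst p) (snd p))"
  proof -
    have "computable (\<lambda>p. (?d (fst p), ?P (fst p), ?f (fst p), edges_of b (fst p), ?c (fst p), snd p))"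
      by (intro comp_intros computable_comp[OF edges arg])
    from decidable_pred_comp[OF decidable_win_ok this] show ?thesis
      unfolding R_def fst_conv snd_conv by (intro comp_intros decidable_pred_comp[OF valid arg])
  qed
  show "decidable_pred (\<lambda>p. Q (fst p) (snd p))"
  proof -
    have "computable (\<lambda>p. (?d (fst p), ?P (fst p), ?f (fst p), edges_of b (fst p), ?c (fst p), snd p))"
      by (intro comp_intros computable_comp[OF edges arg])
    from decidable_pred_comp[OF decidable_lose_ok this] show ?thesis
      unfolding Q_def fst_conv snd_conv by (intro comp_intros decidable_pred_comp[OF valid arg])
  qed
  fix I :: problem_instance
  obtain d q1s qPs tws c f where I: "I = ((d, q1s, qPs, tws), c, f)" by (metis surj_pair)
  show "(valid I \<and> player1_wins b I) = (\<exists>w. R I w)"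
  proof -
    have "(\<exists>w. win_ok d qPs f E c w) \<longleftrightarrow> cfg c \<in> win d (set qPs) {f} (set E)" for E
      using win_ok_sound[of d qPs f E c] win_ok_complete[of c d qPs f E] by blast
    then show ?thesis unfolding R_def player1_wins_def I by simp
  qed
  show "(\<not> (valid I \<and> player1_wins b I)) = (\<exists>w. Q I w)"
  proof (cases "valid I")
    case True
    note v = True[unfolded I]
    obtain q v where c: "c = (q, v)" by fastforce
    have "(\<exists>w. lose_ok d qPs f (edges_of b I) c w) \<longleftrightarrow> cfg c \<notin> win d (set qPs) {f} (set (edges_of b I))"
      using lose_ok_sound[OF static_edges_of[OF v, of b]] lose_ok_complete[OF static_edges_of[OF v, of b]]
        valid_length[OF v] unfolding I c by auto
    then show ?thesis unfolding Q_def player1_wins_def using True unfolding I by simp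
  next
    case False
    then show ?thesis unfolding Q_def by simp
  qed
qed

section \<open>Decoding problem instances\<close>

lemma list_encode_enc: "list_encode xs = enc xs"
  by (simp add: enc_list_def enc_nat_def[abs_def] map_idI)

lemma enc_map_int_encode: "enc (map int_encode z) = enc z"
  by (simp add: enc_list_def enc_int_def[abs_def] enc_nat_def[abs_def])

definition decode_transition :: "nat \<Rightarrow> nat transition \<times> nat" where
  "decode_transition n = ((entry (dec n) 0, dec (entry (dec n) 1), entry (dec n) 2), entry (dec n) 3)"

definition decode_vass :: "nat \<Rightarrow> vass_desc" where
  "decode_vass n = (entry (dec n) 0, dec (entry (dec n) 1), dec (entry (dec n) 2),
     map decode_transition (dec (entry (dec n) 3)))"

definition decode_instance :: "nat \<Rightarrow> problem_instance" where
  "decode_instance n = (decode_vass (entry (dec n) 0), (entry (dec n) 1, dec (entry (dec n) 2)), entry (dec n) 3)"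

lemma entry_list4: "entry [a, b, c, d] 0 = a" "entry [a, b, c, d] (Suc 0) = b"
  "entry [a, b, c, d] 2 = c" "entry [a, b, c, d] 3 = d"
  by (simp_all add: nth_default_def numeral_2_eq_2 numeral_3_eq_3)

lemma decode_transition_encode: "decode_transition (encode_transition tw) = tw"
  by (cases tw) (auto simp: decode_transition_def encode_transition_def list_encode_enc
      enc_map_int_encode entry_list4)

lemma decode_instance_encode: "decode_instance (encode_instance I) = I"
proof -
  obtain d q1s qPs tws q v f where I: "I = ((d, q1s, qPs, tws), (q, v), f)" by (metis surj_pair)
  have "map (\<lambda>tw. decode_transition (encode_transition tw)) tws = tws"
    by (simp add: decode_transition_encode)
  then show ?thesis
    unfolding I decode_instance_def encode_instance_def decode_vass_def encode_vass_def split
    by (simp add: list_encode_enc entry_list4 comp_def)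
qed

lemma decidable_image_encode_instance:
  assumes "decidable_pred X"
  shows "decidable (encode_instance ` {I. X I})"
proof -
  have dt: "computable decode_transition"
    unfolding decode_transition_def by (intro comp_intros)
  have et: "computable encode_transition"
    unfolding encode_transition_def list_encode_enc enc_map_int_encode case_prod_beta by (intro comp_intros)
  note arg = computable_snd[OF computable_id]
  have di: "computable decode_instance"
    unfolding decode_instance_def decode_vass_def
    by (intro comp_intros computable_comp[OF dt arg])
  have ei: "computable encode_instance"
    unfolding encode_instance_def encode_vass_def list_encode_enc case_prod_beta
    by (intro comp_intros computable_comp[OF et arg])
  \<comment> \<open>Decoding is total, so a number that is no code is detected by encoding again and
    comparing.\<close>
  have eq: "n \<in> encode_instance ` {I. X I} \<longleftrightarrow> X (decode_instance n) \<and> encode_instance (decode_instance n) = n" for n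
    using decode_instance_encode by force
  show ?thesis
    unfolding decidable_iff eq
    by (intro comp_intros decidable_pred_comp[OF assms di] computable_comp[OF ei di])
qed

theorem theorem6:
  shows "decidable sure_reachability_problem \<and> decidable sure_repeated_reachability_problem"
proof
  have "{(D, c, f) \<in> one_vass_mdp_instances. sure_reachable (vass_of D) c f} = {I. valid I \<and> player1_wins True I}"
    using player1_wins_reach unfolding valid_iff by fastforce
  then show "decidable sure_reachability_problem"
    unfolding sure_reachability_problem_def
    using decidable_image_encode_instance[OF decidable_player1_wins[of True]] by simp
  have "{(D, c, f) \<in> one_vass_mdp_instances. sure_repeatedly_reachable (vass_of D) c f} =
      {I. valid I \<and> player1_wins False I}"
    using player1_wins_repeated unfolding valid_iff by fastforce
  then show "decidable sure_repeated_reachability_problem"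
    unfolding sure_repeated_reachability_problem_def
    using decidable_image_encode_instance[OF decidable_player1_wins[of False]] by simp
qed

end
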